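(* Let $(M,H)$ be an $n$-dimensional Carnot manifold and $X=(X_1,\ldots,X_n)$ an $H$-frame over the domain of a local chart, identified through the chart with an open set $U\subset\mathbb{R}^n$. For $x\in U$, let $\varepsilon_x:\mathbb{R}^n\to\mathbb{R}^n$ be the $\varepsilon$-Carnot coordinate map at $x$ associated with these coordinates and the frame $X$. Then the maps $(x,y)\mapsto\varepsilon_x(y)$ and $(x,y)\mapsto\varepsilon_x^{-1}(y)$ are smooth maps from $U\times\mathbb{R}^n$ to $\mathbb{R}^n$.
   Context: A Carnot manifold of step $r$ is an $n$-manifold $M$ with a filtration by subbundles $H_1\subset\cdots\subset H_r=TM$ such that the Lie bracket of local sections of $H_w$ and $H_{w'}$ is a section of $H_{w+w'}$ whenever $w+w'\le r$. Weights: $w_j=\min\{w: j\le\mathrm{rk}\,H_w\}$. An $H$-frame over an open set is a tangent frame $(X_1,\ldots,X_n)$ over it with each $X_j$ a section of $H_{w_j}$. For $\alpha\in\mathbb{N}_0^n$: $|\alpha|=\sum\alpha_j$, $\langle\alpha\rangle=\sum w_j\alpha_j$. The $\varepsilon$-Carnot coordinate map at a point $a$. For $I=(i_1,\ldots,i_k)$, $k\ge0$: $X_I=X_{i_1}\cdots X_{i_k}$, $\langle I\rangle=\sum_l w_{i_l}$. A smooth $f$ has order $N$ at $a$ if $X_If(a)=0$ whenever $\langle I\rangle<N$ and $X_If(a)\neq0$ for some $I$ with $\langle I\rangle=N$. Coordinates centered at $a$ are linearly adapted if $X_j(0)=\partial_j$ for all $j$, and privileged at $a$ if moreover each $x_j$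 has order $w_j$ at $a$. With $\delta_t(x)=t\cdot x=(t^{w_1}x_1,\ldots,t^{w_n}x_n)$ and $\delta_t^*(\sum a_j(x)\partial_j)=\sum t^{-w_j}a_j(t\cdot x)\partial_j$, in privileged coordinates $t^{w_j}\delta_t^*X_j$ converges as $t\to0$ ($C^\infty$ on compact sets) to a polynomial vector field $X_j^{(a)}$ on $\mathbb{R}^n$ (model vector field). Given local coordinates near $a$, $T_a$ is the unique affine map such that $x\mapsto T_a(x)$ gives coordinates centered at $a$ and linearly adapted; $\hat\psi_a$ is the unique polynomial map with components $\hat\psi_a(y)_k=y_k+\sum_{\langle\alpha\rangle<w_k,|\alpha|\ge2}a_{k\alpha}y^\alpha$ converting these coordinates into privileged coordinates at $a$ (known to exist); $\psi_a=\hat\psi_a\circ T_a$; $X_j^{(a)}$ are the model vector fields in the coordinates given by $\psi_a$; $\exp_{X^{(a)}}(x)$ is the time-one flow of $\sum x_jX_j^{(a)}$ starting at $0$, a diffeomorphism of $\mathbb{R}^n$. Then $\varepsilon_a=\exp_{X^{(a)}}^{-1}\circ\psi_a:\mathbb{R}^n\to\mathbb{R}^n$, a diffeomorphism. *)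

theory Defs
  imports "HOL-Analysis.Analysis"
begin

section \<open>Smooth maps between open subsets of Euclidean spaces\<close>

text \<open>Meant for open \<open>S\<close> in a finite-dimensional space, where it is the usual class \<open>C\<^sup>k\<close>.\<close>

primrec C_diff_on ::
    "nat \<Rightarrow> 'a::real_normed_vector set \<Rightarrow> ('a \<Rightarrow> 'b::real_normed_vector) \<Rightarrow> bool" where
  "C_diff_on 0 S f \<longleftrightarrow> continuous_on S f"
| "C_diff_on (Suc k) S f \<longleftrightarrow>
     (\<forall>x\<in>S. f differentiable (at x)) \<and>
     (\<forall>v. C_diff_on k S (\<lambda>x. frechet_derivative f (at x) v))"

definition smooth_on ::
    "'a::real_normed_vector set \<Rightarrow> ('a \<Rightarrow> 'b::real_normed_vector) \<Rightarrow> bool" where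
  "smooth_on S f \<longleftrightarrow> (\<forall>k. C_diff_on k S f)"

section \<open>Carnot manifolds\<close>

text \<open>A chart is a pair of its domain and its coordinate map; the latter is irrelevant outside
  the domain. The index type \<open>'n\<close> is finite and linearly ordered, so it plays the role of
  \<open>{1..n}\<close> with \<open>n = CARD('n)\<close>.\<close>

type_synonym ('m, 'n) chart = "'m set \<times> ('m \<Rightarrow> real^'n)"

definition transition ::
    "('m, 'n::finite) chart \<Rightarrow> ('m, 'n) chart \<Rightarrow> real^'n \<Rightarrow> real^'n" where
  "transition c c' = snd c' \<circ> inv_into (fst c) (snd c)"

locale smooth_manifold =
  fixes M :: "'m topology" and A :: "('m, 'n::finite) chart set"
  assumes Hausdorff: "Hausdorff_space M"
    and second_countable: "second_countable M"
    and cover: "(\<Union>c\<in>A. fst c) = topspace M"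
    and chart_domain: "(D, \<phi>) \<in> A \<Longrightarrow> openin M D"
    and chart_image: "(D, \<phi>) \<in> A \<Longrightarrow> open (\<phi> ` D)"
    and chart_homeomorphic:
      "(D, \<phi>) \<in> A \<Longrightarrow> homeomorphic_map (subtopology M D) (top_of_set (\<phi> ` D)) \<phi>"
    and transition_smooth:
      "\<lbrakk>(D, \<phi>) \<in> A; (E, \<theta>) \<in> A\<rbrakk> \<Longrightarrow>
         smooth_on (\<phi> ` (D \<inter> E)) (transition (D, \<phi>) (E, \<theta>))"

text \<open>A vector field on an open set \<open>U\<close> of \<open>\<real>\<^sup>n\<close> is the function of its components; values outside
  \<open>U\<close> are irrelevant.\<close>

type_synonym 'n vfield = "real^'n \<Rightarrow> real^'n"

definition lie_bracket :: "'n::finite vfield \<Rightarrow> 'n vfield \<Rightarrow> 'n vfield" where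
  "lie_bracket Y Z = (\<lambda>x. frechet_derivative Z (at x) (Y x) - frechet_derivative Y (at x) (Z x))"

definition smooth_section_on ::
    "(real^'n::finite) set \<Rightarrow> (real^'n \<Rightarrow> (real^'n) set) \<Rightarrow> 'n vfield \<Rightarrow> bool" where
  "smooth_section_on V E Y \<longleftrightarrow> smooth_on V Y \<and> (\<forall>x\<in>V. Y x \<in> E x)"

text \<open>Smooth subbundle of rank \<open>d\<close> of the (trivial) tangent bundle of an open set \<open>U\<close>.\<close>

definition subbundle_on ::
    "(real^'n::finite) set \<Rightarrow> nat \<Rightarrow> (real^'n \<Rightarrow> (real^'n) set) \<Rightarrow> bool" where
  "subbundle_on U d E \<longleftrightarrow>
     (\<forall>x\<in>U. \<exists>V B. open V \<and> x \<in> V \<and> V \<subseteq> U \<and>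
        (\<forall>i<d. smooth_on V (B i)) \<and>
        (\<forall>y\<in>V. inj_on (\<lambda>i::nat. B i y) {..<d} \<and> independent ((\<lambda>i. B i y) ` {..<d}) \<and>
               span ((\<lambda>i. B i y) ` {..<d}) = E y))"

text \<open>The tangent bundle is glued from the sets \<open>\<phi> ` D \<times> \<real>\<^sup>n\<close> along the Jacobians of the
  transition maps, so a subbundle of \<open>TM\<close> is given by its coordinate expressions in the charts:
  \<open>H c w x\<close> is the fibre of \<open>H\<^sub>w\<close> at the point with coordinates \<open>x\<close> in the chart \<open>c\<close>, and \<open>rk w\<close> is
  the rank of \<open>H\<^sub>w\<close>. Since brackets are local and coordinate invariant, the bracket condition
  need only be imposed on sections over subsets of chart domains. Only \<open>1 \<le> w \<le> r\<close> matters.\<close>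

locale carnot_manifold = smooth_manifold M A
  for M :: "'m topology" and A :: "('m, 'n::{finite,linorder}) chart set" +
  fixes r :: nat and rk :: "nat \<Rightarrow> nat"
    and H :: "('m, 'n) chart \<Rightarrow> nat \<Rightarrow> (real, 'n) vec \<Rightarrow> (real, 'n) vec set"
  assumes step: "1 \<le> r"
    and subbundle:
      "\<lbrakk>(D, \<phi>) \<in> A; 1 \<le> w; w \<le> r\<rbrakk> \<Longrightarrow> subbundle_on (\<phi> ` D) (rk w) (H (D, \<phi>) w)"
    and compatible:
      "\<lbrakk>(D, \<phi>) \<in> A; (E, \<theta>) \<in> A; p \<in> D; p \<in> E; 1 \<le> w; w \<le> r\<rbrakk> \<Longrightarrow>
         H (E, \<theta>) w (\<theta> p) =
         frechet_derivative (transition (D, \<phi>) (E, \<theta>)) (at (\<phi> p)) ` H (D, \<phi>) w (\<phi> p)"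
    and filtration:
      "\<lbrakk>(D, \<phi>) \<in> A; x \<in> \<phi> ` D; 1 \<le> w; w < r\<rbrakk> \<Longrightarrow> H (D, \<phi>) w x \<subseteq> H (D, \<phi>) (Suc w) x"
    and top: "\<lbrakk>(D, \<phi>) \<in> A; x \<in> \<phi> ` D\<rbrakk> \<Longrightarrow> H (D, \<phi>) r x = UNIV"
    and bracket:
      "\<lbrakk>(D, \<phi>) \<in> A; open V; V \<subseteq> \<phi> ` D; 1 \<le> w; 1 \<le> w'; w + w' \<le> r;
        smooth_section_on V (H (D, \<phi>) w) Y; smooth_section_on V (H (D, \<phi>) w') Z\<rbrakk> \<Longrightarrow>
         smooth_section_on V (H (D, \<phi>) (w + w')) (lie_bracket Y Z)"

text \<open>\<open>card {i. i \<le> j}\<close> is the position of \<open>j\<close> in \<open>1, \<dots>, n\<close>.\<close>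

definition weight :: "(nat \<Rightarrow> nat) \<Rightarrow> 'n::{finite,linorder} \<Rightarrow> nat" where
  "weight rk j = (LEAST w. 1 \<le> w \<and> card {i. i \<le> j} \<le> rk w)"

text \<open>An \<open>H\<close>-frame over an open set \<open>U\<close> of \<open>\<real>\<^sup>n\<close>, for weights \<open>w\<close> and fibres \<open>E k x\<close> of \<open>H\<^sub>k\<close>.\<close>

definition H_frame_on ::
    "(real^'n::finite) set \<Rightarrow> ('n \<Rightarrow> nat) \<Rightarrow> (nat \<Rightarrow> real^'n \<Rightarrow> (real^'n) set) \<Rightarrow>
     ('n \<Rightarrow> 'n vfield) \<Rightarrow> bool" where
  "H_frame_on U w E X \<longleftrightarrow>
     (\<forall>j. smooth_section_on U (E (w j)) (X j)) \<and>
     (\<forall>x\<in>U. inj (\<lambda>j. X j x) \<and> independent (range (\<lambda>j. X j x)) \<and>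
            span (range (\<lambda>j. X j x)) = UNIV)"

section \<open>Privileged coordinates\<close>

definition vf_apply :: "'n::finite vfield \<Rightarrow> (real^'n \<Rightarrow> real) \<Rightarrow> real^'n \<Rightarrow> real" where
  "vf_apply Y f = (\<lambda>x. frechet_derivative f (at x) (Y x))"

definition vf_word ::
    "('n::finite \<Rightarrow> 'n vfield) \<Rightarrow> 'n list \<Rightarrow> (real^'n \<Rightarrow> real) \<Rightarrow> real^'n \<Rightarrow> real" where
  "vf_word X I f = foldr (\<lambda>i. vf_apply (X i)) I f"

definition word_weight :: "('n \<Rightarrow> nat) \<Rightarrow> 'n list \<Rightarrow> nat" where
  "word_weight w I = (\<Sum>i\<leftarrow>I. w i)"

definition has_order_at ::
    "('n::finite \<Rightarrow> nat) \<Rightarrow> ('n \<Rightarrow> 'n vfield) \<Rightarrow> real^'n \<Rightarrow> (real^'n \<Rightarrow> real) \<Rightarrow> nat \<Rightarrow> bool" where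
  "has_order_at w X a f N \<longleftrightarrow>
     (\<forall>I. word_weight w I < N \<longrightarrow> vf_word X I f a = 0) \<and>
     (\<exists>I. word_weight w I = N \<and> vf_word X I f a \<noteq> 0)"

definition local_coords :: "(real^'n::finite) set \<Rightarrow> (real^'n \<Rightarrow> real^'n) \<Rightarrow> bool" where
  "local_coords V \<phi> \<longleftrightarrow> open V \<and> open (\<phi> ` V) \<and> inj_on \<phi> V \<and>
     smooth_on V \<phi> \<and> smooth_on (\<phi> ` V) (inv_into V \<phi>)"

text \<open>The vector field \<open>Y\<close> on \<open>V\<close> expressed in the coordinates \<open>\<phi>\<close>, i.e. its pushforward to
  \<open>\<phi> ` V\<close>.\<close>

definition in_coords ::
    "(real^'n::finite) set \<Rightarrow> (real^'n \<Rightarrow> real^'n) \<Rightarrow> 'n vfield \<Rightarrow> 'n vfield" where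
  "in_coords V \<phi> Y = (\<lambda>y. let x = inv_into V \<phi> y in frechet_derivative \<phi> (at x) (Y x))"

text \<open>Below, \<open>X\<close> is a frame over the open set \<open>U\<close>; coordinates near \<open>a\<close> are defined on some
  neighbourhood of \<open>a\<close> in \<open>U\<close>.\<close>

definition linearly_adapted_at ::
    "(real^'n::finite) set \<Rightarrow> ('n \<Rightarrow> 'n vfield) \<Rightarrow> real^'n \<Rightarrow> (real^'n \<Rightarrow> real^'n) \<Rightarrow> bool" where
  "linearly_adapted_at U X a \<phi> \<longleftrightarrow>
     (\<exists>V\<subseteq>U. a \<in> V \<and> local_coords V \<phi> \<and> \<phi> a = 0 \<and>
        (\<forall>j. in_coords V \<phi> (X j) 0 = axis j 1))"

definition privileged_at ::
    "(real^'n::finite) set \<Rightarrow> ('n \<Rightarrow> nat) \<Rightarrow> ('n \<Rightarrow> 'n vfield) \<Rightarrow> real^'n \<Rightarrow>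
     (real^'n \<Rightarrow> real^'n) \<Rightarrow> bool" where
  "privileged_at U w X a \<phi> \<longleftrightarrow>
     linearly_adapted_at U X a \<phi> \<and> (\<forall>j. has_order_at w X a (\<lambda>x. \<phi> x $ j) (w j))"

section \<open>The \<open>\<epsilon>\<close>-Carnot coordinate map\<close>

definition affine_map :: "(real^'n::finite \<Rightarrow> real^'n) \<Rightarrow> bool" where
  "affine_map T \<longleftrightarrow> (\<exists>L b. linear L \<and> T = (\<lambda>x. L x + b))"

definition T_map ::
    "(real^'n::finite) set \<Rightarrow> ('n \<Rightarrow> 'n vfield) \<Rightarrow> real^'n \<Rightarrow> real^'n \<Rightarrow> real^'n" where
  "T_map U X a = (THE T. affine_map T \<and> linearly_adapted_at U X a T)"

text \<open>The index set of the sum is finite whenever all weights are positive.\<close>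

definition psi_hat_form :: "('n::finite \<Rightarrow> nat) \<Rightarrow> (real^'n \<Rightarrow> real^'n) \<Rightarrow> bool" where
  "psi_hat_form w P \<longleftrightarrow>
     (\<exists>c :: 'n \<Rightarrow> ('n \<Rightarrow> nat) \<Rightarrow> real. \<forall>y k.
        P y $ k = y $ k +
          (\<Sum>\<alpha> | (\<Sum>j\<in>UNIV. w j * \<alpha> j) < w k \<and> 2 \<le> (\<Sum>j\<in>UNIV. \<alpha> j).
             c k \<alpha> * (\<Prod>j\<in>UNIV. y $ j ^ \<alpha> j)))"

definition psi_hat ::
    "(real^'n::finite) set \<Rightarrow> ('n \<Rightarrow> nat) \<Rightarrow> ('n \<Rightarrow> 'n vfield) \<Rightarrow> real^'n \<Rightarrow>
     real^'n \<Rightarrow> real^'n" where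
  "psi_hat U w X a = (THE P. psi_hat_form w P \<and> privileged_at U w X a (P \<circ> T_map U X a))"

definition psi_map ::
    "(real^'n::finite) set \<Rightarrow> ('n \<Rightarrow> nat) \<Rightarrow> ('n \<Rightarrow> 'n vfield) \<Rightarrow> real^'n \<Rightarrow>
     real^'n \<Rightarrow> real^'n" where
  "psi_map U w X a = psi_hat U w X a \<circ> T_map U X a"

definition dilation :: "('n::finite \<Rightarrow> nat) \<Rightarrow> real \<Rightarrow> real^'n \<Rightarrow> real^'n" where
  "dilation w t x = (\<chi> j. t ^ w j * x $ j)"

definition dilation_pullback :: "('n::finite \<Rightarrow> nat) \<Rightarrow> real \<Rightarrow> 'n vfield \<Rightarrow> 'n vfield" where
  "dilation_pullback w t Y = (\<lambda>x. \<chi> j. inverse (t ^ w j) * Y (dilation w t x) $ j)"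

text \<open>The model vector fields, in the privileged coordinates \<open>\<psi>\<^sub>a\<close> (a global diffeomorphism of
  \<open>\<real>\<^sup>n\<close>, restricted to \<open>U\<close>). For \<open>t\<close> close to \<open>0\<close> the point \<open>t \<cdot> x\<close> lies in the image of \<open>U\<close>.
  The limit also exists in \<open>C\<^sup>\<infinity>\<close> on compact sets and is then determined by the pointwise one.\<close>

definition model_vf ::
    "(real^'n::finite) set \<Rightarrow> ('n \<Rightarrow> nat) \<Rightarrow> ('n \<Rightarrow> 'n vfield) \<Rightarrow> real^'n \<Rightarrow> 'n \<Rightarrow> 'n vfield" where
  "model_vf U w X a j = (\<lambda>x. Lim (at 0)
     (\<lambda>t. t ^ w j *\<^sub>R dilation_pullback w t (in_coords U (psi_map U w X a) (X j)) x))"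

definition time_one_flow :: "'n::finite vfield \<Rightarrow> real^'n \<Rightarrow> real^'n" where
  "time_one_flow Y p = (THE q. \<exists>\<gamma> :: real \<Rightarrow> real^'n. \<gamma> 0 = p \<and> \<gamma> 1 = q \<and>
     (\<forall>t\<in>{0..1}. (\<gamma> has_vector_derivative Y (\<gamma> t)) (at t within {0..1})))"

definition exp_map :: "('n::finite \<Rightarrow> 'n vfield) \<Rightarrow> real^'n \<Rightarrow> real^'n" where
  "exp_map Z x = time_one_flow (\<lambda>y. \<Sum>j\<in>UNIV. x $ j *\<^sub>R Z j y) 0"

definition eps_carnot ::
    "(real^'n::finite) set \<Rightarrow> ('n \<Rightarrow> nat) \<Rightarrow> ('n \<Rightarrow> 'n vfield) \<Rightarrow> real^'n \<Rightarrow>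
     real^'n \<Rightarrow> real^'n" where
  "eps_carnot U w X a = inv (exp_map (model_vf U w X a)) \<circ> psi_map U w X a"

end

theory Submission
  imports Defs
begin


text \<open>All objects are made explicit enough to see their dependence on the base point \<open>a\<close>. The affine map
  \<open>T\<^sub>a\<close> is given by Cramer's rule. A commutator of two frame fields is a combination of frame fields of
  no larger weight, so privilegedness need only be tested on sorted words; on these the conditions
  on the coefficients of \<open>psi_hat\<close> form a linear system, triangular in the degree, with entries smooth in \<open>a\<close>.
  The order of vanishing with respect to \<open>X\<close> agrees with the weighted order in privileged
  coordinates, and Taylor's formula then identifies the model fields as polynomial fields whose
  coefficients are smooth in \<open>a\<close> and whose \<open>k\<close>-th component involves only coordinates of weight less
  than \<open>w k\<close>. For such triangular fields Picard iteration terminates, so the exponential map is again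
  triangular and polynomial with smooth coefficients, and triangular maps are inverted by a finite
  iteration that preserves smoothness.\<close>

section \<open>Calculus of smooth maps\<close>

text \<open>The affine map, the polynomial correction, the model fields and the flow are given by
  definite descriptions and limits, one base point at a time, which say nothing about dependence on
  \<open>a\<close>. Hence each is identified with a formula in \<open>(a, x)\<close>, and smoothness
  is proved jointly in both variables; only afterwards is \<open>x\<close> set equal to
  \<open>a\<close> where a coefficient requires it. The main obstacle is that privilege is a
  condition on words in the fields \<open>X j\<close>, whereas limits of dilated components are
  governed by Taylor coefficients, that is, by words in the coordinate fields. Passing from one to
  the other needs the inverse of the component matrix of the frame, whose entries have order
  \<open>w q - w k\<close>; as this may be negative, orders are integers. Both fixed point
  iterations, for inverse maps and for flows, gain one weight per step, so a number of steps
  exceeding the largest weight is enough.\<close>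

lemma frechet_derivative_eq: "(f has_derivative f') (at x) \<Longrightarrow> frechet_derivative f (at x) = f'"
  using frechet_derivative_at by metis

lemma has_derivative_frechet:
  "f differentiable (at x) \<Longrightarrow> (f has_derivative frechet_derivative f (at x)) (at x)"
  by (simp add: frechet_derivative_works)

lemma C_diff_on_subset: "C_diff_on k S f \<Longrightarrow> T \<subseteq> S \<Longrightarrow> C_diff_on k T f"
  by (induction k arbitrary: f) (auto intro: continuous_on_subset)

text \<open>Openness of \<open>S\<close> turns agreement on \<open>S\<close> into agreement near
  each of its points, so the derivatives agree on \<open>S\<close> as well and the induction
  continues with them.\<close>

lemma C_diff_on_cong:
  assumes "open S" "C_diff_on k S f" "\<And>x. x \<in> S \<Longrightarrow> f x = g x"
  shows "C_diff_on k S g"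
  using assms(2,3)
proof (induction k arbitrary: f g)
  case 0
  then show ?case by (simp cong: continuous_on_cong)
next
  case (Suc k)
  have d: "(g has_derivative frechet_derivative f (at x)) (at x)" if "x \<in> S" for x
    using Suc.prems that has_derivative_frechet[of f x]
      has_derivative_transform_within_open[OF _ \<open>open S\<close> that] by fastforce
  show ?case
    unfolding C_diff_on.simps
  proof (intro conjI ballI allI)
    fix x assume "x \<in> S"
    then show "g differentiable (at x)" using d differentiableI by blast
  next
    fix v
    have "C_diff_on k S (\<lambda>x. frechet_derivative f (at x) v)" using Suc.prems by simp
    then show "C_diff_on k S (\<lambda>x. frechet_derivative g (at x) v)"
      by (rule Suc.IH) (simp add: frechet_derivative_eq[OF d])
  qed
qed

lemma C_diff_on_SucI:
  assumes "open S" "\<And>x. x \<in> S \<Longrightarrow> (f has_derivative f' x) (at x)"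
    "\<And>v. C_diff_on k S (\<lambda>x. f' x v)"
  shows "C_diff_on (Suc k) S f"
  unfolding C_diff_on.simps
proof (intro conjI ballI allI)
  show "f differentiable (at x)" if "x \<in> S" for x
    using assms(2)[OF that] differentiableI by blast
  show "C_diff_on k S (\<lambda>x. frechet_derivative f (at x) v)" for v
    by (rule C_diff_on_cong[OF assms(1) assms(3)[of v]])
       (simp add: frechet_derivative_eq[OF assms(2)])
qed

lemma C_diff_on_SucD: "C_diff_on (Suc k) S f \<Longrightarrow> C_diff_on k S f"
proof (induction k arbitrary: f)
  case 0
  then show ?case
    by (auto intro!: continuous_at_imp_continuous_on differentiable_imp_continuous_within)
next
  case (Suc k)
  then have "\<forall>v. C_diff_on (Suc k) S (\<lambda>x. frechet_derivative f (at x) v)"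
    using C_diff_on.simps(2)[of "Suc k" S f] by blast
  then have "\<forall>v. C_diff_on k S (\<lambda>x. frechet_derivative f (at x) v)" using Suc.IH by blast
  with Suc.prems show ?case by simp
qed

lemma C_diff_on_differentiable: "C_diff_on (Suc k) S f \<Longrightarrow> x \<in> S \<Longrightarrow> f differentiable (at x)"
  by simp

lemma C_diff_on_const: "open S \<Longrightarrow> C_diff_on k S (\<lambda>x. c)"
proof (induction k arbitrary: c)
  case (Suc k)
  show ?case by (rule C_diff_on_SucI[where f' = "\<lambda>_ _. 0"]) (auto intro: Suc)
qed simp

lemma C_diff_on_bounded_linear:
  assumes "open S" "bounded_linear L"
  shows "C_diff_on k S L"
proof (cases k)
  case 0
  then show ?thesis using assms by (simp add: linear_continuous_on)
next
  case (Suc m)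
  show ?thesis unfolding Suc
    by (rule C_diff_on_SucI[where f' = "\<lambda>_. L"])
       (auto intro: assms C_diff_on_const bounded_linear_imp_has_derivative)
qed

lemma C_diff_on_linear_compose:
  assumes "open S" "bounded_linear L" "C_diff_on k S f"
  shows "C_diff_on k S (\<lambda>x. L (f x))"
  using assms(3)
proof (induction k arbitrary: f)
  case 0
  then show ?case using bounded_linear.continuous_on[OF assms(2)] by simp
next
  case (Suc k)
  show ?case
  proof (rule C_diff_on_SucI[where f' = "\<lambda>x v. L (frechet_derivative f (at x) v)"])
    fix x assume "x \<in> S"
    then show "((\<lambda>x. L (f x)) has_derivative (\<lambda>v. L (frechet_derivative f (at x) v))) (at x)"
      using Suc.prems by (intro bounded_linear.has_derivative[OF assms(2)] has_derivative_frechet) simp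
  qed (use Suc assms in auto)
qed

lemma C_diff_on_add:
  assumes "open S" "C_diff_on k S f" "C_diff_on k S g"
  shows "C_diff_on k S (\<lambda>x. f x + g x)"
  using assms(2,3)
proof (induction k arbitrary: f g)
  case 0
  then show ?case by (simp add: continuous_on_add)
next
  case (Suc k)
  show ?case
    by (rule C_diff_on_SucI[where f' = "\<lambda>x v. frechet_derivative f (at x) v + frechet_derivative g (at x) v"])
       (use Suc assms(1) in \<open>auto intro!: has_derivative_add has_derivative_frechet\<close>)
qed

text \<open>Each summand of the Leibniz rule keeps one factor undifferentiated; its class is lowered
  from \<open>Suc k\<close> to \<open>k\<close> so that the induction hypothesis covers it.\<close>

lemma C_diff_on_bilinear:
  assumes "open S" "bounded_bilinear p" "C_diff_on k S f" "C_diff_on k S g"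
  shows "C_diff_on k S (\<lambda>x. p (f x) (g x))"
  using assms(3,4)
proof (induction k arbitrary: f g)
  case 0
  then show ?case using bounded_bilinear.continuous_on[OF assms(2)] by simp
next
  case (Suc k)
  show ?case
  proof (rule C_diff_on_SucI[where f' =
      "\<lambda>x v. p (f x) (frechet_derivative g (at x) v) + p (frechet_derivative f (at x) v) (g x)"])
    fix x assume "x \<in> S"
    then show "((\<lambda>x. p (f x) (g x)) has_derivative
       (\<lambda>v. p (f x) (frechet_derivative g (at x) v) + p (frechet_derivative f (at x) v) (g x))) (at x)"
      using Suc.prems
      by (intro bounded_bilinear.FDERIV[OF assms(2)] has_derivative_frechet) simp_all
  next
    fix v
    show "C_diff_on k S (\<lambda>x. p (f x) (frechet_derivative g (at x) v) + p (frechet_derivative f (at x) v) (g x))"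
      using Suc.prems C_diff_on_SucD[OF Suc.prems(1)] C_diff_on_SucD[OF Suc.prems(2)]
      by (intro C_diff_on_add[OF assms(1)] Suc.IH) simp_all
  qed (rule assms(1))
qed

lemma C_diff_on_sum:
  assumes "open S" "finite I" "\<And>i. i \<in> I \<Longrightarrow> C_diff_on k S (f i)"
  shows "C_diff_on k S (\<lambda>x. \<Sum>i\<in>I. f i x)"
  using assms(2,3)
  by (induction I rule: finite_induct) (auto intro: C_diff_on_const C_diff_on_add assms(1))

lemma linear_eq_sum_Basis:
  fixes L :: "'a::euclidean_space \<Rightarrow> 'b::real_vector"
  assumes "linear L"
  shows "L v = (\<Sum>b\<in>Basis. (v \<bullet> b) *\<^sub>R L b)"
proof -
  have "L v = L (\<Sum>b\<in>Basis. (v \<bullet> b) *\<^sub>R b)" by (simp only: euclidean_representation)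
  also have "\<dots> = (\<Sum>b\<in>Basis. (v \<bullet> b) *\<^sub>R L b)"
    by (simp add: linear_sum[OF assms] linear_scale[OF assms])
  finally show ?thesis .
qed

text \<open>The chain rule differentiates \<open>g\<close> in a direction that moves with
  \<open>x\<close>, while \<open>C_diff_on\<close> only speaks of fixed directions. Expanding the
  direction in \<open>Basis\<close> leaves fixed directions with smooth coefficients, hence the
  Euclidean middle space.\<close>

lemma C_diff_on_compose:
  fixes g :: "'b::euclidean_space \<Rightarrow> 'c::real_normed_vector"
  assumes "open S" "C_diff_on k T g" "C_diff_on k S f" "f ` S \<subseteq> T"
  shows "C_diff_on k S (\<lambda>x. g (f x))"
  using assms(2,3)
proof (induction k arbitrary: g)
  case 0
  then show ?case using continuous_on_compose2[of T g S f] assms(4) by simp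
next
  case (Suc k)
  let ?f' = "\<lambda>x v. frechet_derivative g (at (f x)) (frechet_derivative f (at x) v)"
  have g: "(g has_derivative frechet_derivative g (at (f x))) (at (f x))" if "x \<in> S" for x
    using Suc.prems(1) that assms(4) by (intro has_derivative_frechet) auto
  show ?case
  proof (rule C_diff_on_SucI[where f' = ?f'])
    fix x assume "x \<in> S"
    then show "((\<lambda>x. g (f x)) has_derivative ?f' x) (at x)"
      using Suc.prems(2) has_derivative_compose[OF has_derivative_frechet[of f x] g[OF \<open>x \<in> S\<close>]] by simp
  next
    fix v
    have "C_diff_on k S (\<lambda>x. \<Sum>b\<in>Basis. (frechet_derivative f (at x) v \<bullet> b) *\<^sub>R
             frechet_derivative g (at (f x)) b)"
    proof (intro C_diff_on_sum[OF assms(1)] C_diff_on_bilinear[OF assms(1) bounded_bilinear_scaleR])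
      fix b :: 'b
      show "C_diff_on k S (\<lambda>x. frechet_derivative f (at x) v \<bullet> b)"
        using Suc.prems(2) by (intro C_diff_on_linear_compose[OF assms(1) bounded_linear_inner_left]) simp
      show "C_diff_on k S (\<lambda>x. frechet_derivative g (at (f x)) b)"
        using Suc.prems C_diff_on_SucD by (intro Suc.IH) auto
    qed simp
    then show "C_diff_on k S (\<lambda>x. ?f' x v)"
      by (rule C_diff_on_cong[OF assms(1)])
         (rule linear_eq_sum_Basis[symmetric, OF has_derivative_linear[OF g]])
  qed (rule assms(1))
qed

lemma C_diff_on_inverse:
  fixes f :: "'a::real_normed_vector \<Rightarrow> real"
  assumes "open S" "C_diff_on k S f" "\<And>x. x \<in> S \<Longrightarrow> f x \<noteq> 0"
  shows "C_diff_on k S (\<lambda>x. inverse (f x))"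
  using assms(2)
proof (induction k)
  case 0
  then show ?case using assms(3) by (simp add: continuous_on_inverse)
next
  case (Suc k)
  have ih: "C_diff_on k S (\<lambda>x. inverse (f x))"
    using C_diff_on_SucD[OF Suc.prems] Suc.IH by blast
  show ?case
  proof (rule C_diff_on_SucI[where f' = "\<lambda>x v. - (inverse (f x) * frechet_derivative f (at x) v * inverse (f x))"])
    fix x assume "x \<in> S"
    then show "((\<lambda>x. inverse (f x)) has_derivative
       (\<lambda>v. - (inverse (f x) * frechet_derivative f (at x) v * inverse (f x)))) (at x)"
      using Suc.prems by (intro Deriv.has_derivative_inverse assms(3) has_derivative_frechet) auto
  next
    fix v
    show "C_diff_on k S (\<lambda>x. - (inverse (f x) * frechet_derivative f (at x) v * inverse (f x)))"
      using Suc.prems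
      by (intro C_diff_on_linear_compose[OF assms(1) bounded_linear_minus[OF bounded_linear_ident]]
            C_diff_on_bilinear[OF assms(1) bounded_bilinear_mult] ih) simp
  qed (rule assms(1))
qed

section \<open>Closure properties of smooth maps\<close>

named_theorems smooth_intros

lemma smooth_on_subset: "smooth_on S f \<Longrightarrow> T \<subseteq> S \<Longrightarrow> smooth_on T f"
  unfolding smooth_on_def using C_diff_on_subset by blast

lemma smooth_on_cong:
  "open S \<Longrightarrow> smooth_on S f \<Longrightarrow> (\<And>x. x \<in> S \<Longrightarrow> f x = g x) \<Longrightarrow> smooth_on S g"
  unfolding smooth_on_def using C_diff_on_cong by blast

lemma smooth_on_imp_differentiable: "smooth_on S f \<Longrightarrow> x \<in> S \<Longrightarrow> f differentiable (at x)"
  unfolding smooth_on_def using C_diff_on_differentiable by blast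

lemma smooth_on_imp_has_derivative:
  "smooth_on S f \<Longrightarrow> x \<in> S \<Longrightarrow> (f has_derivative frechet_derivative f (at x)) (at x)"
  using smooth_on_imp_differentiable has_derivative_frechet by blast

lemma smooth_on_imp_continuous_on: "smooth_on S f \<Longrightarrow> continuous_on S f"
  unfolding smooth_on_def using C_diff_on.simps(1) by blast

lemma smooth_on_imp_linear: "smooth_on S f \<Longrightarrow> x \<in> S \<Longrightarrow> linear (frechet_derivative f (at x))"
  using smooth_on_imp_differentiable linear_frechet_derivative by blast

lemma smooth_on_frechet_derivative: "smooth_on S f \<Longrightarrow> smooth_on S (\<lambda>x. frechet_derivative f (at x) v)"
  unfolding smooth_on_def by (metis C_diff_on.simps(2))

lemma smooth_on_const [smooth_intros]: "open S \<Longrightarrow> smooth_on S (\<lambda>x. c)"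
  unfolding smooth_on_def using C_diff_on_const by blast

lemma smooth_on_bounded_linear: "open S \<Longrightarrow> bounded_linear L \<Longrightarrow> smooth_on S L"
  unfolding smooth_on_def using C_diff_on_bounded_linear by blast

lemma smooth_on_id [smooth_intros]: "open S \<Longrightarrow> smooth_on S (\<lambda>x. x)"
  using smooth_on_bounded_linear bounded_linear_ident by blast

lemma smooth_on_linear_compose:
  "open S \<Longrightarrow> bounded_linear L \<Longrightarrow> smooth_on S f \<Longrightarrow> smooth_on S (\<lambda>x. L (f x))"
  unfolding smooth_on_def using C_diff_on_linear_compose by blast

lemma smooth_on_bilinear:
  "open S \<Longrightarrow> bounded_bilinear p \<Longrightarrow> smooth_on S f \<Longrightarrow> smooth_on S g \<Longrightarrow> smooth_on S (\<lambda>x. p (f x) (g x))"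
  unfolding smooth_on_def using C_diff_on_bilinear by blast

lemma smooth_on_add [smooth_intros]:
  "open S \<Longrightarrow> smooth_on S f \<Longrightarrow> smooth_on S g \<Longrightarrow> smooth_on S (\<lambda>x. f x + g x)"
  unfolding smooth_on_def using C_diff_on_add by blast

lemma smooth_on_uminus [smooth_intros]: "open S \<Longrightarrow> smooth_on S f \<Longrightarrow> smooth_on S (\<lambda>x. - f x)"
  using smooth_on_linear_compose[OF _ bounded_linear_minus[OF bounded_linear_ident]] by blast

lemma smooth_on_diff [smooth_intros]:
  "open S \<Longrightarrow> smooth_on S f \<Longrightarrow> smooth_on S g \<Longrightarrow> smooth_on S (\<lambda>x. f x - g x)"
  using smooth_on_add[OF _ _ smooth_on_uminus] by fastforce

lemma smooth_on_sum [smooth_intros]: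
  "open S \<Longrightarrow> (\<And>i. i \<in> I \<Longrightarrow> smooth_on S (f i)) \<Longrightarrow> smooth_on S (\<lambda>x. \<Sum>i\<in>I. f i x)"
  by (induction I rule: infinite_finite_induct) (auto intro: smooth_intros)

lemma smooth_on_mult [smooth_intros]:
  fixes f g :: "'a::real_normed_vector \<Rightarrow> real"
  shows "open S \<Longrightarrow> smooth_on S f \<Longrightarrow> smooth_on S g \<Longrightarrow> smooth_on S (\<lambda>x. f x * g x)"
  using smooth_on_bilinear[OF _ bounded_bilinear_mult] by blast

lemma smooth_on_scaleR [smooth_intros]:
  "open S \<Longrightarrow> smooth_on S f \<Longrightarrow> smooth_on S g \<Longrightarrow> smooth_on S (\<lambda>x. f x *\<^sub>R g x)"
  using smooth_on_bilinear[OF _ bounded_bilinear_scaleR] by blast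

lemma smooth_on_inner [smooth_intros]:
  "open S \<Longrightarrow> smooth_on S f \<Longrightarrow> smooth_on S g \<Longrightarrow> smooth_on S (\<lambda>x. f x \<bullet> g x)"
  using smooth_on_bilinear[OF _ bounded_bilinear_inner] by blast

lemma smooth_on_prod [smooth_intros]:
  fixes f :: "'i \<Rightarrow> 'a::real_normed_vector \<Rightarrow> real"
  shows "open S \<Longrightarrow> (\<And>i. i \<in> I \<Longrightarrow> smooth_on S (f i)) \<Longrightarrow> smooth_on S (\<lambda>x. \<Prod>i\<in>I. f i x)"
  by (induction I rule: infinite_finite_induct) (auto intro: smooth_intros)

lemma smooth_on_power [smooth_intros]:
  fixes f :: "'a::real_normed_vector \<Rightarrow> real"
  shows "open S \<Longrightarrow> smooth_on S f \<Longrightarrow> smooth_on S (\<lambda>x. f x ^ m)"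
  by (induction m) (auto intro: smooth_intros)

lemma smooth_on_divide [smooth_intros]:
  fixes f g :: "'a::real_normed_vector \<Rightarrow> real"
  assumes "open S" "smooth_on S f" "smooth_on S g" "\<And>x. x \<in> S \<Longrightarrow> g x \<noteq> 0"
  shows "smooth_on S (\<lambda>x. f x / g x)"
proof -
  have "smooth_on S (\<lambda>x. inverse (g x))"
    using assms C_diff_on_inverse unfolding smooth_on_def by blast
  then show ?thesis
    unfolding divide_inverse using assms by (intro smooth_intros)
qed

lemma smooth_on_fst [smooth_intros]: "open S \<Longrightarrow> smooth_on S f \<Longrightarrow> smooth_on S (\<lambda>x. fst (f x))"
  using smooth_on_linear_compose[OF _ bounded_linear_fst] by blast

lemma smooth_on_snd [smooth_intros]: "open S \<Longrightarrow> smooth_on S f \<Longrightarrow> smooth_on S (\<lambda>x. snd (f x))"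
  using smooth_on_linear_compose[OF _ bounded_linear_snd] by blast

lemma smooth_on_fst_snd [smooth_intros]: "open S \<Longrightarrow> smooth_on S fst" "open S \<Longrightarrow> smooth_on S snd"
  by (auto intro: smooth_on_bounded_linear bounded_linear_fst bounded_linear_snd)

lemma smooth_on_Pair [smooth_intros]:
  assumes "open S" "smooth_on S f" "smooth_on S g"
  shows "smooth_on S (\<lambda>x. (f x, g x))"
proof -
  have *: "bounded_linear (\<lambda>x. (x, 0))" "bounded_linear (\<lambda>x. (0, x))"
    by (intro bounded_linear_Pair bounded_linear_ident bounded_linear_zero)+
  have "smooth_on S (\<lambda>x. (f x, 0) + (0, g x))"
    using smooth_on_linear_compose[OF _ *(1) assms(2)] smooth_on_linear_compose[OF _ *(2) assms(3)]
    by (intro smooth_on_add assms) (simp_all add: assms)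
  then show ?thesis by simp
qed

lemma smooth_on_vec_nth [smooth_intros]: "open S \<Longrightarrow> smooth_on S f \<Longrightarrow> smooth_on S (\<lambda>x. f x $ i)"
  using smooth_on_linear_compose[OF _ bounded_linear_vec_nth] by blast

lemma smooth_on_vecI:
  fixes f :: "'a::real_normed_vector \<Rightarrow> real^'n"
  assumes "open S" "\<And>i. smooth_on S (\<lambda>x. f x $ i)"
  shows "smooth_on S f"
proof -
  have "smooth_on S (\<lambda>x. \<Sum>i\<in>UNIV. (f x $ i) *\<^sub>R axis i (1::real))"
    by (intro smooth_intros assms)
  also have "(\<lambda>x. \<Sum>i\<in>UNIV. (f x $ i) *\<^sub>R axis i (1::real)) = f"
    using basis_expansion[of "f _"] by (auto simp: scalar_mult_eq_scaleR)
  finally show ?thesis .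
qed

lemma smooth_on_vec_lambda [smooth_intros]:
  fixes f :: "'n::finite \<Rightarrow> 'a::real_normed_vector \<Rightarrow> real"
  shows "open S \<Longrightarrow> (\<And>i. smooth_on S (f i)) \<Longrightarrow> smooth_on S (\<lambda>x. \<chi> i. f i x)"
  by (rule smooth_on_vecI) simp_all

lemma smooth_on_compose:
  fixes g :: "'b::euclidean_space \<Rightarrow> 'c::real_normed_vector"
  shows "open S \<Longrightarrow> smooth_on T g \<Longrightarrow> smooth_on S f \<Longrightarrow> f ` S \<subseteq> T \<Longrightarrow> smooth_on S (\<lambda>x. g (f x))"
  unfolding smooth_on_def using C_diff_on_compose by blast

lemma smooth_on_compose2:
  fixes g :: "'b::euclidean_space \<Rightarrow> 'c::euclidean_space \<Rightarrow> 'd::real_normed_vector"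
  assumes "open S" "smooth_on T (\<lambda>p. g (fst p) (snd p))" "smooth_on S u" "smooth_on S v"
    "\<And>x. x \<in> S \<Longrightarrow> (u x, v x) \<in> T"
  shows "smooth_on S (\<lambda>x. g (u x) (v x))"
  using smooth_on_compose[OF assms(1,2), of "\<lambda>x. (u x, v x)"] assms
  by (simp add: smooth_on_Pair image_subset_iff)

lemma smooth_on_det [smooth_intros]:
  fixes F :: "'a::real_normed_vector \<Rightarrow> real^'n^'n"
  assumes "open S" "\<And>i j. smooth_on S (\<lambda>x. F x $ i $ j)"
  shows "smooth_on S (\<lambda>x. det (F x))"
  unfolding det_def by (intro smooth_intros assms)

text \<open>The derivative in the second variable along \<open>v\<close> is the full derivative
  along \<open>(0, v)\<close>. This lets a family indexed by the base point be differentiated in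
  space without losing smoothness in the base point.\<close>

lemma smooth_on_partial_derivative:
  fixes G :: "'a::euclidean_space \<Rightarrow> 'b::euclidean_space \<Rightarrow> 'c::real_normed_vector"
  assumes "open S" "smooth_on S (\<lambda>p. G (fst p) (snd p))" "smooth_on S u"
  shows "smooth_on S (\<lambda>p. frechet_derivative (G (fst p)) (at (snd p)) (u p))"
proof -
  let ?g = "\<lambda>p. G (fst p) (snd p)"
  have d: "frechet_derivative (G (fst p)) (at (snd p)) v = frechet_derivative ?g (at p) (0, v)"
    and l: "linear (frechet_derivative (G (fst p)) (at (snd p)))" if "p \<in> S" for p v
  proof -
    obtain a x where p: "p = (a, x)" by (cases p)
    have g: "(?g has_derivative frechet_derivative ?g (at p)) (at (a, x))"
      using smooth_on_imp_has_derivative[OF assms(2) that] p by simp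
    have "((\<lambda>x. (a, x)) has_derivative (\<lambda>v. (0, v))) (at x)"
      by (auto intro!: derivative_eq_intros)
    from has_derivative_compose[OF this g]
    have *: "(G a has_derivative (\<lambda>v. frechet_derivative ?g (at p) (0, v))) (at x)" by simp
    then show "frechet_derivative (G (fst p)) (at (snd p)) v = frechet_derivative ?g (at p) (0, v)"
      using frechet_derivative_eq[OF *] p by simp
    show "linear (frechet_derivative (G (fst p)) (at (snd p)))"
      using frechet_derivative_eq[OF *] has_derivative_linear[OF *] p by simp
  qed
  have "smooth_on S (\<lambda>p. \<Sum>b\<in>Basis. (u p \<bullet> b) *\<^sub>R frechet_derivative ?g (at p) (0, b))"
    by (intro smooth_intros assms smooth_on_frechet_derivative)
  then show ?thesis
    by (rule smooth_on_cong[OF assms(1)]) (subst linear_eq_sum_Basis[OF l], simp_all add: d)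
qed

section \<open>Triangular maps and triangular differential equations\<close>

definition agree_below :: "('n \<Rightarrow> nat) \<Rightarrow> nat \<Rightarrow> real^'n::finite \<Rightarrow> real^'n \<Rightarrow> bool" where
  "agree_below w m y y' \<longleftrightarrow> (\<forall>j. w j < m \<longrightarrow> y $ j = y' $ j)"

text \<open>The inequality inside \<open>agree_below\<close> is strict, so component
  \<open>k\<close> ignores \<open>y $ k\<close> and every coordinate of the same weight. As a
  correction, \<open>q\<close> makes \<open>y + q y\<close> unipotent; as a field, it can be
  integrated weight by weight.\<close>

definition triangular :: "('n::finite \<Rightarrow> nat) \<Rightarrow> (real^'n \<Rightarrow> real^'n) \<Rightarrow> bool" where
  "triangular w q \<longleftrightarrow> (\<forall>k y y'. agree_below w (w k) y y' \<longrightarrow> q y $ k = q y' $ k)"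

text \<open>Solving \<open>y + q a y = z\<close> means finding a fixed point of
  \<open>F a z\<close>. Each application settles the coordinates of one more weight whatever the
  starting value, so contraction is measured in weight and not in norm.\<close>

lemma triangular_inverse:
  fixes q :: "'a::euclidean_space \<Rightarrow> real^'n \<Rightarrow> real^'n::finite"
  assumes "open U" and smooth: "smooth_on (U \<times> UNIV) (\<lambda>p. q (fst p) (snd p))"
    and tri: "\<And>a. a \<in> U \<Longrightarrow> triangular w (q a)"
  obtains Q where "smooth_on (U \<times> UNIV) (\<lambda>p. Q (fst p) (snd p))"
    "\<And>a y. a \<in> U \<Longrightarrow> Q a (y + q a y) = y" "\<And>a z. a \<in> U \<Longrightarrow> Q a z + q a (Q a z) = z"
proof -
  define F where "F = (\<lambda>a z y. z - q a y)"
  define N where "N = Suc (Max (range w))"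
  define Q where "Q = (\<lambda>a z. (F a z ^^ N) 0)"
  have N: "w k < N" for k by (simp add: N_def less_Suc_eq_le)
  have agree: "agree_below w m ((F a z ^^ m) y) ((F a z ^^ m) y')" if "a \<in> U" for a z m y y'
  proof (induction m)
    case 0
    show ?case by (simp add: agree_below_def)
  next
    case (Suc m)
    have "q a ((F a z ^^ m) y) $ k = q a ((F a z ^^ m) y') $ k" if "w k < Suc m" for k
    proof -
      have "agree_below w (w k) ((F a z ^^ m) y) ((F a z ^^ m) y')"
        using Suc that by (auto simp: agree_below_def)
      then show ?thesis using tri[OF \<open>a \<in> U\<close>] unfolding triangular_def by blast
    qed
    then show ?case by (simp add: agree_below_def F_def)
  qed
  have const: "(F a z ^^ N) y = Q a z" if "a \<in> U" for a z y
    using agree[OF that, of N z y 0] N by (simp add: agree_below_def vec_eq_iff Q_def)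
  have "open (U \<times> (UNIV::(real^'n) set))" using \<open>open U\<close> by (simp add: open_Times)
  then have "smooth_on (U \<times> UNIV) (\<lambda>p. (F (fst p) (snd p) ^^ m) 0)" for m
  proof (induction m)
    case (Suc m)
    then show ?case unfolding F_def funpow.simps o_def
      by (intro smooth_intros smooth_on_compose2[OF _ smooth]) auto
  qed (auto intro: smooth_intros)
  then have 1: "smooth_on (U \<times> UNIV) (\<lambda>p. Q (fst p) (snd p))" by (simp add: Q_def)
  have 2: "Q a (y + q a y) = y" if "a \<in> U" for a y
  proof -
    \<comment> \<open>A fixed point is its own \<open>N\<close>-fold iterate, so it is the value
      that all starting points reach.\<close>
    have "F a (y + q a y) y = y" by (simp add: F_def)
    then have "(F a (y + q a y) ^^ N) y = y" by (induction N) auto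
    then show ?thesis using const[OF that] by metis
  qed
  have 3: "Q a z + q a (Q a z) = z" if "a \<in> U" for a z
  proof -
    \<comment> \<open>One more application is absorbed into the starting value, on which the
      \<open>N\<close>-fold iterate does not depend.\<close>
    have "F a z (Q a z) = (F a z ^^ N) (F a z 0)" by (simp add: Q_def funpow_swap1)
    then have "F a z (Q a z) = Q a z" using const[OF that] by simp
    then show ?thesis by (simp add: F_def algebra_simps)
  qed
  show thesis using that 1 2 3 by blast
qed

text \<open>Functions \<open>f p t\<close> that are polynomial in \<open>t\<close> with coefficients smooth in \<open>p \<in> S\<close>. They are
  closed under integration in \<open>t\<close>, so Picard iteration stays among them.\<close>

inductive tpoly :: "'a::real_normed_vector set \<Rightarrow> ('a \<Rightarrow> real \<Rightarrow> real) \<Rightarrow> bool" for S where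
  coeff: "smooth_on S c \<Longrightarrow> tpoly S (\<lambda>p t. c p)"
| times: "tpoly S f \<Longrightarrow> tpoly S (\<lambda>p t. t * f p t)"
| plus: "tpoly S f \<Longrightarrow> tpoly S g \<Longrightarrow> tpoly S (\<lambda>p t. f p t + g p t)"

lemma tpoly_smooth: "tpoly S f \<Longrightarrow> open S \<Longrightarrow> smooth_on S (\<lambda>p. f p t)"
  by (induction rule: tpoly.induct) (auto intro: smooth_intros)

lemma tpoly_mult:
  assumes "open S" "tpoly S f" "tpoly S g"
  shows "tpoly S (\<lambda>p t. f p t * g p t)"
proof -
  have *: "tpoly S (\<lambda>p t. c p * g p t)" if "smooth_on S c" for c
    using assms(3)
  proof (induction rule: tpoly.induct)
    case (coeff c')
    then show ?case using that assms(1) by (intro tpoly.coeff smooth_intros)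
  next
    case (times f)
    then show ?case using tpoly.times by (fastforce simp: algebra_simps)
  next
    case (plus f g)
    then show ?case using tpoly.plus[of S "\<lambda>p t. c p * f p t" "\<lambda>p t. c p * g p t"]
      by (simp add: algebra_simps)
  qed
  show ?thesis using assms(2)
  proof (induction rule: tpoly.induct)
    case (times f)
    then show ?case using tpoly.times[of S "\<lambda>p t. f p t * g p t"] by (simp add: algebra_simps)
  next
    case (plus f f')
    then show ?case using tpoly.plus[of S "\<lambda>p t. f p t * g p t" "\<lambda>p t. f' p t * g p t"]
      by (simp add: algebra_simps)
  qed (rule *)
qed

lemma tpoly_sum:
  assumes "open S" "\<And>i. i \<in> I \<Longrightarrow> tpoly S (f i)"
  shows "tpoly S (\<lambda>p t. \<Sum>i\<in>I. f i p t)"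
  using assms(2)
  by (induction I rule: infinite_finite_induct)
     (auto intro: tpoly.plus tpoly.coeff[OF smooth_on_const[OF assms(1)], of 0])

text \<open>A primitive of \<open>t * f\<close> is not directly obtained from one of
  \<open>f\<close>; the induction therefore treats \<open>t ^ n * f\<close> for all
  \<open>n\<close>, and the rule \<open>times\<close> merely raises \<open>n\<close>.\<close>

lemma tpoly_primitive:
  assumes "open S" "tpoly S f"
  shows "\<exists>F. tpoly S F \<and> (\<forall>p. F p 0 = 0) \<and> (\<forall>p t. (F p has_real_derivative f p t) (at t))"
proof -
  have "\<exists>F. tpoly S F \<and> (\<forall>p. F p 0 = 0) \<and> (\<forall>p t. (F p has_real_derivative t ^ n * f p t) (at t))" for n
    using assms(2)
  proof (induction arbitrary: n rule: tpoly.induct)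
    case (coeff c)
    have pow: "tpoly S (\<lambda>p t. t ^ m * h p)" if "smooth_on S h" for m h
    proof (induction m)
      case 0
      then show ?case using that by (simp add: tpoly.coeff)
    next
      case (Suc m)
      then show ?case using tpoly.times[OF Suc] by (simp add: algebra_simps)
    qed
    have "tpoly S (\<lambda>p t. t ^ Suc n * (c p / real (Suc n)))"
      using coeff assms(1) by (intro pow smooth_intros) auto
    moreover have "((\<lambda>t. t ^ Suc n * (c p / real (Suc n))) has_real_derivative t ^ n * c p) (at t)" for p t
      using DERIV_cmult_right[OF DERIV_pow[of "Suc n" t UNIV], of "c p / real (Suc n)"] by simp
    ultimately show ?case
      by (intro exI[of _ "\<lambda>p t. t ^ Suc n * (c p / real (Suc n))"]) auto
  next
    case (times f)
    from times.IH[of "Suc n"] show ?case by (simp add: algebra_simps)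
  next
    case (plus f g)
    obtain F where "tpoly S F" "\<forall>p. F p 0 = 0"
      "\<forall>p t. (F p has_real_derivative t ^ n * f p t) (at t)" using plus.IH(1)[of n] by blast
    moreover obtain G where "tpoly S G" "\<forall>p. G p 0 = 0"
      "\<forall>p t. (G p has_real_derivative t ^ n * g p t) (at t)" using plus.IH(2)[of n] by blast
    ultimately show ?case
      by (intro exI[of _ "\<lambda>p t. F p t + G p t"])
         (auto intro!: tpoly.plus derivative_eq_intros simp: algebra_simps)
  qed
  from this[of 0] show ?thesis by simp
qed

section \<open>Integral curves on the unit interval\<close>

lemma has_vector_derivative_vec_iff:
  fixes f :: "real \<Rightarrow> real^'n"
  shows "(f has_vector_derivative v) (at t within T) \<longleftrightarrow>
         (\<forall>k. ((\<lambda>t. f t $ k) has_vector_derivative v $ k) (at t within T))" (is "?l \<longleftrightarrow> ?r")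
proof
  assume ?l
  then show ?r using bounded_linear.has_vector_derivative[OF bounded_linear_vec_nth] by blast
next
  assume ?r
  then have "((\<lambda>t. \<Sum>k\<in>UNIV. (f t $ k) *\<^sub>R axis k 1) has_vector_derivative
      (\<Sum>k\<in>UNIV. (v $ k) *\<^sub>R (axis k 1 :: real^'n))) (at t within T)"
    by (intro has_vector_derivative_sum bounded_linear.has_vector_derivative[OF bounded_linear_scaleR_left]) auto
  then show ?l
    using basis_expansion[of v] basis_expansion[of "f _"] by (simp add: scalar_mult_eq_scaleR)
qed

text \<open>With \<open>d = 0\<close> this is uniqueness of a primitive with given initial value; a
  nonzero constant \<open>d\<close> compares curves driven by fields that differ by a constant in
  one component.\<close>

lemma primitives_differ_linear:
  fixes u v :: "real \<Rightarrow> real"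
  assumes "u 0 = v 0" "t \<in> {0..1}"
    and "\<And>s. s \<in> {0..1} \<Longrightarrow> (u has_vector_derivative f s) (at s within {0..1})"
    and "\<And>s. s \<in> {0..1} \<Longrightarrow> (v has_vector_derivative g s) (at s within {0..1})"
    and "\<And>s. s \<in> {0..1} \<Longrightarrow> f s = g s + d"
  shows "u t = v t + d * t"
proof -
  have "((\<lambda>s. u s - v s - s * d) has_vector_derivative 0) (at s within {0..1})" if "s \<in> {0..1}" for s
    using DERIV_diff[OF DERIV_diff[OF assms(3,4)[OF that, folded has_real_derivative_iff_has_vector_derivative]]
        DERIV_cmult_right[OF DERIV_ident, where c = d]] assms(5)[OF that]
    by (simp add: has_real_derivative_iff_has_vector_derivative)
  then obtain c where "\<And>s. s \<in> {0..1} \<Longrightarrow> u s - v s - s * d = c"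
    by (rule has_vector_derivative_zero_constant[rotated]) (simp_all add: convex_real_interval)
  from this[of 0] this[OF assms(2)] assms(1) show ?thesis by (simp add: algebra_simps)
qed

definition integral_curve :: "('n::finite) vfield \<Rightarrow> (real \<Rightarrow> real^'n) \<Rightarrow> bool" where
  "integral_curve V \<gamma> \<longleftrightarrow> (\<forall>t\<in>{0..1}. (\<gamma> has_vector_derivative V (\<gamma> t)) (at t within {0..1}))"

lemma integral_curve_nth:
  "integral_curve V \<gamma> \<Longrightarrow> t \<in> {0..1} \<Longrightarrow>
     ((\<lambda>t. \<gamma> t $ k) has_vector_derivative V (\<gamma> t) $ k) (at t within {0..1})"
  unfolding integral_curve_def has_vector_derivative_vec_iff by blast

text \<open>Once all lighter coordinates agree along both curves, the velocities of coordinate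
  \<open>k\<close> agree, and so do the coordinates. Taking \<open>V = V'\<close> gives uniqueness
  of the flow; distinct fields serve to compare two parameters.\<close>

lemma integral_curves_agree_below:
  assumes "integral_curve V \<gamma>" "integral_curve V' \<gamma>'" "\<gamma> 0 = \<gamma>' 0"
    and eq: "\<And>k y y'. w k < m \<Longrightarrow> agree_below w (w k) y y' \<Longrightarrow> V y $ k = V' y' $ k"
    and "t \<in> {0..1}"
  shows "agree_below w m (\<gamma> t) (\<gamma>' t)"
proof -
  have "w k < m \<Longrightarrow> \<forall>t\<in>{0..1}. \<gamma> t $ k = \<gamma>' t $ k" for k
  proof (induction "w k" arbitrary: k rule: less_induct)
    case less
    have "agree_below w (w k) (\<gamma> s) (\<gamma>' s)" if "s \<in> {0..1}" for s
      using less that by (auto simp: agree_below_def)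
    then have "\<gamma> t $ k = \<gamma>' t $ k + 0 * t" if "t \<in> {0..1}" for t
      using assms(3) that eq[OF less.prems]
      by (intro primitives_differ_linear[OF _ that integral_curve_nth[OF assms(1)] integral_curve_nth[OF assms(2)]]) auto
    then show ?case by simp
  qed
  then show ?thesis using assms(5) by (auto simp: agree_below_def)
qed

lemma agree_below_imp_eq: "(\<And>k. w k < m) \<Longrightarrow> agree_below w m y y' \<Longrightarrow> y = y'"
  by (simp add: agree_below_def vec_eq_iff)

lemma time_one_flow_eq:
  assumes "integral_curve V \<gamma>" "\<gamma> 0 = p" "triangular w V"
  shows "time_one_flow V p = \<gamma> 1"
  unfolding time_one_flow_def
proof (rule the_equality)
  show "\<exists>\<gamma>'. \<gamma>' 0 = p \<and> \<gamma>' 1 = \<gamma> 1 \<and>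
      (\<forall>t\<in>{0..1}. (\<gamma>' has_vector_derivative V (\<gamma>' t)) (at t within {0..1}))"
    using assms by (auto simp: integral_curve_def)
next
  fix q assume "\<exists>\<gamma>'. \<gamma>' 0 = p \<and> \<gamma>' 1 = q \<and>
      (\<forall>t\<in>{0..1}. (\<gamma>' has_vector_derivative V (\<gamma>' t)) (at t within {0..1}))"
  then obtain \<gamma>' where \<gamma>': "\<gamma>' 0 = p" "\<gamma>' 1 = q" "integral_curve V \<gamma>'"
    by (auto simp: integral_curve_def)
  have "agree_below w (Suc (Max (range w))) (\<gamma>' 1) (\<gamma> 1)"
    using assms \<gamma>'(1) by (intro integral_curves_agree_below[OF \<gamma>'(3) assms(1)]) (auto simp: triangular_def)
  then show "q = \<gamma> 1"
    using agree_below_imp_eq[of w "Suc (Max (range w))"] \<gamma>'(2) by (simp add: less_Suc_eq_le)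
qed

text \<open>Hypothesis \<open>poly\<close> keeps the Picard iterates polynomial in \<open>t\<close>,
  so integration in \<open>t\<close> is algebraic and preserves smooth dependence on
  \<open>p\<close>.\<close>

lemma triangular_ode_solution:
  fixes V :: "'a::euclidean_space \<Rightarrow> real^'n \<Rightarrow> real^'n::finite"
  assumes "open S" and tri: "\<And>p. p \<in> S \<Longrightarrow> triangular w (V p)"
    and poly: "\<And>\<gamma> k. (\<And>i. tpoly S (\<lambda>p t. \<gamma> p t $ i)) \<Longrightarrow> tpoly S (\<lambda>p t. V p (\<gamma> p t) $ k)"
  obtains \<gamma> where "\<And>p. p \<in> S \<Longrightarrow> integral_curve (V p) (\<gamma> p)" "\<And>p. \<gamma> p 0 = 0"
    "smooth_on S (\<lambda>p. \<gamma> p 1)"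
proof -
  \<comment> \<open>\<open>J\<close> chooses a primitive for the whole family at once; a separate
    choice for every \<open>p\<close> would give no smoothness in \<open>p\<close>.\<close>
  define J where "J f = (SOME F. tpoly S F \<and> (\<forall>p. F p 0 = 0) \<and>
    (\<forall>p t. (F p has_real_derivative f p t) (at t)))" for f
  have J: "tpoly S (J f)" "J f p 0 = 0" "(J f p has_real_derivative f p t) (at t)"
    if "tpoly S f" for f p t
    using someI_ex[OF tpoly_primitive[OF assms(1) that]] unfolding J_def by blast+
  define \<gamma> where "\<gamma> = rec_nat (\<lambda>p t. 0) (\<lambda>_ g p t. \<chi> k. J (\<lambda>p t. V p (g p t) $ k) p t)"
  have \<gamma>0: "\<gamma> 0 = (\<lambda>p t. 0)" and \<gamma>S: "\<gamma> (Suc m) = (\<lambda>p t. \<chi> k. J (\<lambda>p t. V p (\<gamma> m p t) $ k) p t)" for m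
    by (simp_all add: \<gamma>_def)
  have tp: "tpoly S (\<lambda>p t. \<gamma> m p t $ i)" for m i
    by (induction m arbitrary: i) (simp_all add: \<gamma>0 \<gamma>S J(1) poly tpoly.coeff smooth_on_const assms(1))
  have zero: "\<gamma> m p 0 = 0" for m p
    by (cases m) (simp_all add: \<gamma>0 \<gamma>S J(2) poly tp vec_eq_iff)
  have der: "((\<lambda>t. \<gamma> (Suc m) p t $ k) has_vector_derivative V p (\<gamma> m p t) $ k) (at t within T)" for m p t k T
    using J(3)[OF poly[OF tp]]
    by (simp add: \<gamma>S has_real_derivative_iff_has_vector_derivative has_vector_derivative_at_within)
  have agree: "agree_below w m (\<gamma> (Suc m) p t) (\<gamma> m p t)" if "p \<in> S" "t \<in> {0..1}" for m p t
    using that(2)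
  proof (induction m arbitrary: t)
    case 0
    show ?case by (simp add: agree_below_def)
  next
    case (Suc m)
    have "\<gamma> (Suc (Suc m)) p t $ k = \<gamma> (Suc m) p t $ k" if "w k < Suc m" for k
    proof -
      have "V p (\<gamma> (Suc m) p s) $ k = V p (\<gamma> m p s) $ k" if "s \<in> {0..1}" for s
      proof -
        have "agree_below w (w k) (\<gamma> (Suc m) p s) (\<gamma> m p s)"
          using Suc.IH[OF that] \<open>w k < Suc m\<close> by (auto simp: agree_below_def)
        then show ?thesis using tri[OF \<open>p \<in> S\<close>] unfolding triangular_def by blast
      qed
      then have "\<gamma> (Suc (Suc m)) p t $ k = \<gamma> (Suc m) p t $ k + 0 * t"
        by (intro primitives_differ_linear[OF _ Suc.prems der der]) (simp_all add: zero)
      then show ?thesis by simp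
    qed
    then show ?case by (simp add: agree_below_def)
  qed
  define N where "N = Suc (Max (range w))"
  have N: "w k < N" for k by (simp add: N_def less_Suc_eq_le)
  have eq: "\<gamma> (Suc N) p t = \<gamma> N p t" if "p \<in> S" "t \<in> {0..1}" for p t
    using agree_below_imp_eq[OF N agree[OF that]] .
  \<comment> \<open>The velocity of iterate \<open>Suc N\<close> is \<open>V p\<close> along iterate
    \<open>N\<close>, which by \<open>eq\<close> is the same curve on the unit interval.\<close>
  have "integral_curve (V p) (\<gamma> (Suc N) p)" if "p \<in> S" for p
    unfolding integral_curve_def has_vector_derivative_vec_iff
    using der[of N p] eq[OF that] by metis
  moreover have "smooth_on S (\<lambda>p. \<gamma> (Suc N) p 1)"
    by (rule smooth_on_vecI[OF assms(1)]) (rule tpoly_smooth[OF tp assms(1)])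
  ultimately show thesis using that zero by blast
qed

text \<open>The field is the constant \<open>x\<close> plus a tail triangular in \<open>x\<close>
  and \<open>y\<close> together, so the time-one map is \<open>x + q a x\<close> with
  \<open>q a\<close> triangular, and \<open>triangular_inverse\<close> applies. The parameters of
  the equation are the pairs \<open>(a, x)\<close>, which yields joint smoothness.\<close>

lemma triangular_exponential:
  fixes g :: "'a::euclidean_space \<Rightarrow> real^'n \<Rightarrow> real^'n \<Rightarrow> real^'n::finite"
  assumes "open U"
    and tri: "\<And>a k x x' y y'. a \<in> U \<Longrightarrow> agree_below w (w k) x x' \<Longrightarrow> agree_below w (w k) y y' \<Longrightarrow>
                 g a x y $ k = g a x' y' $ k"
    and poly: "\<And>\<gamma> k. (\<And>i. tpoly (U \<times> UNIV) (\<lambda>p t. \<gamma> p t $ i)) \<Longrightarrow>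
                 tpoly (U \<times> UNIV) (\<lambda>p t. g (fst p) (snd p) (\<gamma> p t) $ k)"
  obtains E E' where "smooth_on (U \<times> UNIV) (\<lambda>p. E (fst p) (snd p))"
    "smooth_on (U \<times> UNIV) (\<lambda>p. E' (fst p) (snd p))"
    "\<And>a x. a \<in> U \<Longrightarrow> time_one_flow (\<lambda>y. x + g a x y) 0 = E a x"
    "\<And>a x. a \<in> U \<Longrightarrow> E' a (E a x) = x" "\<And>a x. a \<in> U \<Longrightarrow> E a (E' a x) = x"
proof -
  let ?S = "U \<times> (UNIV :: (real^'n) set)"
  let ?V = "\<lambda>p y. snd p + g (fst p) (snd p) y"
  have S: "open ?S" using \<open>open U\<close> by (simp add: open_Times)
  have triV: "triangular w (?V p)" if "p \<in> ?S" for p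
    unfolding triangular_def
  proof (intro allI impI)
    fix k y y' assume "agree_below w (w k) y y'"
    moreover have "agree_below w (w k) (snd p) (snd p)" by (simp add: agree_below_def)
    ultimately show "?V p y $ k = ?V p y' $ k" using that tri[of "fst p"] by auto
  qed
  have polyV: "tpoly ?S (\<lambda>p t. ?V p (\<gamma> p t) $ k)" if "\<And>i. tpoly ?S (\<lambda>p t. \<gamma> p t $ i)" for \<gamma> k
    unfolding vector_add_component
    by (intro tpoly.plus poly that tpoly.coeff smooth_intros S)
  obtain \<gamma> where curve: "\<And>p. p \<in> ?S \<Longrightarrow> integral_curve (?V p) (\<gamma> p)" and zero: "\<And>p. \<gamma> p 0 = 0"
    and smooth: "smooth_on ?S (\<lambda>p. \<gamma> p 1)"
    using triangular_ode_solution[OF S triV polyV] by blast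
  define q where "q a x = \<gamma> (a, x) 1 - x" for a x
  have "triangular w (q a)" if "a \<in> U" for a
    unfolding triangular_def
  proof (intro allI impI)
    fix k x x' assume agree: "agree_below w (w k) x x'"
    \<comment> \<open>In components of weight at most \<open>w k\<close> the tails agree, so the
      velocities differ by the constant \<open>x $ l - x' $ l\<close>. For \<open>w l < w k\<close>
      this is zero; in component \<open>k\<close> it integrates to exactly what the definition of
      \<open>q\<close> subtracts.\<close>
    have V: "?V (a, x) y $ l = ?V (a, x') y' $ l + (x $ l - x' $ l)"
      if "w l \<le> w k" "agree_below w (w l) y y'" for l y y'
      using that agree tri[OF \<open>a \<in> U\<close>, of l x x' y y'] by (simp add: agree_below_def)
    have "agree_below w (w k) (\<gamma> (a, x) s) (\<gamma> (a, x') s)" if "s \<in> {0..1}" for s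
      using that \<open>a \<in> U\<close> V agree
      by (intro integral_curves_agree_below[OF curve curve]) (auto simp: zero agree_below_def)
    then have "\<gamma> (a, x) 1 $ k = \<gamma> (a, x') 1 $ k + (x $ k - x' $ k) * 1"
      using \<open>a \<in> U\<close> V
      by (intro primitives_differ_linear[OF _ _ integral_curve_nth[OF curve] integral_curve_nth[OF curve]])
         (auto simp: zero)
    then show "q a x $ k = q a x' $ k" by (simp add: q_def)
  qed
  moreover have "smooth_on ?S (\<lambda>p. q (fst p) (snd p))"
    unfolding q_def using smooth by (intro smooth_intros S) simp
  ultimately obtain Q where Q: "smooth_on ?S (\<lambda>p. Q (fst p) (snd p))"
    "\<And>a y. a \<in> U \<Longrightarrow> Q a (y + q a y) = y" "\<And>a z. a \<in> U \<Longrightarrow> Q a z + q a (Q a z) = z"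
    using triangular_inverse[OF assms(1), of q w] by blast
  have E: "time_one_flow (\<lambda>y. x + g a x y) 0 = \<gamma> (a, x) 1" if "a \<in> U" for a x
    using time_one_flow_eq[OF curve[of "(a, x)"] zero triV[of "(a, x)"]] that by simp
  show thesis
    by (rule that[of "\<lambda>a x. \<gamma> (a, x) 1" Q]) (use smooth Q E in \<open>simp_all add: q_def\<close>)
qed

section \<open>Vector fields as differential operators\<close>

lemma line_has_derivative:
  "(f has_derivative f') (at (z + r *\<^sub>R u)) \<Longrightarrow> ((\<lambda>r. f (z + r *\<^sub>R u)) has_real_derivative f' u) (at r)"
  for f :: "'a::real_normed_vector \<Rightarrow> real"
proof -
  assume f: "(f has_derivative f') (at (z + r *\<^sub>R u))"
  have "((\<lambda>r. z + r *\<^sub>R u) has_derivative (\<lambda>h. h *\<^sub>R u)) (at r)"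
    by (auto intro!: derivative_eq_intros)
  from has_derivative_compose[OF this f]
  show ?thesis
    by (simp add: has_field_derivative_def linear_scale[OF has_derivative_linear[OF f]] mult.commute[of _ "f' u"])
qed

text \<open>The mean value theorem is applied first along \<open>u\<close>, then along
  \<open>v\<close>. The difference on the left is symmetric in \<open>u\<close> and
  \<open>v\<close>, so using the lemma in both orders compares the two mixed derivatives.\<close>

lemma second_difference:
  fixes f :: "'a::real_normed_vector \<Rightarrow> real"
  assumes "smooth_on S f" "s > 0"
    and S: "\<And>q r. q \<in> {0..s} \<Longrightarrow> r \<in> {0..s} \<Longrightarrow> x + q *\<^sub>R v + r *\<^sub>R u \<in> S"
  shows "\<exists>q r. 0 < q \<and> q < s \<and> 0 < r \<and> r < s \<and>
    f (x + s *\<^sub>R v + s *\<^sub>R u) - f (x + s *\<^sub>R v) - f (x + s *\<^sub>R u) + f x =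
      s * s * frechet_derivative (\<lambda>y. frechet_derivative f (at y) u) (at (x + q *\<^sub>R v + r *\<^sub>R u)) v"
proof -
  let ?Du = "\<lambda>y. frechet_derivative f (at y) u"
  have 1: "((\<lambda>r. f (x + q *\<^sub>R v + r *\<^sub>R u)) has_real_derivative ?Du (x + q *\<^sub>R v + r *\<^sub>R u)) (at r)"
    if "q \<in> {0..s}" "r \<in> {0..s}" for q r
    by (intro line_has_derivative smooth_on_imp_has_derivative[OF assms(1)] S that)
  have "\<exists>r. 0 < r \<and> r < s \<and>
     (f (x + s *\<^sub>R v + s *\<^sub>R u) - f (x + 0 *\<^sub>R v + s *\<^sub>R u)) - (f (x + s *\<^sub>R v + 0 *\<^sub>R u) - f (x + 0 *\<^sub>R v + 0 *\<^sub>R u)) =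
     (s - 0) * (?Du (x + s *\<^sub>R v + r *\<^sub>R u) - ?Du (x + 0 *\<^sub>R v + r *\<^sub>R u))"
    using assms(2)
    by (intro MVT2[of 0 s "\<lambda>r. f (x + s *\<^sub>R v + r *\<^sub>R u) - f (x + 0 *\<^sub>R v + r *\<^sub>R u)"] DERIV_diff 1) auto
  then obtain r where r: "0 < r" "r < s"
    "(f (x + s *\<^sub>R v + s *\<^sub>R u) - f (x + s *\<^sub>R u)) - (f (x + s *\<^sub>R v) - f x) =
     s * (?Du (x + s *\<^sub>R v + r *\<^sub>R u) - ?Du (x + r *\<^sub>R u))" by auto
  have 2: "((\<lambda>q. ?Du (x + r *\<^sub>R u + q *\<^sub>R v)) has_real_derivative
      frechet_derivative ?Du (at (x + r *\<^sub>R u + q *\<^sub>R v)) v) (at q)" if "q \<in> {0..s}" for q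
    using S[OF that, of r] r
    by (intro line_has_derivative smooth_on_imp_has_derivative[OF smooth_on_frechet_derivative[OF assms(1)]])
       (simp add: add_ac)
  have "\<exists>q. 0 < q \<and> q < s \<and> ?Du (x + r *\<^sub>R u + s *\<^sub>R v) - ?Du (x + r *\<^sub>R u + 0 *\<^sub>R v) =
      (s - 0) * frechet_derivative ?Du (at (x + r *\<^sub>R u + q *\<^sub>R v)) v"
    using assms(2) by (intro MVT2 2) auto
  then obtain q where q: "0 < q" "q < s" "?Du (x + s *\<^sub>R v + r *\<^sub>R u) - ?Du (x + r *\<^sub>R u) =
      s * frechet_derivative ?Du (at (x + q *\<^sub>R v + r *\<^sub>R u)) v"
    by (auto simp: add_ac)
  show ?thesis
    using q(1,2) r(1,2) r(3)[unfolded q(3)] by (intro exI[of _ q] exI[of _ r]) (simp add: mult_ac)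
qed

lemma symmetric_second_derivative:
  fixes f :: "'a::real_normed_vector \<Rightarrow> real"
  assumes "open S" "smooth_on S f" "x \<in> S"
  shows "frechet_derivative (\<lambda>y. frechet_derivative f (at y) u) (at x) v =
         frechet_derivative (\<lambda>y. frechet_derivative f (at y) v) (at x) u"
proof -
  define A where "A u v y = frechet_derivative (\<lambda>y. frechet_derivative f (at y) u) (at y) v" for u v y
  have "continuous_on S (A u v)" for u v
    unfolding A_def by (intro smooth_on_imp_continuous_on smooth_on_frechet_derivative assms)
  then have cont: "isCont (A u v) x" for u v
    using assms(1,3) continuous_on_eq_continuous_at by blast
  have "\<bar>A u v x - A v u x\<bar> < \<epsilon>" if "\<epsilon> > 0" for \<epsilon>
  proof -
    from \<open>\<epsilon> > 0\<close> have "\<epsilon> / 2 > 0" by simp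
    obtain d1 where d1: "d1 > 0" "\<And>y. dist y x < d1 \<Longrightarrow> dist (A u v y) (A u v x) < \<epsilon> / 2"
      using cont[of u v] \<open>\<epsilon> / 2 > 0\<close> unfolding continuous_at_eps_delta by metis
    obtain d2 where d2: "d2 > 0" "\<And>y. dist y x < d2 \<Longrightarrow> dist (A v u y) (A v u x) < \<epsilon> / 2"
      using cont[of v u] \<open>\<epsilon> / 2 > 0\<close> unfolding continuous_at_eps_delta by metis
    obtain d3 where d3: "d3 > 0" "ball x d3 \<subseteq> S"
      using assms open_contains_ball by blast
    define d where "d = min d1 (min d2 d3)"
    \<comment> \<open>All points reached with steps up to \<open>s\<close> along \<open>v\<close>
      and \<open>u\<close> stay within distance \<open>d\<close> of \<open>x\<close>; the summand 1
      keeps the denominator positive when both vectors vanish.\<close>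
    define s where "s = d / (norm u + norm v + 1) / 2"
    have "d > 0" using d1 d2 d3 by (simp add: d_def)
    then have "s > 0" unfolding s_def
      by (intro divide_pos_pos mult_pos_pos add_nonneg_pos) auto
    have close: "dist (x + q *\<^sub>R v + r *\<^sub>R u) x < d" if "q \<in> {0..s}" "r \<in> {0..s}" for q r
    proof -
      have "dist (x + q *\<^sub>R v + r *\<^sub>R u) x \<le> q * norm v + r * norm u"
        using norm_triangle_ineq[of "q *\<^sub>R v" "r *\<^sub>R u"] that by (simp add: dist_norm add_ac)
      also have "\<dots> \<le> s * norm v + s * norm u"
        using that by (intro add_mono mult_right_mono) auto
      also have "\<dots> < 2 * (s * (norm u + norm v + 1))"
        using \<open>s > 0\<close> norm_ge_zero[of u] norm_ge_zero[of v] by (simp add: algebra_simps add_nonneg_pos)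
      also have "\<dots> = d"
      proof -
        have "norm u + norm v + 1 \<noteq> 0" using norm_ge_zero[of u] norm_ge_zero[of v] by linarith
        moreover have "2 * (d / c / 2 * c) = d" if "c \<noteq> 0" for c using that by simp
        ultimately show ?thesis unfolding s_def by blast
      qed
      finally show ?thesis .
    qed
    have S: "x + q *\<^sub>R v + r *\<^sub>R u \<in> S" if "q \<in> {0..s}" "r \<in> {0..s}" for q r
      using close[OF that] d3 by (auto simp: d_def dist_commute subset_iff)
    have S': "x + q *\<^sub>R u + r *\<^sub>R v \<in> S" if "q \<in> {0..s}" "r \<in> {0..s}" for q r
      using S[OF that(2,1)] by (simp add: add_ac)
    obtain q r where 1: "0 < q" "q < s" "0 < r" "r < s"
      "f (x + s *\<^sub>R v + s *\<^sub>R u) - f (x + s *\<^sub>R v) - f (x + s *\<^sub>R u) + f x =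
      s * s * A u v (x + q *\<^sub>R v + r *\<^sub>R u)"
      using second_difference[OF assms(2) \<open>s > 0\<close> S] unfolding A_def by blast
    obtain q' r' where 2: "0 < q'" "q' < s" "0 < r'" "r' < s"
      "f (x + s *\<^sub>R u + s *\<^sub>R v) - f (x + s *\<^sub>R u) - f (x + s *\<^sub>R v) + f x =
      s * s * A v u (x + q' *\<^sub>R u + r' *\<^sub>R v)"
      using second_difference[OF assms(2) \<open>s > 0\<close> S'] unfolding A_def by blast
    have swap: "x + s *\<^sub>R u + s *\<^sub>R v = x + s *\<^sub>R v + s *\<^sub>R u"
      "x + q' *\<^sub>R u + r' *\<^sub>R v = x + r' *\<^sub>R v + q' *\<^sub>R u"
      by (simp_all add: add_ac)
    have "s * s * A u v (x + q *\<^sub>R v + r *\<^sub>R u) = s * s * A v u (x + r' *\<^sub>R v + q' *\<^sub>R u)"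
      using 1(5) 2(5)[unfolded swap] by linarith
    then have "A u v (x + q *\<^sub>R v + r *\<^sub>R u) = A v u (x + r' *\<^sub>R v + q' *\<^sub>R u)"
      using \<open>s > 0\<close> by simp
    moreover have "dist (A u v (x + q *\<^sub>R v + r *\<^sub>R u)) (A u v x) < \<epsilon> / 2"
      using close[of q r] 1 by (intro d1) (simp add: d_def)
    moreover have "dist (A v u (x + r' *\<^sub>R v + q' *\<^sub>R u)) (A v u x) < \<epsilon> / 2"
      using close[of r' q'] 2 by (intro d2) (simp add: d_def)
    ultimately show ?thesis unfolding dist_real_def by linarith
  qed
  from this[of "\<bar>A u v x - A v u x\<bar>"] have "A u v x = A v u x" by auto
  then show ?thesis by (simp add: A_def)
qed

lemma smooth_on_derivative_apply [smooth_intros]: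
  fixes f :: "'a::euclidean_space \<Rightarrow> 'b::real_normed_vector"
  assumes "open S" "smooth_on S f" "smooth_on S u"
  shows "smooth_on S (\<lambda>x. frechet_derivative f (at x) (u x))"
proof -
  have "smooth_on S (\<lambda>x. \<Sum>b\<in>Basis. (u x \<bullet> b) *\<^sub>R frechet_derivative f (at x) b)"
    by (intro smooth_intros assms smooth_on_frechet_derivative)
  then show ?thesis
    by (rule smooth_on_cong[OF assms(1)])
       (rule linear_eq_sum_Basis[symmetric, OF smooth_on_imp_linear[OF assms(2)]])
qed

lemma smooth_on_vf_apply [smooth_intros]:
  "open S \<Longrightarrow> smooth_on S Y \<Longrightarrow> smooth_on S f \<Longrightarrow> smooth_on S (vf_apply Y f)"
  unfolding vf_apply_def by (intro smooth_intros)

lemma smooth_on_lie_bracket [smooth_intros]: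
  "open S \<Longrightarrow> smooth_on S Y \<Longrightarrow> smooth_on S Z \<Longrightarrow> smooth_on S (lie_bracket Y Z)"
  unfolding lie_bracket_def by (intro smooth_intros)

lemma vf_apply_cong:
  assumes "open S" "smooth_on S f" "\<And>x. x \<in> S \<Longrightarrow> f x = g x" "x \<in> S"
  shows "vf_apply Y f x = vf_apply Y g x"
  unfolding vf_apply_def
  using frechet_derivative_transform_within_open[OF smooth_on_imp_differentiable[OF assms(2,4)] assms(1,4,3)]
  by simp

lemma vf_apply_mult:
  assumes "smooth_on S f" "smooth_on S g" "x \<in> S"
  shows "vf_apply Y (\<lambda>x. f x * g x) x = vf_apply Y f x * g x + f x * vf_apply Y g x"
  using frechet_derivative_eq[OF has_derivative_mult[OF smooth_on_imp_has_derivative[OF assms(1,3)]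
      smooth_on_imp_has_derivative[OF assms(2,3)]]]
  by (simp add: vf_apply_def)

lemma vf_apply_const [simp]: "vf_apply Y (\<lambda>x. c) = (\<lambda>x. 0)"
  by (simp add: vf_apply_def)

lemma vf_apply_sum:
  assumes "\<And>i. i \<in> I \<Longrightarrow> smooth_on S (f i)" "x \<in> S"
  shows "vf_apply Y (\<lambda>x. \<Sum>i\<in>I. f i x) x = (\<Sum>i\<in>I. vf_apply Y (f i) x)"
  using frechet_derivative_eq[OF has_derivative_sum[of I f, OF smooth_on_imp_has_derivative[OF assms]]]
  by (simp add: vf_apply_def)

lemma vf_apply_linear_combination:
  assumes "smooth_on S f" "x \<in> S" "Y x = (\<Sum>i\<in>I. h i *\<^sub>R Z i x)"
  shows "vf_apply Y f x = (\<Sum>i\<in>I. h i * vf_apply (Z i) f x)"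
  using linear_sum[OF smooth_on_imp_linear[OF assms(1,2)], of "\<lambda>i. h i *\<^sub>R Z i x" I]
  by (simp add: vf_apply_def assms(3) linear_scale[OF smooth_on_imp_linear[OF assms(1,2)]])

text \<open>Each order of application splits into a term containing the derivative of the inner
  field and a Hessian term. The Hessian terms cancel by symmetry, the others form the
  bracket.\<close>

lemma vf_apply_commutator:
  fixes Y Z :: "'n::finite vfield"
  assumes "open S" "smooth_on S Y" "smooth_on S Z" "smooth_on S f" "x \<in> S"
  shows "vf_apply Y (vf_apply Z f) x - vf_apply Z (vf_apply Y f) x = vf_apply (lie_bracket Y Z) f x"
proof -
  let ?H = "\<lambda>b c. frechet_derivative (\<lambda>y. frechet_derivative f (at y) b) (at x) c"
  have *: "vf_apply Y (vf_apply Z f) x = frechet_derivative f (at x) (frechet_derivative Z (at x) (Y x))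
      + (\<Sum>b\<in>Basis. \<Sum>c\<in>Basis. (Z x \<bullet> b) * (Y x \<bullet> c) * ?H b c)"
    if Y: "smooth_on S Y" and Z: "smooth_on S Z" for Y Z :: "'n vfield"
  proof -
    let ?f' = "\<lambda>y. frechet_derivative f (at y)"
    have "vf_apply Y (vf_apply Z f) x = vf_apply Y (\<lambda>y. \<Sum>b\<in>Basis. (Z y \<bullet> b) * ?f' y b) x"
    proof (rule vf_apply_cong[OF assms(1) _ _ assms(5)])
      show "vf_apply Z f y = (\<Sum>b\<in>Basis. (Z y \<bullet> b) * ?f' y b)" if "y \<in> S" for y
        using linear_eq_sum_Basis[OF smooth_on_imp_linear[OF assms(4) that], of "Z y"] by (simp add: vf_apply_def)
    qed (intro smooth_intros assms Z)
    also have "\<dots> = (\<Sum>b\<in>Basis. vf_apply Y (\<lambda>y. (Z y \<bullet> b) * ?f' y b) x)"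
      by (intro vf_apply_sum[OF _ assms(5)] smooth_intros smooth_on_frechet_derivative assms Z)
    also have "\<dots> = (\<Sum>b\<in>Basis. (frechet_derivative Z (at x) (Y x) \<bullet> b) * ?f' x b
        + (Z x \<bullet> b) * (\<Sum>c\<in>Basis. (Y x \<bullet> c) * ?H b c))"
    proof (rule sum.cong[OF refl])
      fix b :: "real^'n" assume "b \<in> Basis"
      have 1: "vf_apply Y (\<lambda>y. Z y \<bullet> b) x = frechet_derivative Z (at x) (Y x) \<bullet> b"
        using frechet_derivative_eq[OF has_derivative_inner_left[OF smooth_on_imp_has_derivative[OF Z assms(5)]]]
        by (simp add: vf_apply_def)
      have 2: "vf_apply Y (\<lambda>y. ?f' y b) x = (\<Sum>c\<in>Basis. (Y x \<bullet> c) * ?H b c)"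
        using linear_eq_sum_Basis[OF smooth_on_imp_linear[OF smooth_on_frechet_derivative[OF assms(4), of b] assms(5)], of "Y x"]
        by (simp add: vf_apply_def)
      show "vf_apply Y (\<lambda>y. (Z y \<bullet> b) * ?f' y b) x = (frechet_derivative Z (at x) (Y x) \<bullet> b) * ?f' x b
        + (Z x \<bullet> b) * (\<Sum>c\<in>Basis. (Y x \<bullet> c) * ?H b c)"
        unfolding 1[symmetric] 2[symmetric]
        by (intro vf_apply_mult[OF _ _ assms(5)] smooth_intros smooth_on_frechet_derivative assms Z)
    qed
    also have "\<dots> = ?f' x (frechet_derivative Z (at x) (Y x))
      + (\<Sum>b\<in>Basis. \<Sum>c\<in>Basis. (Z x \<bullet> b) * (Y x \<bullet> c) * ?H b c)"
      using linear_eq_sum_Basis[OF smooth_on_imp_linear[OF assms(4,5)], of "frechet_derivative Z (at x) (Y x)"]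
      by (simp add: sum.distrib sum_distrib_left mult.assoc)
    finally show ?thesis .
  qed
  have "(\<Sum>b\<in>Basis. \<Sum>c\<in>Basis. (Z x \<bullet> b) * (Y x \<bullet> c) * ?H b c) =
        (\<Sum>c\<in>Basis. \<Sum>b\<in>Basis. (Z x \<bullet> b) * (Y x \<bullet> c) * ?H b c)"
    by (rule sum.swap)
  also have "\<dots> = (\<Sum>b\<in>Basis. \<Sum>c\<in>Basis. (Y x \<bullet> b) * (Z x \<bullet> c) * ?H b c)"
    by (intro sum.cong refl) (metis symmetric_second_derivative[OF assms(1,4,5)] mult.commute)
  finally have sym: "(\<Sum>b\<in>Basis. \<Sum>c\<in>Basis. (Z x \<bullet> b) * (Y x \<bullet> c) * ?H b c) =
     (\<Sum>b\<in>Basis. \<Sum>c\<in>Basis. (Y x \<bullet> b) * (Z x \<bullet> c) * ?H b c)" .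
  have "vf_apply (lie_bracket Y Z) f x = frechet_derivative f (at x) (frechet_derivative Z (at x) (Y x))
      - frechet_derivative f (at x) (frechet_derivative Y (at x) (Z x))"
    unfolding vf_apply_def lie_bracket_def by (rule linear_diff[OF smooth_on_imp_linear[OF assms(4,5)]])
  then show ?thesis
    unfolding *[OF assms(2,3)] *[OF assms(3,2)] sym by simp
qed

section \<open>Iterated derivatives along words of fields\<close>

lemma vf_word_Nil [simp]: "vf_word X [] f = f"
  and vf_word_Cons: "vf_word X (i # I) f = vf_apply (X i) (vf_word X I f)"
  and vf_word_append: "vf_word X (I @ J) f = vf_word X I (vf_word X J f)"
  by (simp_all add: vf_word_def)

lemma word_weight_simps [simp]:
  "word_weight w [] = 0" "word_weight w (i # I) = w i + word_weight w I"
  "word_weight w (I @ J) = word_weight w I + word_weight w J"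
  by (simp_all add: word_weight_def)

lemma smooth_on_vf_word [smooth_intros]:
  "open S \<Longrightarrow> (\<And>j. smooth_on S (X j)) \<Longrightarrow> smooth_on S f \<Longrightarrow> smooth_on S (vf_word X I f)"
  by (induction I) (auto simp: vf_word_Cons intro: smooth_intros)

lemma vf_word_cong:
  assumes "open S" "\<And>j. smooth_on S (X j)" "smooth_on S f" "\<And>x. x \<in> S \<Longrightarrow> f x = g x" "x \<in> S"
  shows "vf_word X I f x = vf_word X I g x"
  using assms(5)
proof (induction I arbitrary: x)
  case (Cons i I)
  show ?case unfolding vf_word_Cons
    by (rule vf_apply_cong[OF assms(1) _ Cons.IH Cons.prems]) (auto intro: smooth_intros assms)
qed (use assms in auto)

lemma vf_word_sum:
  assumes "open S" "\<And>j. smooth_on S (X j)" "\<And>i. i \<in> A \<Longrightarrow> smooth_on S (f i)" "x \<in> S"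
  shows "vf_word X I (\<lambda>x. \<Sum>i\<in>A. f i x) x = (\<Sum>i\<in>A. vf_word X I (f i) x)"
  using assms(4)
proof (induction I arbitrary: x)
  case (Cons i I)
  have "vf_apply (X i) (vf_word X I (\<lambda>x. \<Sum>i\<in>A. f i x)) x
      = vf_apply (X i) (\<lambda>x. \<Sum>i\<in>A. vf_word X I (f i) x) x"
    by (rule vf_apply_cong[OF assms(1) _ Cons.IH Cons.prems]) (auto intro: smooth_intros assms)
  then show ?case unfolding vf_word_Cons
    using vf_apply_sum[of A S "\<lambda>i. vf_word X I (f i)" x] assms Cons.prems by (simp add: smooth_on_vf_word)
qed simp

lemma vf_word_cmult:
  assumes "open S" "\<And>j. smooth_on S (X j)" "smooth_on S f" "x \<in> S"
  shows "vf_word X I (\<lambda>x. c * f x) x = c * vf_word X I f x"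
  using assms(4)
proof (induction I arbitrary: x)
  case (Cons i I)
  have "vf_apply (X i) (vf_word X I (\<lambda>x. c * f x)) x = vf_apply (X i) (\<lambda>x. c * vf_word X I f x) x"
    by (rule vf_apply_cong[OF assms(1) _ Cons.IH Cons.prems])
       (intro smooth_on_vf_word smooth_on_mult smooth_on_const assms)
  also have "\<dots> = c * vf_apply (X i) (vf_word X I f) x"
    using vf_apply_mult[OF smooth_on_const[OF assms(1)] smooth_on_vf_word[OF assms(1-3), where I = I] Cons.prems] by simp
  finally show ?case unfolding vf_word_Cons .
qed simp

lemma vf_word_add:
  assumes "open S" "\<And>j. smooth_on S (X j)" "smooth_on S f" "smooth_on S g" "x \<in> S"
  shows "vf_word X I (\<lambda>x. f x + g x) x = vf_word X I f x + vf_word X I g x"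
  using vf_word_sum[OF assms(1,2), where A = "UNIV :: bool set" and f = "\<lambda>b. if b then f else g"] assms
  by (simp add: UNIV_bool add.commute)

text \<open>The parameter enters through the fields and the function, while all derivatives are
  taken in the second variable. Keeping the two apart allows them to be set equal after
  differentiating.\<close>

lemma smooth_on_vf_word_param:
  fixes f :: "'a::euclidean_space \<Rightarrow> real^'n::finite \<Rightarrow> real"
  assumes "open S" "\<And>j. smooth_on S (\<lambda>p. X (fst p) j (snd p))" "smooth_on S (\<lambda>p. f (fst p) (snd p))"
  shows "smooth_on S (\<lambda>p. vf_word (X (fst p)) I (f (fst p)) (snd p))"
proof (induction I)
  case (Cons i I)
  have "smooth_on S (\<lambda>p. frechet_derivative ((\<lambda>a. vf_word (X a) I (f a)) (fst p)) (at (snd p)) (X (fst p) i (snd p)))"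
    using Cons assms by (intro smooth_on_partial_derivative) simp_all
  then show ?case by (simp add: vf_word_Cons vf_apply_def)
qed (simp add: assms)

section \<open>The order of vanishing with respect to a frame\<close>

text \<open>Vanishing to order \<open>N\<close> at \<open>a\<close>, tested on words of length at most \<open>L\<close> only: this grading by
  length is what makes the order of an inverse matrix accessible by induction.\<close>

definition vanishes ::
    "('n::finite \<Rightarrow> nat) \<Rightarrow> ('n \<Rightarrow> 'n vfield) \<Rightarrow> real^'n \<Rightarrow> nat \<Rightarrow> int \<Rightarrow> (real^'n \<Rightarrow> real) \<Rightarrow> bool" where
  "vanishes w X a L N f \<longleftrightarrow>
     (\<forall>I. length I \<le> L \<longrightarrow> int (word_weight w I) < N \<longrightarrow> vf_word X I f a = 0)"

lemma vanishes_0: "vanishes w X a 0 N f \<longleftrightarrow> (0 < N \<longrightarrow> f a = 0)"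
  by (auto simp: vanishes_def)

text \<open>The last letter of a word acts first, so it is split off at the end and passes to the
  function. \<open>N\<close> is an integer because subtracting weights may lead below zero, where
  the condition becomes void.\<close>

lemma vanishes_Suc:
  "vanishes w X a (Suc L) N f \<longleftrightarrow>
     (0 < N \<longrightarrow> f a = 0) \<and> (\<forall>i. vanishes w X a L (N - int (w i)) (vf_apply (X i) f))" (is "?l \<longleftrightarrow> ?r")
proof
  assume l: ?l
  have "vf_word X I (vf_apply (X i) f) a = 0" if "length I \<le> L" "int (word_weight w I) < N - int (w i)" for i I
    using l[unfolded vanishes_def, rule_format, of "I @ [i]"] that by (simp add: vf_word_append vf_word_Cons)
  moreover have "0 < N \<longrightarrow> f a = 0" using l[unfolded vanishes_def, rule_format, of "[]"] by simp
  ultimately show ?r by (simp add: vanishes_def)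
next
  assume r: ?r
  show ?l unfolding vanishes_def
  proof (intro allI impI)
    fix I assume I: "length I \<le> Suc L" "int (word_weight w I) < N"
    show "vf_word X I f a = 0"
    proof (cases I rule: rev_cases)
      case Nil
      then show ?thesis using r I by simp
    next
      case (snoc J i)
      then have "vf_word X J (vf_apply (X i) f) a = 0" using r I by (simp add: vanishes_def)
      then show ?thesis using snoc by (simp add: vf_word_append vf_word_Cons)
    qed
  qed
qed

lemma vanishes_mono: "vanishes w X a L N f \<Longrightarrow> L' \<le> L \<Longrightarrow> N' \<le> N \<Longrightarrow> vanishes w X a L' N' f"
  by (auto simp: vanishes_def)

lemma vanishes_trivial: "N \<le> 0 \<Longrightarrow> vanishes w X a L N f"
  by (auto simp: vanishes_def)

context
  fixes S :: "(real^'n::finite) set" and X :: "'n \<Rightarrow> 'n vfield" and a :: "real^'n"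
  assumes S: "open S" "\<And>j. smooth_on S (X j)" "a \<in> S"
begin

lemma vanishes_cong:
  "smooth_on S f \<Longrightarrow> (\<And>x. x \<in> S \<Longrightarrow> f x = g x) \<Longrightarrow> vanishes w X a L N f \<Longrightarrow> vanishes w X a L N g"
  using vf_word_cong[OF S(1,2) _ _ S(3), where f = f and g = g] by (simp add: vanishes_def)

lemma vanishes_sum:
  "(\<And>i. i \<in> A \<Longrightarrow> smooth_on S (f i)) \<Longrightarrow> (\<And>i. i \<in> A \<Longrightarrow> vanishes w X a L N (f i)) \<Longrightarrow>
     vanishes w X a L N (\<lambda>x. \<Sum>i\<in>A. f i x)"
  using vf_word_sum[OF S(1,2) _ S(3), where A = A and f = f] by (simp add: vanishes_def)

lemma vanishes_add:
  "smooth_on S f \<Longrightarrow> smooth_on S g \<Longrightarrow> vanishes w X a L N f \<Longrightarrow> vanishes w X a L N g \<Longrightarrow>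
     vanishes w X a L N (\<lambda>x. f x + g x)"
  using vf_word_add[OF S(1,2) _ _ S(3), where f = f and g = g] by (simp add: vanishes_def)

lemma vanishes_cmult:
  "smooth_on S f \<Longrightarrow> vanishes w X a L N f \<Longrightarrow> vanishes w X a L N (\<lambda>x. c * f x)"
  using vf_word_cmult[OF S(1,2) _ S(3), where f = f] by (simp add: vanishes_def)

text \<open>Leibniz rule, by induction on \<open>L\<close>. Negative orders do no harm: if
  \<open>M + N\<close> is positive, so is \<open>M\<close> or \<open>N\<close>, and one of the two
  values at \<open>a\<close> is zero.\<close>

lemma vanishes_mult:
  assumes "smooth_on S f" "smooth_on S g" "vanishes w X a L M f" "vanishes w X a L N g"
  shows "vanishes w X a L (M + N) (\<lambda>x. f x * g x)"
  using assms
proof (induction L arbitrary: f g M N)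
  case 0
  then show ?case by (auto simp: vanishes_0)
next
  case (Suc L)
  have "vanishes w X a L (M + N - int (w i)) (vf_apply (X i) (\<lambda>x. f x * g x))" for i
  proof (rule vanishes_cong)
    show "smooth_on S (\<lambda>x. vf_apply (X i) f x * g x + f x * vf_apply (X i) g x)"
      by (intro smooth_intros S Suc.prems)
    show "vf_apply (X i) f x * g x + f x * vf_apply (X i) g x = vf_apply (X i) (\<lambda>x. f x * g x) x"
      if "x \<in> S" for x using vf_apply_mult[OF Suc.prems(1,2) that] by simp
    have "vanishes w X a L (M - int (w i)) (vf_apply (X i) f)" "vanishes w X a L (N - int (w i)) (vf_apply (X i) g)"
      "vanishes w X a L M f" "vanishes w X a L N g"
      using Suc.prems(3,4) vanishes_Suc[of w X a L M f] vanishes_Suc[of w X a L N g]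
        vanishes_mono[of w X a "Suc L"] by auto
    then have "vanishes w X a L ((M - int (w i)) + N) (\<lambda>x. vf_apply (X i) f x * g x)"
       "vanishes w X a L (M + (N - int (w i))) (\<lambda>x. f x * vf_apply (X i) g x)"
      using Suc.IH Suc.prems(1,2) smooth_on_vf_apply[OF S(1,2)] by simp_all
    then show "vanishes w X a L (M + N - int (w i)) (\<lambda>x. vf_apply (X i) f x * g x + f x * vf_apply (X i) g x)"
      by (intro vanishes_add smooth_on_mult smooth_on_vf_apply S Suc.prems) (simp_all add: algebra_simps)
  qed
  moreover have "0 < M + N \<longrightarrow> f a * g a = 0"
    using Suc.prems(3,4) vanishes_Suc[of w X a L M f] vanishes_Suc[of w X a L N g] by force
  ultimately show ?case unfolding vanishes_Suc by blast
qed

end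

section \<open>Weighted frames and the exchange of letters in a word\<close>

definition frame_coords :: "('n::finite \<Rightarrow> 'n vfield) \<Rightarrow> real^'n \<Rightarrow> real^'n \<Rightarrow> real^'n" where
  "frame_coords X x v =
     (\<chi> k. det (\<chi> i j. if j = k then v $ i else X j x $ i) / det (\<chi> i j. X j x $ i))"

lemma frame_coords_iff:
  assumes "det (\<chi> i j. X j x $ i) \<noteq> 0"
  shows "(\<Sum>j\<in>UNIV. y $ j *\<^sub>R X j x) = v \<longleftrightarrow> y = frame_coords X x v"
proof -
  have "(\<Sum>j\<in>UNIV. y $ j *\<^sub>R X j x) = (\<chi> i j. X j x $ i) *v y"
    by (simp add: matrix_vector_mult_def vec_eq_iff mult.commute)
  then show ?thesis using cramer[OF assms, of y v] by (simp add: frame_coords_def cong: if_cong)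
qed

section \<open>Words, their letter counts, and sorting by adjacent transpositions\<close>

lemma word_weight_eq_sum:
  fixes w :: "'n::finite \<Rightarrow> nat"
  shows "word_weight w I = (\<Sum>j\<in>UNIV. w j * count (mset I) j)"
proof (induction I)
  case (Cons i I)
  have "(\<Sum>j\<in>UNIV. w j * count (mset (i # I)) j) = (\<Sum>j\<in>UNIV. w j * count (mset I) j + (if j = i then w j else 0))"
    by (intro sum.cong) auto
  then show ?case using Cons by (simp add: sum.distrib)
qed simp

lemma length_eq_sum_count:
  fixes I :: "'n::finite list"
  shows "length I = (\<Sum>j\<in>UNIV. count (mset I) j)"
  using word_weight_eq_sum[of "\<lambda>_. 1" I] by (simp add: word_weight_def sum_list_triv)

text \<open>One representative for every multiset of letters: the ordered products of fields that
  play the role of a Poincare-Birkhoff-Witt basis.\<close>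

definition sorted_word :: "('n::{finite,linorder} \<Rightarrow> nat) \<Rightarrow> 'n list" where
  "sorted_word \<alpha> = sorted_list_of_multiset (Abs_multiset \<alpha>)"

lemma count_sorted_word [simp]: "count (mset (sorted_word \<alpha>)) = \<alpha>"
  by (simp add: sorted_word_def Abs_multiset_inverse)

lemma sorted_word_count: "sorted_word (count (mset I)) = sort I"
  by (simp add: sorted_word_def count_inverse)

lemma length_sorted_word: "length (sorted_word \<alpha>) = (\<Sum>j\<in>UNIV. \<alpha> j)"
  by (simp add: length_eq_sum_count)

lemma word_weight_sorted_word: "word_weight w (sorted_word \<alpha>) = (\<Sum>j\<in>UNIV. w j * \<alpha> j)"
  by (simp add: word_weight_eq_sum)

text \<open>Insertion moves \<open>x\<close> by adjacent transpositions, the letters already passed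
  being collected in the prefix \<open>J\<close>. The swap hypothesis is confined to one multiset
  \<open>m\<close>, as letters will only be exchanged within rearrangements of a given word.\<close>

lemma swap_invariant_insort:
  assumes "\<And>J i j K. mset (J @ i # j # K) = m \<Longrightarrow> v (J @ i # j # K) = v (J @ j # i # K)"
    and "mset (J @ x # ys) = m"
  shows "v (J @ x # ys) = v (J @ insort x ys)"
  using assms(2)
proof (induction ys arbitrary: J)
  case (Cons y ys)
  have "v (J @ x # y # ys) = v ((J @ [y]) @ x # ys)" using assms(1)[of J x y ys] Cons.prems by simp
  also have "\<dots> = v ((J @ [y]) @ insort x ys)" using Cons.prems by (intro Cons.IH) (simp add: add_mset_commute)
  finally show ?case by simp
qed simp

lemma swap_invariant_sort:
  assumes "\<And>J i j K. mset (J @ i # j # K) = m \<Longrightarrow> v (J @ i # j # K) = v (J @ j # i # K)"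
    and "mset (J @ xs) = m"
  shows "v (J @ xs) = v (J @ sort xs)"
  using assms(2)
proof (induction xs arbitrary: J)
  case (Cons x xs)
  have "v ((J @ [x]) @ xs) = v ((J @ [x]) @ sort xs)" using Cons.prems by (intro Cons.IH) simp
  also have "\<dots> = v (J @ x # sort xs)" by simp
  also have "\<dots> = v (J @ insort x (sort xs))"
    by (rule swap_invariant_insort[where m = m and v = v, OF assms(1)]) (use Cons.prems in simp_all)
  finally show ?case by simp
qed simp

locale frame =
  fixes U :: "(real^'n::{finite,linorder}) set" and X :: "'n \<Rightarrow> 'n vfield"
  assumes open_U: "open U"
    and smooth_X: "smooth_on U (X j)"
    and det_nonzero: "x \<in> U \<Longrightarrow> det (\<chi> i j. X j x $ i) \<noteq> 0"
begin

lemma frame_coords_sum: "x \<in> U \<Longrightarrow> (\<Sum>j\<in>UNIV. frame_coords X x v $ j *\<^sub>R X j x) = v"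
  by (simp add: frame_coords_iff det_nonzero)

lemma frame_coords_unique:
  "x \<in> U \<Longrightarrow> (\<Sum>j\<in>UNIV. y $ j *\<^sub>R X j x) = v \<Longrightarrow> frame_coords X x v = y"
  using frame_coords_iff[where X = X and x = x, OF det_nonzero, of y v] by simp

lemma linear_frame_coords:
  assumes "x \<in> U"
  shows "linear (frame_coords X x)"
proof
  show "frame_coords X x (u + v) = frame_coords X x u + frame_coords X x v" for u v
    by (intro frame_coords_unique assms)
       (simp add: scaleR_add_left sum.distrib frame_coords_sum[OF assms])
  show "frame_coords X x (r *\<^sub>R v) = r *\<^sub>R frame_coords X x v" for r v
  proof (intro frame_coords_unique assms)
    have "(\<Sum>j\<in>UNIV. (r *\<^sub>R frame_coords X x v) $ j *\<^sub>R X j x) =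
        r *\<^sub>R (\<Sum>j\<in>UNIV. frame_coords X x v $ j *\<^sub>R X j x)"
      by (simp add: scaleR_sum_right)
    then show "(\<Sum>j\<in>UNIV. (r *\<^sub>R frame_coords X x v) $ j *\<^sub>R X j x) = r *\<^sub>R v"
      by (simp only: frame_coords_sum[OF assms])
  qed
qed

lemma frame_coords_frame: "x \<in> U \<Longrightarrow> frame_coords X x (X j x) = axis j 1"
proof (intro frame_coords_unique)
  have "(\<Sum>i\<in>UNIV. axis j 1 $ i *\<^sub>R X i x) = (\<Sum>i\<in>UNIV. if i = j then X i x else 0)"
    by (intro sum.cong) (auto simp: axis_def)
  then show "(\<Sum>i\<in>UNIV. axis j 1 $ i *\<^sub>R X i x) = X j x" by simp
qed

lemma smooth_on_frame_coords:
  assumes "open S" "smooth_on S u" "smooth_on S v" "u ` S \<subseteq> U"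
  shows "smooth_on S (\<lambda>p. frame_coords X (u p) (v p))"
proof -
  have X: "smooth_on S (\<lambda>p. X j (u p) $ i)" for i j
    using smooth_on_vec_nth[OF assms(1), of "\<lambda>p. X j (u p)" i]
      smooth_on_compose[of S U "X j" u] assms(1,2,4) smooth_X[of j] by simp
  have v: "smooth_on S (\<lambda>p. v p $ i)" for i by (rule smooth_on_vec_nth[OF assms(1,3)])
  have "smooth_on S (\<lambda>p. if j = k then v p $ i else X j (u p) $ i)" for i j k
    by (cases "j = k") (simp_all add: X v)
  then have num: "smooth_on S (\<lambda>p. det (\<chi> i j. if j = k then v p $ i else X j (u p) $ i))" for k
    by (intro smooth_on_det assms(1)) simp
  have den: "smooth_on S (\<lambda>p. det (\<chi> i j. X j (u p) $ i))"
    by (intro smooth_on_det assms(1)) (simp add: X)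
  have "det (\<chi> i j. X j (u p) $ i) \<noteq> 0" if "p \<in> S" for p
    using det_nonzero[of "u p"] assms(4) that by blast
  then show ?thesis unfolding frame_coords_def
    by (intro smooth_on_vec_lambda[OF assms(1)] smooth_on_divide[OF assms(1) num den])
qed

end

text \<open>What is retained of the Carnot structure: positive weights, and brackets of frame fields
  without components heavier than the sum of the two weights. When that sum reaches the largest
  weight the bracket condition is void.\<close>

locale weighted_frame = frame U X
  for U :: "(real^'n::{finite,linorder}) set" and X +
  fixes w :: "'n \<Rightarrow> nat"
  assumes weight_pos: "0 < w j"
    and bracket_weight:
      "x \<in> U \<Longrightarrow> w i + w j < w k \<Longrightarrow> frame_coords X x (lie_bracket (X i) (X j) x) $ k = 0"
begin

text \<open>The words differ by one in which the bracket of \<open>X i\<close> and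
  \<open>X j\<close> replaces the two letters. Expanding it in the frame gives words one letter
  shorter and, by \<open>bracket_weight\<close>, no heavier, which vanish by \<open>IH\<close>; the
  smooth coefficients are absorbed by the product rule for orders.\<close>

lemma vf_word_swap:
  assumes a: "a \<in> U" and f: "smooth_on U f"
    and IH: "\<And>I. length I < length (J @ i # j # K) \<Longrightarrow> word_weight w I \<le> word_weight w (J @ i # j # K) \<Longrightarrow>
      vf_word X I f a = 0"
  shows "vf_word X (J @ i # j # K) f a = vf_word X (J @ j # i # K) f a"
proof -
  define g where "g = vf_word X K f"
  define c where "c k x = frame_coords X x (lie_bracket (X i) (X j) x) $ k" for k x
  have g: "smooth_on U g" unfolding g_def by (intro smooth_intros open_U smooth_X f)
  have c: "smooth_on U (c k)" for k
    unfolding c_def using smooth_X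
    by (intro smooth_on_vec_nth smooth_on_frame_coords smooth_intros open_U) auto
  have Xg: "smooth_on U (vf_apply (X k) g)" for k
    by (intro smooth_intros open_U smooth_X g)
  have "vf_apply (X i) (vf_apply (X j) g) x =
      vf_apply (X j) (vf_apply (X i) g) x + (\<Sum>k\<in>UNIV. c k x * vf_apply (X k) g x)" if "x \<in> U" for x
    using vf_apply_commutator[OF open_U smooth_X smooth_X g that, of i j]
      vf_apply_linear_combination[OF g that, where Y = "lie_bracket (X i) (X j)" and I = UNIV
        and h = "\<lambda>k. c k x" and Z = X]
      frame_coords_sum[OF that, of "lie_bracket (X i) (X j) x"]
    by (simp add: c_def)
  then have "vf_word X J (vf_apply (X i) (vf_apply (X j) g)) a = vf_word X J (\<lambda>x.
      vf_apply (X j) (vf_apply (X i) g) x + (\<Sum>k\<in>UNIV. c k x * vf_apply (X k) g x)) a"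
    by (intro vf_word_cong[OF open_U smooth_X _ _ a]) (intro smooth_intros open_U smooth_X g)
  also have "\<dots> = vf_word X J (vf_apply (X j) (vf_apply (X i) g)) a +
      vf_word X J (\<lambda>x. \<Sum>k\<in>UNIV. c k x * vf_apply (X k) g x) a"
    by (intro vf_word_add[OF open_U smooth_X _ _ a] smooth_intros open_U smooth_X g c)
  also have "vf_word X J (\<lambda>x. \<Sum>k\<in>UNIV. c k x * vf_apply (X k) g x) a =
      (\<Sum>k\<in>UNIV. vf_word X J (\<lambda>x. c k x * vf_apply (X k) g x) a)"
    by (intro vf_word_sum[OF open_U smooth_X _ a] smooth_intros open_U smooth_X g c)
  also have "\<dots> = 0"
  proof (intro sum.neutral ballI)
    fix k
    show "vf_word X J (\<lambda>x. c k x * vf_apply (X k) g x) a = 0"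
    proof (cases "w k \<le> w i + w j")
      case True
      have "vf_word X I (vf_apply (X k) g) a = 0"
        if "length I \<le> length J" "word_weight w I \<le> word_weight w J" for I
        using IH[of "I @ k # K"] that True by (simp add: g_def vf_word_append vf_word_Cons)
      \<comment> \<open>The bound exceeds the weight of \<open>J\<close> by one because
        \<open>vanishes\<close> tests strictly lighter words and \<open>J\<close> itself must be
        among them.\<close>
      then have 1: "vanishes w X a (length J) (int (word_weight w J) + 1) (vf_apply (X k) g)"
        by (simp add: vanishes_def)
      have "vanishes w X a (length J) (0 + (int (word_weight w J) + 1)) (\<lambda>x. c k x * vf_apply (X k) g x)"
        by (rule vanishes_mult[OF open_U smooth_X a c Xg vanishes_trivial 1]) simp
      then show ?thesis by (simp add: vanishes_def)
    next
      case False
      then have "vf_word X J (\<lambda>x. c k x * vf_apply (X k) g x) a = vf_word X J (\<lambda>x. 0 * vf_apply (X k) g x) a"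
        using bracket_weight by (intro vf_word_cong[OF open_U smooth_X _ _ a] smooth_intros open_U Xg c)
           (simp add: c_def)
      also have "\<dots> = 0"
        using vf_word_cmult[OF open_U smooth_X Xg a, where I = J and c = 0] by simp
      finally show ?thesis .
    qed
  qed
  finally show ?thesis by (simp add: vf_word_append vf_word_Cons g_def)
qed

text \<open>A commutator of two letters is a combination of shorter words of no larger weight, so by
  induction on the length only sorted words need to be tested.\<close>

lemma vf_word_zero_if_sorted_zero:
  assumes a: "a \<in> U" and f: "smooth_on U f"
    and sorted: "\<And>\<alpha>. (\<Sum>j\<in>UNIV. w j * \<alpha> j) < N \<Longrightarrow> vf_word X (sorted_word \<alpha>) f a = 0"
    and "word_weight w I < N"
  shows "vf_word X I f a = 0"
  using assms(4)
proof (induction "length I" arbitrary: I rule: less_induct)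
  case less
  have "vf_word X (J @ i # j # K) f a = vf_word X (J @ j # i # K) f a"
    if m: "mset (J @ i # j # K) = mset I" for J i j K
  proof (rule vf_word_swap[OF a f])
    fix I' assume "length I' < length (J @ i # j # K)"
      "word_weight w I' \<le> word_weight w (J @ i # j # K)"
    moreover have "length (J @ i # j # K) = length I" "word_weight w (J @ i # j # K) = word_weight w I"
      using m by (metis size_mset, metis word_weight_eq_sum)
    ultimately show "vf_word X I' f a = 0" using less by auto
  qed
  then have "vf_word X I f a = vf_word X (sort I) f a"
    using swap_invariant_sort[of "mset I" "\<lambda>I. vf_word X I f a" "[]" I] unfolding append_Nil by blast
  also have "\<dots> = 0"
    using sorted[of "count (mset I)"] less.prems by (simp add: sorted_word_count word_weight_eq_sum)
  finally show ?case .
qed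

end

section \<open>Monomials in coordinates adapted to a frame\<close>

definition monomial :: "('n::finite \<Rightarrow> nat) \<Rightarrow> real^'n \<Rightarrow> real" where
  "monomial \<alpha> y = (\<Prod>j\<in>UNIV. y $ j ^ \<alpha> j)"

lemma smooth_on_monomial [smooth_intros]:
  "open S \<Longrightarrow> smooth_on S f \<Longrightarrow> smooth_on S (\<lambda>x. monomial \<alpha> (f x))"
  unfolding monomial_def by (intro smooth_on_prod smooth_on_power smooth_on_vec_nth)

lemma frechet_derivative_nth:
  "smooth_on S f \<Longrightarrow> x \<in> S \<Longrightarrow> frechet_derivative (\<lambda>x. f x $ k) (at x) v = frechet_derivative f (at x) v $ k"
  using frechet_derivative_eq[OF bounded_linear.has_derivative[OF bounded_linear_vec_nth
        smooth_on_imp_has_derivative[of S f x]], of k] by simp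

context
  fixes S :: "(real^'n::finite) set" and X :: "'n \<Rightarrow> 'n vfield" and a :: "real^'n"
    and T :: "real^'n \<Rightarrow> real^'n"
  assumes S: "open S" "\<And>j. smooth_on S (X j)" "a \<in> S"
    and T: "smooth_on S T" "T a = 0"
begin

lemma vanishes_prod:
  assumes "finite A" "\<And>i. i \<in> A \<Longrightarrow> smooth_on S (f i)" "\<And>i. i \<in> A \<Longrightarrow> vanishes w X a L (N i) (f i)"
  shows "vanishes w X a L (\<Sum>i\<in>A. N i) (\<lambda>x. \<Prod>i\<in>A. f i x)"
  using assms
proof (induction A rule: finite_induct)
  case empty
  show ?case by (simp add: vanishes_trivial)
next
  case (insert i A)
  have "vanishes w X a L (N i + (\<Sum>i\<in>A. N i)) (\<lambda>x. f i x * (\<Prod>i\<in>A. f i x))"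
    using insert by (intro vanishes_mult[OF S] smooth_on_prod S(1)) auto
  then show ?case using insert.hyps by simp
qed

lemma vanishes_power:
  assumes "smooth_on S f" "vanishes w X a L N f"
  shows "vanishes w X a L (int m * N) (\<lambda>x. f x ^ m)"
  using vanishes_prod[of "{..<m}" "\<lambda>_. f" w L "\<lambda>_. N"] assms by simp

text \<open>With all weights 1, the weight of a word is its length and order counts ordinary degree;
  each coordinate of \<open>T\<close> has order at least 1 because \<open>T a = 0\<close>.\<close>

lemma vanishes_monomial: "vanishes (\<lambda>_. 1) X a L (int (\<Sum>j\<in>UNIV. \<alpha> j)) (\<lambda>x. monomial \<alpha> (T x))"
proof -
  have "vanishes (\<lambda>_. 1) X a L 1 (\<lambda>x. T x $ j)" for j
    using T(2) by (auto simp: vanishes_def word_weight_def sum_list_triv)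
  then have "vanishes (\<lambda>_. 1) X a L (\<Sum>j\<in>UNIV. int (\<alpha> j) * 1) (\<lambda>x. monomial \<alpha> (T x))"
    unfolding monomial_def
    by (intro vanishes_prod vanishes_power smooth_on_power smooth_on_vec_nth S(1) T(1)) auto
  then show ?thesis by simp
qed

lemma vf_word_monomial_short:
  "length I < (\<Sum>j\<in>UNIV. \<alpha> j) \<Longrightarrow> vf_word X I (\<lambda>x. monomial \<alpha> (T x)) a = 0"
  using vanishes_monomial[of "length I" \<alpha>]
  by (simp add: vanishes_def word_weight_def sum_list_triv del: of_nat_sum)

text \<open>For \<open>\<alpha> j = 0\<close> the truncated exponent \<open>\<alpha> j - 1\<close>
  is harmless, since the factor \<open>real (\<alpha> j)\<close> is zero.\<close>

lemma vf_apply_monomial: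
  assumes "x \<in> S"
  shows "vf_apply Y (\<lambda>x. monomial \<alpha> (T x)) x =
    (\<Sum>j\<in>UNIV. (real (\<alpha> j) * monomial (\<alpha>(j := \<alpha> j - 1)) (T x)) * vf_apply Y (\<lambda>x. T x $ j) x)"
proof -
  let ?d = "\<lambda>j. frechet_derivative (\<lambda>x. T x $ j) (at x)"
  have "((\<lambda>x. T x $ j) has_derivative ?d j) (at x)" for j
    using assms by (intro smooth_on_imp_has_derivative[of S] smooth_on_vec_nth S(1) T(1))
  then have "((\<lambda>x. T x $ j ^ \<alpha> j) has_derivative (\<lambda>v. of_nat (\<alpha> j) * ?d j v * T x $ j ^ (\<alpha> j - 1))) (at x)" for j
    by (rule has_derivative_power)
  then have "((\<lambda>x. monomial \<alpha> (T x)) has_derivative (\<lambda>v. \<Sum>j\<in>UNIV.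
      (of_nat (\<alpha> j) * ?d j v * T x $ j ^ (\<alpha> j - 1)) * (\<Prod>i\<in>UNIV - {j}. T x $ i ^ \<alpha> i))) (at x)"
    unfolding monomial_def by (rule has_derivative_prod)
  from frechet_derivative_eq[OF this]
  have "vf_apply Y (\<lambda>x. monomial \<alpha> (T x)) x = (\<Sum>j\<in>UNIV.
      (of_nat (\<alpha> j) * ?d j (Y x) * T x $ j ^ (\<alpha> j - 1)) * (\<Prod>i\<in>UNIV - {j}. T x $ i ^ \<alpha> i))"
    by (simp add: vf_apply_def)
  also have "\<dots> = (\<Sum>j\<in>UNIV. (real (\<alpha> j) * monomial (\<alpha>(j := \<alpha> j - 1)) (T x)) * vf_apply Y (\<lambda>x. T x $ j) x)"
  proof (rule sum.cong[OF refl])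
    fix j
    have "monomial (\<alpha>(j := \<alpha> j - 1)) (T x) = T x $ j ^ (\<alpha> j - 1) * (\<Prod>i\<in>UNIV - {j}. T x $ i ^ \<alpha> i)"
      unfolding monomial_def by (subst prod.remove[of _ j]) auto
    then show "(of_nat (\<alpha> j) * ?d j (Y x) * T x $ j ^ (\<alpha> j - 1)) * (\<Prod>i\<in>UNIV - {j}. T x $ i ^ \<alpha> i)
      = (real (\<alpha> j) * monomial (\<alpha>(j := \<alpha> j - 1)) (T x)) * vf_apply Y (\<lambda>x. T x $ j) x"
      by (simp add: vf_apply_def)
  qed
  finally show ?thesis .
qed

text \<open>At leading order the fields act at \<open>a\<close> like partial derivatives in the
  coordinates \<open>T\<close>, so the value is that of an iterated partial derivative of a monomial
  of equal degree.\<close>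

lemma vf_word_monomial:
  assumes normalized: "\<And>i j. vf_apply (X i) (\<lambda>x. T x $ j) a = axis i 1 $ j"
    and "length I = (\<Sum>j\<in>UNIV. \<alpha> j)"
  shows "vf_word X I (\<lambda>x. monomial \<alpha> (T x)) a =
    (if count (mset I) = \<alpha> then \<Prod>j\<in>UNIV. fact (\<alpha> j) else 0)"
  using assms(2)
proof (induction I arbitrary: \<alpha> rule: rev_induct)
  case Nil
  then have "\<alpha> = (\<lambda>_. 0)" by auto
  then show ?case by (simp add: monomial_def)
next
  case (snoc i J)
  define \<beta> where "\<beta> j = \<alpha>(j := \<alpha> j - 1)" for j
  \<comment> \<open>The deviation of \<open>X i\<close> from the \<open>i\<close>-th coordinate
    derivative vanishes at \<open>a\<close>. Multiplied by a monomial of degree one less, it regains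
    the full degree and is killed by the shorter word \<open>J\<close>.\<close>
  define r where "r j x = vf_apply (X i) (\<lambda>x. T x $ j) x - axis i 1 $ j" for j x
  have T': "smooth_on S (\<lambda>x. T x $ j)" for j by (intro smooth_on_vec_nth S(1) T(1))
  have r: "smooth_on S (r j)" for j unfolding r_def
    by (intro smooth_on_diff smooth_on_const smooth_on_vf_apply S(1,2) T')
  have m: "smooth_on S (\<lambda>x. monomial \<gamma> (T x))" for \<gamma> by (intro smooth_on_monomial S(1) T(1))
  have s: "smooth_on S (\<lambda>x. real (\<alpha> j) * (monomial (\<beta> j) (T x) * r j x))" for j
    by (intro smooth_on_mult smooth_on_const S(1) m r)
  have s': "smooth_on S (\<lambda>x. real (\<alpha> i) * monomial (\<beta> i) (T x))"
    by (intro smooth_on_mult smooth_on_const S(1) m)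
  have "vf_word X (J @ [i]) (\<lambda>x. monomial \<alpha> (T x)) a = vf_word X J (vf_apply (X i) (\<lambda>x. monomial \<alpha> (T x))) a"
    by (simp add: vf_word_append vf_word_Cons)
  also have "\<dots> = vf_word X J (\<lambda>x. real (\<alpha> i) * monomial (\<beta> i) (T x) +
      (\<Sum>j\<in>UNIV. real (\<alpha> j) * (monomial (\<beta> j) (T x) * r j x))) a"
  proof (rule vf_word_cong[OF S(1,2) _ _ S(3)])
    fix x assume "x \<in> S"
    have "(\<Sum>j\<in>UNIV. real (\<alpha> j) * monomial (\<beta> j) (T x) * (axis i 1 $ j)) =
        (\<Sum>j\<in>UNIV. if j = i then real (\<alpha> j) * monomial (\<beta> j) (T x) else 0)"
      by (intro sum.cong) (auto simp: axis_def)
    then have i: "(\<Sum>j\<in>UNIV. real (\<alpha> j) * monomial (\<beta> j) (T x) * (axis i 1 $ j)) = real (\<alpha> i) * monomial (\<beta> i) (T x)"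
      by simp
    have "vf_apply (X i) (\<lambda>x. monomial \<alpha> (T x)) x =
      (\<Sum>j\<in>UNIV. real (\<alpha> j) * monomial (\<beta> j) (T x) * (axis i 1 $ j) + real (\<alpha> j) * (monomial (\<beta> j) (T x) * r j x))"
      unfolding vf_apply_monomial[OF \<open>x \<in> S\<close>] \<beta>_def r_def
      by (intro sum.cong refl) (simp add: algebra_simps)
    then show "vf_apply (X i) (\<lambda>x. monomial \<alpha> (T x)) x = real (\<alpha> i) * monomial (\<beta> i) (T x) +
      (\<Sum>j\<in>UNIV. real (\<alpha> j) * (monomial (\<beta> j) (T x) * r j x))"
      by (simp only: sum.distrib i)
  qed (intro smooth_on_vf_apply S(1,2) m)
  also have "\<dots> = vf_word X J (\<lambda>x. real (\<alpha> i) * monomial (\<beta> i) (T x)) a +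
      vf_word X J (\<lambda>x. \<Sum>j\<in>UNIV. real (\<alpha> j) * (monomial (\<beta> j) (T x) * r j x)) a"
    by (intro vf_word_add[OF S(1,2) _ _ S(3)] s' smooth_on_sum S(1) s)
  also have "vf_word X J (\<lambda>x. \<Sum>j\<in>UNIV. real (\<alpha> j) * (monomial (\<beta> j) (T x) * r j x)) a = 0"
  proof -
    have "vf_word X J (\<lambda>x. real (\<alpha> j) * (monomial (\<beta> j) (T x) * r j x)) a = 0" for j
    proof (cases "\<alpha> j = 0")
      case True
      then show ?thesis using vf_word_cmult[OF S(1,2) smooth_on_mult[OF S(1) m r] S(3), where I = J and c = 0] by simp
    next
      case False
      have "vanishes (\<lambda>_. 1) X a (length J) 1 (r j)"
        using normalized by (auto simp: vanishes_def word_weight_def sum_list_triv r_def)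
      then have "vanishes (\<lambda>_. 1) X a (length J) (int (\<Sum>k\<in>UNIV. \<beta> j k) + 1) (\<lambda>x. monomial (\<beta> j) (T x) * r j x)"
        by (intro vanishes_mult[OF S] m r vanishes_monomial)
      moreover have "(\<Sum>k\<in>UNIV. \<alpha> k) = Suc (\<Sum>k\<in>UNIV. \<beta> j k)"
        using False by (subst (1 2) sum.remove[of _ j]) (auto simp: \<beta>_def)
      ultimately have "vf_word X J (\<lambda>x. monomial (\<beta> j) (T x) * r j x) a = 0"
        using snoc.prems by (simp add: vanishes_def word_weight_def sum_list_triv)
      then show ?thesis
        using vf_word_cmult[OF S(1,2) smooth_on_mult[OF S(1) m r] S(3), where I = J and c = "real (\<alpha> j)"] by simp
    qed
    then show ?thesis
      using vf_word_sum[where X = X and I = J and A = UNIV and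
          f = "\<lambda>j x. real (\<alpha> j) * (monomial (\<beta> j) (T x) * r j x)", OF S(1,2) s S(3)] by simp
  qed
  also have "vf_word X J (\<lambda>x. real (\<alpha> i) * monomial (\<beta> i) (T x)) a = real (\<alpha> i) * vf_word X J (\<lambda>x. monomial (\<beta> i) (T x)) a"
    by (rule vf_word_cmult[OF S(1,2) m S(3)])
  also have "real (\<alpha> i) * vf_word X J (\<lambda>x. monomial (\<beta> i) (T x)) a + 0 =
    (if count (mset (J @ [i])) = \<alpha> then \<Prod>j\<in>UNIV. fact (\<alpha> j) else 0)"
  proof (cases "\<alpha> i = 0")
    case True
    then have "count (mset (J @ [i])) \<noteq> \<alpha>" by (auto dest: fun_cong[of _ _ i])
    then show ?thesis using True by simp
  next
    case False
    have "(\<Sum>k\<in>UNIV. \<alpha> k) = Suc (\<Sum>k\<in>UNIV. \<beta> i k)"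
      using False by (subst (1 2) sum.remove[of _ i]) (auto simp: \<beta>_def)
    then have "vf_word X J (\<lambda>x. monomial (\<beta> i) (T x)) a =
        (if count (mset J) = \<beta> i then \<Prod>j\<in>UNIV. fact (\<beta> i j) else 0)"
      using snoc.prems by (intro snoc.IH) simp
    moreover have "count (mset J) = \<beta> i \<longleftrightarrow> count (mset (J @ [i])) = \<alpha>"
      using False by (auto simp: \<beta>_def fun_eq_iff)
    moreover have "real (\<alpha> i) * (\<Prod>j\<in>UNIV. fact (\<beta> i j)) = (\<Prod>j\<in>UNIV. fact (\<alpha> j))"
    proof -
      have "(fact (\<alpha> i) :: real) = real (\<alpha> i) * fact (\<alpha> i - 1)"
        using False by (simp add: fact_reduce)
      moreover have "(\<Prod>j\<in>UNIV - {i}. fact (\<beta> i j)) = (\<Prod>j\<in>UNIV - {i}. fact (\<alpha> j) :: real)"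
        by (intro prod.cong) (auto simp: \<beta>_def)
      ultimately show ?thesis
        by (subst (1 2) prod.remove[of _ i]) (auto simp: \<beta>_def mult_ac)
    qed
    ultimately show ?thesis by auto
  qed
  finally show ?case .
qed

end

section \<open>Privileged coordinates\<close>

lemma in_coords_apply:
  "inj_on \<phi> V \<Longrightarrow> x \<in> V \<Longrightarrow> in_coords V \<phi> Y (\<phi> x) = frechet_derivative \<phi> (at x) (Y x)"
  by (simp add: in_coords_def)

text \<open>With a global inverse \<open>\<rho>\<close>, the image of \<open>V\<close> is the
  preimage of \<open>V\<close> under \<open>\<rho>\<close>, hence open.\<close>

lemma local_coordsI:
  assumes "open V" "smooth_on UNIV \<phi>" "smooth_on UNIV \<rho>" "\<And>x. \<rho> (\<phi> x) = x" "\<And>y. \<phi> (\<rho> y) = y"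
  shows "local_coords V \<phi>"
proof -
  have inj: "inj_on \<phi> V" using assms(4) by (metis inj_onI)
  have im: "\<phi> ` V = \<rho> -` V"
  proof
    show "\<phi> ` V \<subseteq> \<rho> -` V" using assms(4) by auto
    show "\<rho> -` V \<subseteq> \<phi> ` V" using assms(5) by (metis image_eqI subsetI vimageE)
  qed
  have "continuous_on UNIV \<rho>" using assms(3) by (rule smooth_on_imp_continuous_on)
  then have op: "open (\<phi> ` V)" unfolding im using assms(1) by (simp add: open_vimage)
  have "smooth_on (\<phi> ` V) \<rho>" using assms(3) smooth_on_subset by blast
  then have "smooth_on (\<phi> ` V) (inv_into V \<phi>)"
    by (rule smooth_on_cong[OF op]) (auto simp: assms(4) inv_into_f_f[OF inj])
  then show ?thesis
    unfolding local_coords_def using assms(1,2) inj op smooth_on_subset by blast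
qed

definition psi_index :: "('n::finite \<Rightarrow> nat) \<Rightarrow> 'n \<Rightarrow> ('n \<Rightarrow> nat) set" where
  "psi_index w k = {\<alpha>. (\<Sum>j\<in>UNIV. w j * \<alpha> j) < w k \<and> 2 \<le> (\<Sum>j\<in>UNIV. \<alpha> j)}"

definition psi_poly :: "('n::finite \<Rightarrow> nat) \<Rightarrow> ('n \<Rightarrow> ('n \<Rightarrow> nat) \<Rightarrow> real) \<Rightarrow> real^'n \<Rightarrow> real^'n" where
  "psi_poly w c y = (\<chi> k. \<Sum>\<alpha>\<in>psi_index w k. c k \<alpha> * monomial \<alpha> y)"

lemma psi_hat_form_iff: "psi_hat_form w P \<longleftrightarrow> (\<exists>c. P = (\<lambda>y. y + psi_poly w c y))"
  by (simp add: psi_hat_form_def psi_poly_def psi_index_def monomial_def fun_eq_iff vec_eq_iff)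

lemma le_weighted_sum: "w (j::'n::finite) * \<alpha> j \<le> (\<Sum>j\<in>UNIV. w j * \<alpha> j :: nat)"
  by (rule member_le_sum) auto

text \<open>A monomial of weighted degree below \<open>w k\<close> can only contain variables of
  weight below \<open>w k\<close>.\<close>

lemma triangular_psi_poly: "triangular w (psi_poly w c)"
  unfolding triangular_def
proof (intro allI impI)
  fix k y y' assume agree: "agree_below w (w k) y y'"
  have "monomial \<alpha> y = monomial \<alpha> y'" if \<alpha>: "\<alpha> \<in> psi_index w k" for \<alpha>
    unfolding monomial_def
  proof (rule prod.cong[OF refl])
    fix j
    show "y $ j ^ \<alpha> j = y' $ j ^ \<alpha> j"
    proof (cases "\<alpha> j = 0")
      case False
      then have "w j \<le> w j * \<alpha> j" by simp
      also have "\<dots> < w k" using le_weighted_sum[of w j \<alpha>] \<alpha> by (simp add: psi_index_def)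
      finally show ?thesis using agree by (simp add: agree_below_def)
    qed simp
  qed
  then show "psi_poly w c y $ k = psi_poly w c y' $ k" by (simp add: psi_poly_def)
qed

lemma smooth_on_psi_poly:
  assumes "open S" "\<And>k \<alpha>. \<alpha> \<in> psi_index w k \<Longrightarrow> smooth_on S (\<lambda>x. c x k \<alpha>)" "smooth_on S f"
  shows "smooth_on S (\<lambda>x. psi_poly w (c x) (f x))"
  unfolding psi_poly_def
  by (intro smooth_on_vec_lambda smooth_on_sum smooth_on_mult smooth_on_monomial assms)

context weighted_frame
begin

lemma finite_psi_index: "finite (psi_index w k)"
proof (rule finite_subset)
  show "psi_index w k \<subseteq> (\<Pi>\<^sub>E j\<in>UNIV. {..w k})"
  proof
    fix \<alpha> assume \<alpha>: "\<alpha> \<in> psi_index w k"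
    have "\<alpha> j \<le> w k" for j
    proof -
      have "\<alpha> j \<le> w j * \<alpha> j" using weight_pos[of j] by simp
      also have "\<dots> \<le> w k" using le_weighted_sum[of w j \<alpha>] \<alpha> by (simp add: psi_index_def)
      finally show ?thesis .
    qed
    then show "\<alpha> \<in> (\<Pi>\<^sub>E j\<in>UNIV. {..w k})" by (auto simp: PiE_def extensional_def)
  qed
qed (simp add: finite_PiE)

section \<open>The affine coordinates adapted to the frame\<close>

definition lin_coords :: "(real, 'n) vec \<Rightarrow> (real, 'n) vec \<Rightarrow> (real, 'n) vec" where
  "lin_coords a x = frame_coords X a (x - a)"

definition lin_coords_inv :: "(real, 'n) vec \<Rightarrow> (real, 'n) vec \<Rightarrow> (real, 'n) vec" where
  "lin_coords_inv a y = a + (\<Sum>j\<in>UNIV. y $ j *\<^sub>R X j a)"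

lemma lin_coords_inverse [simp]:
  assumes "a \<in> U"
  shows "lin_coords_inv a (lin_coords a x) = x" "lin_coords a (lin_coords_inv a y) = y"
  using frame_coords_sum[OF assms] frame_coords_unique[OF assms]
  by (simp_all add: lin_coords_def lin_coords_inv_def)

lemma lin_coords_self [simp]: "a \<in> U \<Longrightarrow> lin_coords a a = 0"
  using linear_0[OF linear_frame_coords] by (simp add: lin_coords_def)

lemma open_U_UNIV: "open (U \<times> UNIV)"
  using open_U by (simp add: open_Times)

lemma smooth_on_lin_coords: "smooth_on (U \<times> UNIV) (\<lambda>p. lin_coords (fst p) (snd p))"
  unfolding lin_coords_def
  by (intro smooth_on_frame_coords smooth_intros open_U_UNIV) auto

lemma smooth_on_lin_coords_inv: "smooth_on (U \<times> UNIV) (\<lambda>p. lin_coords_inv (fst p) (snd p))"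
proof -
  have "smooth_on (U \<times> UNIV) (\<lambda>p. X j (fst p))" for j
    by (rule smooth_on_compose[OF open_U_UNIV smooth_X]) (auto intro: smooth_intros open_U_UNIV)
  then show ?thesis
    unfolding lin_coords_inv_def
    by (intro smooth_on_add smooth_on_sum smooth_on_scaleR smooth_on_vec_nth smooth_on_fst smooth_on_snd
        smooth_on_id open_U_UNIV)
qed

lemma smooth_on_fix_param:
  fixes f :: "(real, 'n) vec \<Rightarrow> (real, 'n) vec \<Rightarrow> 'c::real_normed_vector"
  assumes "smooth_on (U \<times> UNIV) (\<lambda>p. f (fst p) (snd p))" "a \<in> U"
  shows "smooth_on UNIV (f a)"
  using smooth_on_compose[OF open_UNIV assms(1), of "\<lambda>x. (a, x)"] assms(2)
  by (simp add: image_subset_iff smooth_on_Pair smooth_on_const smooth_on_id)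

lemma smooth_lin_coords: "a \<in> U \<Longrightarrow> smooth_on UNIV (lin_coords a)"
  by (rule smooth_on_fix_param[OF smooth_on_lin_coords])

lemma smooth_lin_coords_inv: "a \<in> U \<Longrightarrow> smooth_on UNIV (lin_coords_inv a)"
  by (rule smooth_on_fix_param[OF smooth_on_lin_coords_inv])

lemma lin_coords_has_derivative:
  assumes "a \<in> U"
  shows "(lin_coords a has_derivative frame_coords X a) (at x)"
proof -
  have "bounded_linear (frame_coords X a)"
    using linear_frame_coords[OF assms] by (simp add: linear_conv_bounded_linear)
  then have "((\<lambda>x. frame_coords X a (x - a)) has_derivative frame_coords X a) (at x)"
    by (rule bounded_linear.has_derivative) (auto intro!: derivative_eq_intros)
  then show ?thesis by (simp add: lin_coords_def[abs_def])
qed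

lemma vf_apply_lin_coords:
  assumes "a \<in> U"
  shows "vf_apply (X i) (\<lambda>x. lin_coords a x $ j) a = axis i 1 $ j"
  using frechet_derivative_nth[OF smooth_lin_coords[OF assms] UNIV_I, of j a "X i a"]
  by (simp add: vf_apply_def frechet_derivative_eq[OF lin_coords_has_derivative[OF assms]] frame_coords_frame[OF assms])

text \<open>For uniqueness, adaptedness forces the linear part to send each \<open>X j a\<close> to
  the \<open>j\<close>-th unit vector, which determines it on a basis; \<open>T a = 0\<close> then
  fixes the translation.\<close>

lemma T_map_eq:
  assumes a: "a \<in> U"
  shows "T_map U X a = lin_coords a"
  unfolding T_map_def
proof (rule the_equality)
  have lc: "local_coords U (lin_coords a)"
    by (rule local_coordsI[OF open_U smooth_lin_coords[OF a] smooth_lin_coords_inv[OF a]]) (simp_all add: a)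
  have "in_coords U (lin_coords a) (X j) 0 = axis j 1" for j
    using in_coords_apply[of "lin_coords a" U a "X j"] lc a
    by (simp add: local_coords_def frechet_derivative_eq[OF lin_coords_has_derivative[OF a]] frame_coords_frame[OF a])
  then have "linearly_adapted_at U X a (lin_coords a)"
    unfolding linearly_adapted_at_def using lc a by auto
  moreover have "affine_map (lin_coords a)"
    unfolding affine_map_def
    using linear_frame_coords[OF a] linear_diff[OF linear_frame_coords[OF a]]
    by (intro exI[of _ "frame_coords X a"] exI[of _ "- frame_coords X a a"]) (auto simp: lin_coords_def)
  ultimately show "affine_map (lin_coords a) \<and> linearly_adapted_at U X a (lin_coords a)" by simp
next
  fix T assume T: "affine_map T \<and> linearly_adapted_at U X a T"
  then obtain L b where L: "linear L" "T = (\<lambda>x. L x + b)" by (auto simp: affine_map_def)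
  obtain V where V: "a \<in> V" "inj_on T V" "T a = 0" "\<And>j. in_coords V T (X j) 0 = axis j 1"
    using T by (auto simp: linearly_adapted_at_def local_coords_def)
  have "(T has_derivative L) (at a)"
    unfolding L(2) using linear_conv_bounded_linear[of L] L(1)
    by (auto intro!: derivative_eq_intros bounded_linear_imp_has_derivative)
  then have LX: "L (X j a) = axis j 1" for j
    using in_coords_apply[OF V(2,1), of "X j"] V(3,4) frechet_derivative_eq[of T L a] by simp
  have "L v = frame_coords X a v" for v
  proof -
    have "L v = L (\<Sum>j\<in>UNIV. frame_coords X a v $ j *\<^sub>R X j a)" by (simp add: frame_coords_sum[OF a])
    also have "\<dots> = (\<Sum>j\<in>UNIV. frame_coords X a v $ j *\<^sub>R axis j 1)"
      by (simp add: linear_sum[OF L(1)] linear_scale[OF L(1)] LX)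
    also have "\<dots> = frame_coords X a v"
      using basis_expansion[of "frame_coords X a v"] by (simp add: scalar_mult_eq_scaleR)
    finally show ?thesis .
  qed
  moreover have "T x = L (x - a)" for x
    using V(3) L by (simp add: linear_diff algebra_simps eq_neg_iff_add_eq_0)
  ultimately show "T = lin_coords a" by (auto simp: lin_coords_def)
qed

text \<open>Obtained by requiring that the sorted word of \<alpha> annihilate component
  \<open>k\<close> of the corrected coordinates at \<open>a\<close>: the unknown coefficient enters
  with the factor \<alpha>!, and the other contributions come from lower degrees.\<close>

function psi_coeff :: "(real, 'n) vec \<Rightarrow> 'n \<Rightarrow> ('n \<Rightarrow> nat) \<Rightarrow> real" where
  "psi_coeff a k \<alpha> =
     - (vf_word X (sorted_word \<alpha>) (\<lambda>x. lin_coords a x $ k) a +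
        (\<Sum>\<beta> | \<beta> \<in> psi_index w k \<and> (\<Sum>j\<in>UNIV. \<beta> j) < (\<Sum>j\<in>UNIV. \<alpha> j).
           psi_coeff a k \<beta> * vf_word X (sorted_word \<alpha>) (\<lambda>x. monomial \<beta> (lin_coords a x)) a)) /
       (\<Prod>j\<in>UNIV. fact (\<alpha> j))"
  by pat_completeness auto
termination by (relation "Wellfounded.measure (\<lambda>(a, k, \<alpha>). \<Sum>j\<in>UNIV. \<alpha> j)") auto

declare psi_coeff.simps [simp del]

text \<open>Here \<open>a\<close> is both parameter and point of evaluation. The two roles are
  separated on \<open>U \<times> U\<close> while differentiating, and the result is restricted to
  the diagonal.\<close>

lemma smooth_on_vf_word_diagonal:
  assumes "smooth_on (U \<times> UNIV) (\<lambda>p. f (fst p) (snd p) :: real)"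
  shows "smooth_on U (\<lambda>a. vf_word X I (f a) a)"
proof -
  have UU: "open (U \<times> U)" using open_U by (simp add: open_Times)
  have "smooth_on (U \<times> U) (\<lambda>p. X j (snd p))" for j
    by (rule smooth_on_compose[OF UU smooth_X]) (auto intro: smooth_intros UU)
  then have "smooth_on (U \<times> U) (\<lambda>p. vf_word X I (f (fst p)) (snd p))"
    using smooth_on_subset[OF assms, of "U \<times> U"]
    by (intro smooth_on_vf_word_param[where X = "\<lambda>_. X"] UU) (auto simp: subset_iff)
  from smooth_on_compose[OF open_U this, of "\<lambda>a. (a, a)"] show ?thesis
    by (simp add: image_subset_iff smooth_on_Pair smooth_on_id open_U)
qed

lemma smooth_on_psi_coeff: "smooth_on U (\<lambda>a. psi_coeff a k \<alpha>)"
proof (induction "\<Sum>j\<in>UNIV. \<alpha> j" arbitrary: \<alpha> rule: less_induct)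
  case less
  have 1: "smooth_on U (\<lambda>a. vf_word X (sorted_word \<alpha>) (\<lambda>x. lin_coords a x $ k) a)"
    by (intro smooth_on_vf_word_diagonal smooth_on_vec_nth smooth_on_lin_coords open_U_UNIV)
  have 2: "smooth_on U (\<lambda>a. vf_word X (sorted_word \<alpha>) (\<lambda>x. monomial \<beta> (lin_coords a x)) a)" for \<beta>
    by (intro smooth_on_vf_word_diagonal smooth_on_monomial smooth_on_lin_coords open_U_UNIV)
  show ?case
    by (subst psi_coeff.simps)
       (intro smooth_on_divide smooth_on_uminus smooth_on_add smooth_on_sum smooth_on_mult
          smooth_on_const open_U 1 2 less, auto)
qed

section \<open>The equations for the polynomial correction at a fixed base point\<close>

context
  fixes a assumes a: "a \<in> U"
begin

lemma smooth_psi_poly_lin: "smooth_on UNIV (\<lambda>x. lin_coords a x + psi_poly w c (lin_coords a x))"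
  using smooth_lin_coords[OF a] by (intro smooth_on_add smooth_on_psi_poly[where c = "\<lambda>_. c"] smooth_on_const) auto

lemmas lin_coords_U = smooth_on_subset[OF smooth_lin_coords[OF a] subset_UNIV[of U]]

lemma vf_word_psi:
  "vf_word X I (\<lambda>x. (lin_coords a x + psi_poly w c (lin_coords a x)) $ k) a =
     vf_word X I (\<lambda>x. lin_coords a x $ k) a +
     (\<Sum>\<beta>\<in>psi_index w k. c k \<beta> * vf_word X I (\<lambda>x. monomial \<beta> (lin_coords a x)) a)"
proof -
  have T: "smooth_on U (\<lambda>x. lin_coords a x $ k)"
    by (intro smooth_on_vec_nth lin_coords_U open_U)
  have m: "smooth_on U (\<lambda>x. monomial \<beta> (lin_coords a x))" for \<beta>
    by (intro smooth_on_monomial lin_coords_U open_U)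
  have cm: "smooth_on U (\<lambda>x. c k \<beta> * monomial \<beta> (lin_coords a x))" for \<beta>
    by (intro smooth_on_mult smooth_on_const m open_U)
  have "vf_word X I (\<lambda>x. (lin_coords a x + psi_poly w c (lin_coords a x)) $ k) a =
      vf_word X I (\<lambda>x. lin_coords a x $ k + (\<Sum>\<beta>\<in>psi_index w k. c k \<beta> * monomial \<beta> (lin_coords a x))) a"
    by (simp add: psi_poly_def)
  also have "\<dots> = vf_word X I (\<lambda>x. lin_coords a x $ k) a +
      vf_word X I (\<lambda>x. \<Sum>\<beta>\<in>psi_index w k. c k \<beta> * monomial \<beta> (lin_coords a x)) a"
    by (rule vf_word_add[OF open_U smooth_X T _ a]) (intro smooth_on_sum cm open_U)
  also have "vf_word X I (\<lambda>x. \<Sum>\<beta>\<in>psi_index w k. c k \<beta> * monomial \<beta> (lin_coords a x)) a =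
      (\<Sum>\<beta>\<in>psi_index w k. vf_word X I (\<lambda>x. c k \<beta> * monomial \<beta> (lin_coords a x)) a)"
    by (rule vf_word_sum[where X = X and I = I, OF open_U smooth_X cm a])
  also have "\<dots> = (\<Sum>\<beta>\<in>psi_index w k. c k \<beta> * vf_word X I (\<lambda>x. monomial \<beta> (lin_coords a x)) a)"
    by (intro sum.cong refl vf_word_cmult[where X = X, OF open_U smooth_X m a])
  finally show ?thesis .
qed

lemma vf_word_monomial_lin:
  "length I < (\<Sum>j\<in>UNIV. \<beta> j) \<Longrightarrow> vf_word X I (\<lambda>x. monomial \<beta> (lin_coords a x)) a = 0"
  "length I = (\<Sum>j\<in>UNIV. \<beta> j) \<Longrightarrow> vf_word X I (\<lambda>x. monomial \<beta> (lin_coords a x)) a =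
     (if count (mset I) = \<beta> then \<Prod>j\<in>UNIV. fact (\<beta> j) else 0)"
  using vf_word_monomial_short[where X = X and T = "lin_coords a", OF open_U smooth_X a lin_coords_U]
    vf_word_monomial[where X = X and T = "lin_coords a", OF open_U smooth_X a lin_coords_U _ vf_apply_lin_coords[OF a]] a
  by auto

text \<open>Monomials of degree above the length of the word contribute nothing, and among those of
  equal degree only \<alpha> has matching letter counts. So the linear system is triangular with
  diagonal entries \<alpha>!.\<close>

lemma vf_word_psi_sorted:
  assumes "\<alpha> \<in> psi_index w k"
  shows "vf_word X (sorted_word \<alpha>) (\<lambda>x. (lin_coords a x + psi_poly w c (lin_coords a x)) $ k) a =
     vf_word X (sorted_word \<alpha>) (\<lambda>x. lin_coords a x $ k) a +
     (\<Sum>\<beta> | \<beta> \<in> psi_index w k \<and> (\<Sum>j\<in>UNIV. \<beta> j) < (\<Sum>j\<in>UNIV. \<alpha> j).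
        c k \<beta> * vf_word X (sorted_word \<alpha>) (\<lambda>x. monomial \<beta> (lin_coords a x)) a) +
     c k \<alpha> * (\<Prod>j\<in>UNIV. fact (\<alpha> j))"
proof -
  let ?g = "\<lambda>\<beta>. c k \<beta> * vf_word X (sorted_word \<alpha>) (\<lambda>x. monomial \<beta> (lin_coords a x)) a"
  let ?B = "{\<beta>. \<beta> \<in> psi_index w k \<and> (\<Sum>j\<in>UNIV. \<beta> j) < (\<Sum>j\<in>UNIV. \<alpha> j)}"
  have "?g \<beta> = 0" if "\<beta> \<in> psi_index w k - insert \<alpha> ?B" for \<beta>
  proof (cases "(\<Sum>j\<in>UNIV. \<alpha> j) < (\<Sum>j\<in>UNIV. \<beta> j)")
    case True
    then show ?thesis by (simp add: vf_word_monomial_lin(1) length_sorted_word)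
  next
    case False
    then have "(\<Sum>j\<in>UNIV. \<alpha> j) = (\<Sum>j\<in>UNIV. \<beta> j)" "\<alpha> \<noteq> \<beta>" using that by auto
    then show ?thesis by (simp add: vf_word_monomial_lin(2) length_sorted_word)
  qed
  then have "sum ?g (psi_index w k) = sum ?g (insert \<alpha> ?B)"
    using assms finite_psi_index by (intro sum.mono_neutral_right) auto
  also have "\<dots> = sum ?g ?B + ?g \<alpha>"
    using finite_subset[OF _ finite_psi_index, of ?B k] by simp
  also have "?g \<alpha> = c k \<alpha> * (\<Prod>j\<in>UNIV. fact (\<alpha> j))"
    by (simp add: vf_word_monomial_lin(2) length_sorted_word)
  finally show ?thesis unfolding vf_word_psi add.assoc by simp
qed

text \<open>From left to right the coefficients are read off by induction on the degree. Conversely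
  sorted words suffice, and for those of length at least 2 the recursion of \<open>psi_coeff\<close>
  is the equation to be verified.\<close>

lemma order_psi_iff:
  "(\<forall>I. word_weight w I < w k \<longrightarrow>
      vf_word X I (\<lambda>x. (lin_coords a x + psi_poly w c (lin_coords a x)) $ k) a = 0) \<longleftrightarrow>
   (\<forall>\<alpha>\<in>psi_index w k. c k \<alpha> = psi_coeff a k \<alpha>)" (is "?l \<longleftrightarrow> ?r")
proof
  assume l: ?l
  have "c k \<alpha> = psi_coeff a k \<alpha>" if "\<alpha> \<in> psi_index w k" for \<alpha>
    using that
  proof (induction "\<Sum>j\<in>UNIV. \<alpha> j" arbitrary: \<alpha> rule: less_induct)
    case less
    let ?p = "\<Prod>j\<in>UNIV. fact (\<alpha> j) :: real"
    have "?p \<noteq> 0" by simp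
    have "word_weight w (sorted_word \<alpha>) < w k"
      using less.prems by (simp add: word_weight_sorted_word psi_index_def)
    with l have "0 = vf_word X (sorted_word \<alpha>) (\<lambda>x. (lin_coords a x + psi_poly w c (lin_coords a x)) $ k) a"
      by simp
    also have "\<dots> = vf_word X (sorted_word \<alpha>) (\<lambda>x. lin_coords a x $ k) a +
     (\<Sum>\<beta> | \<beta> \<in> psi_index w k \<and> (\<Sum>j\<in>UNIV. \<beta> j) < (\<Sum>j\<in>UNIV. \<alpha> j).
        psi_coeff a k \<beta> * vf_word X (sorted_word \<alpha>) (\<lambda>x. monomial \<beta> (lin_coords a x)) a) +
     c k \<alpha> * ?p"
      unfolding vf_word_psi_sorted[OF less.prems] using less.hyps by simp
    finally have "c k \<alpha> * ?p = psi_coeff a k \<alpha> * ?p"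
      by (subst psi_coeff.simps) (use \<open>?p \<noteq> 0\<close> in simp)
    then show ?case using \<open>?p \<noteq> 0\<close> by simp
  qed
  then show ?r by blast
next
  assume r: ?r
  let ?f = "\<lambda>x. (lin_coords a x + psi_poly w c (lin_coords a x)) $ k"
  have f: "smooth_on U ?f"
    by (intro smooth_on_vec_nth open_U smooth_on_subset[OF smooth_psi_poly_lin]) simp
  have "vf_word X (sorted_word \<alpha>) ?f a = 0" if "(\<Sum>j\<in>UNIV. w j * \<alpha> j) < w k" for \<alpha>
  proof (cases "2 \<le> (\<Sum>j\<in>UNIV. \<alpha> j)")
    case True
    let ?p = "\<Prod>j\<in>UNIV. fact (\<alpha> j) :: real"
    have \<alpha>: "\<alpha> \<in> psi_index w k" using True that by (simp add: psi_index_def)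
    have "?p \<noteq> 0" by simp
    have "c k \<alpha> * ?p = psi_coeff a k \<alpha> * ?p" using r \<alpha> by simp
    also have "\<dots> = - (vf_word X (sorted_word \<alpha>) (\<lambda>x. lin_coords a x $ k) a +
     (\<Sum>\<beta> | \<beta> \<in> psi_index w k \<and> (\<Sum>j\<in>UNIV. \<beta> j) < (\<Sum>j\<in>UNIV. \<alpha> j).
        psi_coeff a k \<beta> * vf_word X (sorted_word \<alpha>) (\<lambda>x. monomial \<beta> (lin_coords a x)) a))"
      by (subst psi_coeff.simps) (use \<open>?p \<noteq> 0\<close> in simp)
    finally show ?thesis unfolding vf_word_psi_sorted[OF \<alpha>] using r by simp
  next
    case False
    \<comment> \<open>Words of length 0 and 1 do not see the correction, whose degree is at least 2.
      The empty word gives 0 at the centre, and a letter lighter than \<open>w k\<close> is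
      different from \<open>k\<close>.\<close>
    have "vf_word X (sorted_word \<alpha>) (\<lambda>x. monomial \<beta> (lin_coords a x)) a = 0" if "\<beta> \<in> psi_index w k" for \<beta>
      using False that by (intro vf_word_monomial_lin(1)) (auto simp: length_sorted_word psi_index_def)
    moreover have "vf_word X (sorted_word \<alpha>) (\<lambda>x. lin_coords a x $ k) a = 0"
    proof (cases "sorted_word \<alpha>")
      case Nil
      then show ?thesis using a by simp
    next
      case (Cons i I)
      then have I: "I = []" using False length_sorted_word[of \<alpha>] by (cases I) auto
      then have "w i < w k" using that Cons word_weight_sorted_word[of w \<alpha>] by simp
      then have "i \<noteq> k" by auto
      then show ?thesis using Cons I vf_apply_lin_coords[OF a, of i k] by (simp add: vf_word_Cons axis_def)
    qed
    ultimately show ?thesis unfolding vf_word_psi by simp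
  qed
  then show ?l using vf_word_zero_if_sorted_zero[OF a f] by blast
qed

lemma vf_apply_psi:
  "vf_apply (X i) (\<lambda>x. (lin_coords a x + psi_poly w c (lin_coords a x)) $ k) a = axis i 1 $ k"
proof -
  have "vf_word X [i] (\<lambda>x. monomial \<beta> (lin_coords a x)) a = 0" if "\<beta> \<in> psi_index w k" for \<beta>
    using that by (intro vf_word_monomial_lin(1)) (simp add: psi_index_def)
  then show ?thesis
    using vf_word_psi[of "[i]" c k] vf_apply_lin_coords[OF a] by (simp add: vf_word_Cons)
qed

lemma psi_poly_0: "psi_poly w c 0 = 0"
proof -
  have "monomial \<alpha> (0 :: (real, 'n) vec) = 0" if "\<alpha> \<in> psi_index w k" for \<alpha> k
  proof -
    have "(\<Sum>j\<in>UNIV. \<alpha> j) \<noteq> 0" using that by (auto simp: psi_index_def simp del: sum_eq_0_iff)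
    then obtain j where "\<alpha> j \<noteq> 0" by (meson sum.neutral)
    then show ?thesis by (auto simp: monomial_def)
  qed
  then show ?thesis by (simp add: psi_poly_def vec_eq_iff)
qed

text \<open>The coefficients are arbitrary because uniqueness of \<open>psi_hat\<close> requires
  deciding for every candidate whether it is privileged.\<close>

lemma psi_poly_lin_inverse:
  obtains \<rho> where "smooth_on UNIV \<rho>"
    "\<And>x. \<rho> (lin_coords a x + psi_poly w c (lin_coords a x)) = x"
    "\<And>y. lin_coords a (\<rho> y) + psi_poly w c (lin_coords a (\<rho> y)) = y"
proof -
  have "open (U \<times> (UNIV :: (real, 'n) vec set))" by (rule open_U_UNIV)
  then have "smooth_on (U \<times> UNIV) (\<lambda>p. psi_poly w c (snd p))"
    by (intro smooth_on_psi_poly[where c = "\<lambda>_. c"] smooth_on_const smooth_on_snd smooth_on_id)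
  then obtain Q where Q: "smooth_on (U \<times> UNIV) (\<lambda>p. Q (fst p) (snd p))"
    "\<And>a y. a \<in> U \<Longrightarrow> Q a (y + psi_poly w c y) = y" "\<And>a z. a \<in> U \<Longrightarrow> Q a z + psi_poly w c (Q a z) = z"
    using triangular_inverse[OF open_U, of "\<lambda>_. psi_poly w c" w] triangular_psi_poly by blast
  show thesis
  proof (rule that[of "\<lambda>y. lin_coords_inv a (Q a y)"])
    show "smooth_on UNIV (\<lambda>y. lin_coords_inv a (Q a y))"
      using smooth_on_fix_param[OF Q(1) a] smooth_lin_coords_inv[OF a]
      by (intro smooth_on_compose[where g = "lin_coords_inv a" and f = "Q a"]) auto
  qed (simp_all add: a Q)
qed

text \<open>Every candidate is linearly adapted, as terms of degree at least 2 leave first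
  derivatives at \<open>a\<close> unchanged, so only the order conditions distinguish them. The word
  \<open>[k]\<close> witnesses that the order does not exceed \<open>w k\<close>.\<close>

lemma privileged_iff:
  "privileged_at U w X a ((\<lambda>y. y + psi_poly w c y) \<circ> lin_coords a) \<longleftrightarrow>
     (\<forall>k. \<forall>\<alpha>\<in>psi_index w k. c k \<alpha> = psi_coeff a k \<alpha>)"
proof -
  define \<phi> where "\<phi> x = lin_coords a x + psi_poly w c (lin_coords a x)" for x
  have \<phi>: "(\<lambda>y. y + psi_poly w c y) \<circ> lin_coords a = \<phi>" by (auto simp: \<phi>_def)
  obtain \<rho> where \<rho>: "smooth_on UNIV \<rho>" "\<And>x. \<rho> (\<phi> x) = x" "\<And>y. \<phi> (\<rho> y) = y"
    using psi_poly_lin_inverse[of c] unfolding \<phi>_def by blast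
  have smooth: "smooth_on UNIV \<phi>" unfolding \<phi>_def[abs_def] by (rule smooth_psi_poly_lin)
  have "local_coords U \<phi>" by (rule local_coordsI[OF open_U smooth \<rho>])
  moreover have "\<phi> a = 0" by (simp add: \<phi>_def a psi_poly_0)
  moreover have "in_coords U \<phi> (X j) 0 = axis j 1" for j
    unfolding vec_eq_iff
  proof
    fix k
    have "in_coords U \<phi> (X j) 0 = frechet_derivative \<phi> (at a) (X j a)"
      using in_coords_apply[of \<phi> U a "X j"] calculation a by (simp add: local_coords_def)
    then have "in_coords U \<phi> (X j) 0 $ k = vf_apply (X j) (\<lambda>x. \<phi> x $ k) a"
      by (simp add: vf_apply_def frechet_derivative_nth[OF smooth])
    then show "in_coords U \<phi> (X j) 0 $ k = axis j 1 $ k"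
      using vf_apply_psi[of j c k] by (simp add: \<phi>_def[abs_def])
  qed
  ultimately have la: "linearly_adapted_at U X a \<phi>"
    unfolding linearly_adapted_at_def using a by blast
  have "has_order_at w X a (\<lambda>x. \<phi> x $ k) (w k) \<longleftrightarrow> (\<forall>\<alpha>\<in>psi_index w k. c k \<alpha> = psi_coeff a k \<alpha>)" for k
  proof -
    have "vf_word X [k] (\<lambda>x. \<phi> x $ k) a = 1"
      using vf_apply_psi[of k c k] by (simp add: \<phi>_def[abs_def] vf_word_Cons axis_def)
    then have "\<exists>I. word_weight w I = w k \<and> vf_word X I (\<lambda>x. \<phi> x $ k) a \<noteq> 0"
      by (intro exI[of _ "[k]"]) simp
    then show ?thesis
      unfolding has_order_at_def using order_psi_iff[of k c] by (simp add: \<phi>_def[abs_def])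
  qed
  then show ?thesis unfolding \<phi> privileged_at_def using la by blast
qed

lemma psi_map_eq: "psi_map U w X a x = lin_coords a x + psi_poly w (psi_coeff a) (lin_coords a x)"
proof -
  have "psi_hat U w X a = (\<lambda>y. y + psi_poly w (psi_coeff a) y)"
    unfolding psi_hat_def T_map_eq[OF a]
  proof (rule the_equality)
    show "psi_hat_form w (\<lambda>y. y + psi_poly w (psi_coeff a) y) \<and>
        privileged_at U w X a ((\<lambda>y. y + psi_poly w (psi_coeff a) y) \<circ> lin_coords a)"
      unfolding privileged_iff psi_hat_form_iff by auto
  next
    fix P assume P: "psi_hat_form w P \<and> privileged_at U w X a (P \<circ> lin_coords a)"
    then obtain c where c: "P = (\<lambda>y. y + psi_poly w c y)" unfolding psi_hat_form_iff by blast
    with P have "\<forall>k. \<forall>\<alpha>\<in>psi_index w k. c k \<alpha> = psi_coeff a k \<alpha>" using privileged_iff[of c] by simp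
    \<comment> \<open>Coefficients are determined only on \<open>psi_index\<close>; these are the
      ones that enter \<open>psi_poly\<close>, so the maps coincide.\<close>
    then show "P = (\<lambda>y. y + psi_poly w (psi_coeff a) y)"
      unfolding c psi_poly_def by simp
  qed
  then show ?thesis by (simp add: psi_map_def T_map_eq[OF a])
qed

end

section \<open>The privileged coordinates as a family in the base point\<close>

definition psi :: "(real, 'n) vec \<Rightarrow> (real, 'n) vec \<Rightarrow> (real, 'n) vec" where
  "psi a x = lin_coords a x + psi_poly w (psi_coeff a) (lin_coords a x)"

lemma smooth_on_psi_coeff_fst: "smooth_on (U \<times> UNIV) (\<lambda>p. psi_coeff (fst p) k \<alpha>)"
  by (rule smooth_on_compose[OF open_U_UNIV smooth_on_psi_coeff]) (auto intro: smooth_intros open_U_UNIV)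

lemma smooth_on_psi: "smooth_on (U \<times> UNIV) (\<lambda>p. psi (fst p) (snd p))"
  unfolding psi_def
  by (intro smooth_on_add smooth_on_psi_poly smooth_on_lin_coords smooth_on_psi_coeff_fst open_U_UNIV)

lemma psi_inverse:
  obtains \<rho> where "smooth_on (U \<times> UNIV) (\<lambda>p. \<rho> (fst p) (snd p))"
    "\<And>a x. a \<in> U \<Longrightarrow> \<rho> a (psi a x) = x" "\<And>a y. a \<in> U \<Longrightarrow> psi a (\<rho> a y) = y"
proof -
  have "smooth_on (U \<times> UNIV) (\<lambda>p. psi_poly w (psi_coeff (fst p)) (snd p))"
    by (intro smooth_on_psi_poly smooth_on_psi_coeff_fst smooth_on_snd smooth_on_id open_U_UNIV)
  then obtain Q where Q: "smooth_on (U \<times> UNIV) (\<lambda>p. Q (fst p) (snd p))"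
    "\<And>a y. a \<in> U \<Longrightarrow> Q a (y + psi_poly w (psi_coeff a) y) = y"
    "\<And>a z. a \<in> U \<Longrightarrow> Q a z + psi_poly w (psi_coeff a) (Q a z) = z"
    using triangular_inverse[OF open_U, of "\<lambda>a. psi_poly w (psi_coeff a)" w] triangular_psi_poly by blast
  show thesis
  proof (rule that[of "\<lambda>a y. lin_coords_inv a (Q a y)"])
    show "smooth_on (U \<times> UNIV) (\<lambda>p. lin_coords_inv (fst p) (Q (fst p) (snd p)))"
      by (rule smooth_on_compose2[OF open_U_UNIV smooth_on_lin_coords_inv smooth_on_fst[OF open_U_UNIV smooth_on_id[OF open_U_UNIV]] Q(1)]) auto
  qed (simp_all add: psi_def Q)
qed

lemma vf_word_psi_zero:
  "a \<in> U \<Longrightarrow> word_weight w I < w k \<Longrightarrow> vf_word X I (\<lambda>x. psi a x $ k) a = 0"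
  unfolding psi_def using order_psi_iff[of a k "psi_coeff a"] by blast

lemma vf_apply_psi_self: "a \<in> U \<Longrightarrow> vf_apply (X i) (\<lambda>x. psi a x $ k) a = axis i 1 $ k"
  unfolding psi_def by (rule vf_apply_psi)

lemma psi_self: "a \<in> U \<Longrightarrow> psi a a = 0"
  by (simp add: psi_def psi_poly_0)

end

section \<open>Order of vanishing in privileged coordinates\<close>

context weighted_frame
begin

definition psi_inv :: "(real, 'n) vec \<Rightarrow> (real, 'n) vec \<Rightarrow> (real, 'n) vec" where
  "psi_inv a = inv (psi a)"

lemma psi_inv_facts:
  "smooth_on (U \<times> UNIV) (\<lambda>p. psi_inv (fst p) (snd p))"
  "a \<in> U \<Longrightarrow> psi_inv a (psi a x) = x" "a \<in> U \<Longrightarrow> psi a (psi_inv a y) = y"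
proof -
  obtain \<rho> where \<rho>: "smooth_on (U \<times> UNIV) (\<lambda>p. \<rho> (fst p) (snd p))"
    "\<And>a x. a \<in> U \<Longrightarrow> \<rho> a (psi a x) = x" "\<And>a y. a \<in> U \<Longrightarrow> psi a (\<rho> a y) = y"
    using psi_inverse by blast
  have eq: "psi_inv a = \<rho> a" if "a \<in> U" for a
    unfolding psi_inv_def using \<rho>(2,3)[OF that] by (intro inv_unique_comp) auto
  show "smooth_on (U \<times> UNIV) (\<lambda>p. psi_inv (fst p) (snd p))"
    by (rule smooth_on_cong[OF open_U_UNIV \<rho>(1)]) (auto simp: eq)
  show "a \<in> U \<Longrightarrow> psi_inv a (psi a x) = x" "a \<in> U \<Longrightarrow> psi a (psi_inv a y) = y"
    using \<rho> eq by auto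
qed

text \<open>The coordinate fields of the coordinates \<open>psi a\<close>, as fields on the original domain.\<close>

definition coord_field :: "(real, 'n) vec \<Rightarrow> 'n \<Rightarrow> (real, 'n) vec \<Rightarrow> (real, 'n) vec" where
  "coord_field a k x = frechet_derivative (psi_inv a) (at (psi a x)) (axis k 1)"

text \<open>The matrix \<open>b\<close> that expresses the frame through the coordinate fields;
  \<open>coord_comp\<close> is its inverse \<open>c\<close>.\<close>

definition frame_comp :: "(real, 'n) vec \<Rightarrow> 'n \<Rightarrow> 'n \<Rightarrow> (real, 'n) vec \<Rightarrow> real" where
  "frame_comp a j k = vf_apply (X j) (\<lambda>x. psi a x $ k)"

definition coord_comp :: "(real, 'n) vec \<Rightarrow> 'n \<Rightarrow> 'n \<Rightarrow> (real, 'n) vec \<Rightarrow> real" where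
  "coord_comp a k j x = frame_coords X x (coord_field a k x) $ j"

lemma smooth_on_coord_field: "smooth_on (U \<times> UNIV) (\<lambda>p. coord_field (fst p) k (snd p))"
proof -
  have "smooth_on (U \<times> UNIV) (\<lambda>p. frechet_derivative (psi_inv (fst p)) (at (snd p)) (axis k 1))"
    by (intro smooth_on_partial_derivative psi_inv_facts(1) smooth_on_const open_U_UNIV)
  then show ?thesis
    unfolding coord_field_def
    by (rule smooth_on_compose2[OF open_U_UNIV, where g = "\<lambda>a y. frechet_derivative (psi_inv a) (at y) (axis k 1)"])
       (auto intro: smooth_on_psi smooth_on_fst_snd open_U_UNIV)
qed

lemma smooth_on_frame_comp: "smooth_on (U \<times> U) (\<lambda>p. frame_comp (fst p) j k (snd p))"
proof -
  have UU: "open (U \<times> U)" using open_U by (simp add: open_Times)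
  have "smooth_on (U \<times> U) (\<lambda>p. X j (snd p))"
    by (rule smooth_on_compose[OF UU smooth_X]) (auto intro: smooth_on_fst_snd UU)
  moreover have "smooth_on (U \<times> U) (\<lambda>p. psi (fst p) (snd p) $ k)"
    by (intro smooth_on_vec_nth UU smooth_on_subset[OF smooth_on_psi]) auto
  ultimately show ?thesis
    unfolding frame_comp_def vf_apply_def
    by (intro smooth_on_partial_derivative[where G = "\<lambda>a x. psi a x $ k"] UU)
qed

context
  fixes a assumes a: "a \<in> U"
begin

lemma smooth_psi: "smooth_on UNIV (psi a)"
  by (rule smooth_on_fix_param[OF smooth_on_psi a])

lemma smooth_psi_inv: "smooth_on UNIV (psi_inv a)"
  by (rule smooth_on_fix_param[OF psi_inv_facts(1) a])

lemma smooth_psi_nth: "smooth_on U (\<lambda>x. psi a x $ k)"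
  by (intro smooth_on_vec_nth open_U smooth_on_subset[OF smooth_psi]) auto

lemma smooth_coord_field: "smooth_on U (coord_field a k)"
  by (rule smooth_on_subset[OF smooth_on_fix_param[OF smooth_on_coord_field a]]) simp

lemma smooth_frame_comp: "smooth_on U (frame_comp a j k)"
  unfolding frame_comp_def by (intro smooth_on_vf_apply open_U smooth_X smooth_psi_nth)

lemma smooth_coord_comp: "smooth_on U (coord_comp a k j)"
  unfolding coord_comp_def
  by (intro smooth_on_vec_nth smooth_on_frame_coords smooth_coord_field open_U smooth_on_id) auto

lemma derivative_psi_inverse:
  "frechet_derivative (psi_inv a) (at (psi a x)) (frechet_derivative (psi a) (at x) v) = v"
  "frechet_derivative (psi a) (at x) (frechet_derivative (psi_inv a) (at (psi a x)) v) = v"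
proof -
  have d: "(psi a has_derivative frechet_derivative (psi a) (at x)) (at x)"
    "(psi_inv a has_derivative frechet_derivative (psi_inv a) (at (psi a x))) (at (psi a x))"
    using smooth_on_imp_has_derivative[OF smooth_psi] smooth_on_imp_has_derivative[OF smooth_psi_inv] by auto
  have "((\<lambda>x. x) has_derivative
      (\<lambda>v. frechet_derivative (psi_inv a) (at (psi a x)) (frechet_derivative (psi a) (at x) v))) (at x)"
    using has_derivative_compose[OF d] by (simp add: psi_inv_facts(2)[OF a])
  from has_derivative_unique[OF this has_derivative_ident]
  show "frechet_derivative (psi_inv a) (at (psi a x)) (frechet_derivative (psi a) (at x) v) = v"
    by (rule fun_cong)
  have "((\<lambda>y. y) has_derivative
      (\<lambda>v. frechet_derivative (psi a) (at x) (frechet_derivative (psi_inv a) (at (psi a x)) v))) (at (psi a x))"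
    using has_derivative_compose[OF d(2), of "psi a" "frechet_derivative (psi a) (at x)"] d(1)
    by (simp add: psi_inv_facts(2,3)[OF a])
  from has_derivative_unique[OF this has_derivative_ident]
  show "frechet_derivative (psi a) (at x) (frechet_derivative (psi_inv a) (at (psi a x)) v) = v"
    by (rule fun_cong)
qed

lemma frame_comp_eq: "frame_comp a j k x = frechet_derivative (psi a) (at x) (X j x) $ k"
  by (simp add: frame_comp_def vf_apply_def frechet_derivative_nth[OF smooth_psi UNIV_I])

lemma linear_derivative_psi_inv: "linear (frechet_derivative (psi_inv a) (at y))"
  by (rule smooth_on_imp_linear[OF smooth_psi_inv UNIV_I])

lemma derivative_psi_inv_eq:
  "frechet_derivative (psi_inv a) (at (psi a x)) v = (\<Sum>k\<in>UNIV. v $ k *\<^sub>R coord_field a k x)"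
proof -
  have "v = (\<Sum>k\<in>UNIV. v $ k *\<^sub>R axis k 1)"
    using basis_expansion[of v] by (simp add: scalar_mult_eq_scaleR)
  then have "frechet_derivative (psi_inv a) (at (psi a x)) v =
      frechet_derivative (psi_inv a) (at (psi a x)) (\<Sum>k\<in>UNIV. v $ k *\<^sub>R axis k 1)" by simp
  also have "\<dots> = (\<Sum>k\<in>UNIV. v $ k *\<^sub>R coord_field a k x)"
    by (simp add: linear_sum[OF linear_derivative_psi_inv] linear_scale[OF linear_derivative_psi_inv] coord_field_def)
  finally show ?thesis .
qed

lemma frame_eq_coord_fields: "X j x = (\<Sum>k\<in>UNIV. frame_comp a j k x *\<^sub>R coord_field a k x)"
  using derivative_psi_inverse(1)[of x "X j x"] by (simp add: derivative_psi_inv_eq frame_comp_eq)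

lemma coord_field_eq_frame: "x \<in> U \<Longrightarrow> coord_field a k x = (\<Sum>j\<in>UNIV. coord_comp a k j x *\<^sub>R X j x)"
  unfolding coord_comp_def by (rule frame_coords_sum[symmetric])

text \<open>Both products are used: \<open>c b = 1\<close> is differentiated along the frame, and
  \<open>b c = 1\<close> then isolates the derivative of \<open>c\<close>.\<close>

lemma comp_inverse:
  assumes "x \<in> U"
  shows "(\<Sum>j\<in>UNIV. coord_comp a k j x * frame_comp a j l x) = axis k 1 $ l"
    and "(\<Sum>l\<in>UNIV. frame_comp a j l x * coord_comp a l q x) = axis j 1 $ q"
proof -
  let ?D = "frechet_derivative (psi a) (at x)"
  have lin: "linear ?D" by (rule smooth_on_imp_linear[OF smooth_psi UNIV_I])
  have "axis k 1 = ?D (coord_field a k x)"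
    unfolding coord_field_def by (rule derivative_psi_inverse(2)[symmetric])
  also have "\<dots> = (\<Sum>j\<in>UNIV. coord_comp a k j x *\<^sub>R ?D (X j x))"
    by (subst coord_field_eq_frame[OF assms]) (simp add: linear_sum[OF lin] linear_scale[OF lin])
  finally show "(\<Sum>j\<in>UNIV. coord_comp a k j x * frame_comp a j l x) = axis k 1 $ l"
    by (simp add: frame_comp_eq)
  define y where "y = (\<chi> q. \<Sum>l\<in>UNIV. frame_comp a j l x * coord_comp a l q x)"
  have "X j x = (\<Sum>l\<in>UNIV. frame_comp a j l x *\<^sub>R (\<Sum>q\<in>UNIV. coord_comp a l q x *\<^sub>R X q x))"
    using frame_eq_coord_fields[of j x] coord_field_eq_frame[OF assms] by simp
  also have "\<dots> = (\<Sum>q\<in>UNIV. y $ q *\<^sub>R X q x)"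
    unfolding scaleR_sum_right scaleR_scaleR
    by (subst sum.swap) (simp add: y_def scaleR_sum_left)
  finally have "frame_coords X x (X j x) = y" by (intro frame_coords_unique[OF assms]) simp
  then have "y $ q = axis j 1 $ q" by (simp add: frame_coords_frame[OF assms])
  then show "(\<Sum>l\<in>UNIV. frame_comp a j l x * coord_comp a l q x) = axis j 1 $ q" by (simp add: y_def)
qed

lemma frame_comp_self: "frame_comp a j k a = axis j 1 $ k"
  unfolding frame_comp_def by (rule vf_apply_psi_self[OF a])

lemma coord_comp_self: "coord_comp a k j a = axis k 1 $ j"
proof -
  have "axis k 1 $ j = (\<Sum>l\<in>UNIV. frame_comp a k l a * coord_comp a l j a)"
    by (rule comp_inverse(2)[OF a, symmetric])
  also have "\<dots> = (\<Sum>l\<in>UNIV. if l = k then coord_comp a l j a else 0)"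
    by (intro sum.cong) (auto simp: frame_comp_self axis_def)
  finally show ?thesis by simp
qed

text \<open>A word applied to \<open>frame_comp a j k\<close> is the word extended by
  \<open>j\<close> applied to the \<open>k\<close>-th privileged coordinate, which vanishes as long
  as the total weight is below \<open>w k\<close>.\<close>

lemma vanishes_frame_comp: "vanishes w X a L (int (w k) - int (w j)) (frame_comp a j k)"
  unfolding vanishes_def
proof (intro allI impI)
  fix I assume "int (word_weight w I) < int (w k) - int (w j)"
  then have "vf_word X (I @ [j]) (\<lambda>x. psi a x $ k) a = 0"
    by (intro vf_word_psi_zero[OF a]) simp
  then show "vf_word X I (frame_comp a j k) a = 0"
    by (simp add: vf_word_append vf_word_Cons frame_comp_def)
qed

lemma vf_apply_coord_comp:
  assumes "x \<in> U"
  shows "vf_apply (X i) (coord_comp a k q) x =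
    - (\<Sum>l\<in>UNIV. \<Sum>j\<in>UNIV. coord_comp a k j x * vf_apply (X i) (frame_comp a j l) x * coord_comp a l q x)"
proof -
  let ?c = "coord_comp a" and ?b = "frame_comp a"
  let ?dc = "\<lambda>k j. vf_apply (X i) (coord_comp a k j) x" and ?db = "\<lambda>j l. vf_apply (X i) (frame_comp a j l) x"
  have 0: "(\<Sum>j\<in>UNIV. ?dc k j * ?b j l x) = - (\<Sum>j\<in>UNIV. ?c k j x * ?db j l)" for l
  proof -
    have "vf_apply (X i) (\<lambda>x. \<Sum>j\<in>UNIV. ?c k j x * ?b j l x) x = vf_apply (X i) (\<lambda>x. axis k 1 $ l) x"
      by (rule vf_apply_cong[OF open_U _ _ assms])
         (auto intro!: smooth_on_sum smooth_on_mult open_U smooth_coord_comp smooth_frame_comp simp: comp_inverse)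
    then have "0 = vf_apply (X i) (\<lambda>x. \<Sum>j\<in>UNIV. ?c k j x * ?b j l x) x" by simp
    also have "\<dots> = (\<Sum>j\<in>UNIV. vf_apply (X i) (\<lambda>x. ?c k j x * ?b j l x) x)"
      by (intro vf_apply_sum[OF _ assms] smooth_on_mult open_U smooth_coord_comp smooth_frame_comp)
    also have "\<dots> = (\<Sum>j\<in>UNIV. ?dc k j * ?b j l x + ?c k j x * ?db j l)"
      by (intro sum.cong refl vf_apply_mult[OF _ _ assms] smooth_coord_comp smooth_frame_comp)
    finally show ?thesis by (simp add: sum.distrib)
  qed
  have "?dc k q = (\<Sum>j\<in>UNIV. if j = q then ?dc k j else 0)" by simp
  also have "\<dots> = (\<Sum>j\<in>UNIV. ?dc k j * (axis j 1 $ q))"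
    by (intro sum.cong) (auto simp: axis_def)
  also have "\<dots> = (\<Sum>j\<in>UNIV. \<Sum>l\<in>UNIV. ?dc k j * ?b j l x * ?c l q x)"
    by (simp add: comp_inverse(2)[OF assms, symmetric] sum_distrib_left mult.assoc)
  also have "\<dots> = (\<Sum>l\<in>UNIV. (\<Sum>j\<in>UNIV. ?dc k j * ?b j l x) * ?c l q x)"
    by (subst sum.swap) (simp add: sum_distrib_right)
  also have "\<dots> = - (\<Sum>l\<in>UNIV. \<Sum>j\<in>UNIV. ?c k j x * ?db j l * ?c l q x)"
    by (simp only: 0 sum_distrib_right mult_minus_left sum_negf)
  finally show ?thesis .
qed

text \<open>Induction on the word length through \<open>X\<^sub>i c = - c (X\<^sub>i b) c\<close> for \<open>c = b\<^sup>-\<^sup>1\<close>.\<close>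

lemma vanishes_coord_comp: "vanishes w X a L (int (w q) - int (w k)) (coord_comp a k q)"
proof (induction L arbitrary: k q)
  case 0
  show ?case by (auto simp: vanishes_0 coord_comp_self axis_def)
next
  case (Suc L)
  have "vanishes w X a L (int (w q) - int (w k) - int (w i)) (vf_apply (X i) (coord_comp a k q))" for i
  proof -
    let ?N = "int (w q) - int (w k) - int (w i)"
    let ?g = "\<lambda>l j x. coord_comp a k j x * vf_apply (X i) (frame_comp a j l) x * coord_comp a l q x"
    have db: "smooth_on U (vf_apply (X i) (frame_comp a j l))" for j l
      by (intro smooth_on_vf_apply open_U smooth_X smooth_frame_comp)
    have g: "smooth_on U (?g l j)" for l j
      by (intro smooth_on_mult open_U smooth_coord_comp db)
    have "vanishes w X a L (int (w l) - int (w j) - int (w i)) (vf_apply (X i) (frame_comp a j l))" for j l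
      using vanishes_frame_comp[of "Suc L" l j] unfolding vanishes_Suc by blast
    \<comment> \<open>The three orders telescope: \<open>w j\<close> and \<open>w l\<close> cancel,
      leaving the order of \<open>coord_comp a k q\<close> lowered by \<open>w i\<close>.\<close>
    then have "vanishes w X a L ((int (w j) - int (w k)) + (int (w l) - int (w j) - int (w i)) + (int (w q) - int (w l))) (?g l j)" for l j
      by (intro vanishes_mult[OF open_U smooth_X a] Suc smooth_on_mult open_U smooth_coord_comp db)
    then have "vanishes w X a L ?N (?g l j)" for l j by simp
    then have "vanishes w X a L ?N (\<lambda>x. \<Sum>l\<in>UNIV. \<Sum>j\<in>UNIV. ?g l j x)"
      by (intro vanishes_sum[OF open_U smooth_X a] smooth_on_sum open_U g)
    then have "vanishes w X a L ?N (\<lambda>x. (-1) * (\<Sum>l\<in>UNIV. \<Sum>j\<in>UNIV. ?g l j x))"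
      by (intro vanishes_cmult[OF open_U smooth_X a] smooth_on_sum open_U g)
    then show ?thesis
      by (rule vanishes_cong[OF open_U smooth_X a, rotated 2])
         (auto intro!: smooth_on_uminus smooth_on_sum open_U g simp: vf_apply_coord_comp)
  qed
  moreover have "0 < int (w q) - int (w k) \<longrightarrow> coord_comp a k q a = 0"
    by (auto simp: coord_comp_self axis_def)
  ultimately show ?case unfolding vanishes_Suc by blast
qed

text \<open>A coordinate field is a combination of the \<open>X j\<close> with coefficients of order
  \<open>w j - w i\<close>, and \<open>X j\<close> lowers the order by \<open>w j\<close>, so the
  total loss is \<open>w i\<close>. The hypothesis covers all \<open>L\<close> because each
  derivative consumes one unit of length.\<close>

lemma vanishes_vf_word_coord_field:
  assumes f: "smooth_on U f" and "\<And>L. vanishes w X a L N f"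
  shows "vanishes w X a L (N - int (word_weight w I)) (vf_word (coord_field a) I f)"
proof (induction I arbitrary: L)
  case Nil
  then show ?case using assms(2) by simp
next
  case (Cons i I)
  let ?f = "vf_word (coord_field a) I f"
  let ?M = "N - int (word_weight w I)"
  have f': "smooth_on U ?f" by (intro smooth_on_vf_word open_U smooth_coord_field f)
  have Xf: "smooth_on U (vf_apply (X j) ?f)" for j by (intro smooth_on_vf_apply open_U smooth_X f')
  have "vanishes w X a L (?M - int (w j)) (vf_apply (X j) ?f)" for j
    using Cons[of "Suc L"] unfolding vanishes_Suc by blast
  then have "vanishes w X a L ((int (w j) - int (w i)) + (?M - int (w j))) (\<lambda>x. coord_comp a i j x * vf_apply (X j) ?f x)" for j
    by (intro vanishes_mult[OF open_U smooth_X a] vanishes_coord_comp smooth_coord_comp Xf)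
  then have "vanishes w X a L (?M - int (w i)) (\<lambda>x. coord_comp a i j x * vf_apply (X j) ?f x)" for j
    by simp
  then have "vanishes w X a L (?M - int (w i)) (\<lambda>x. \<Sum>j\<in>UNIV. coord_comp a i j x * vf_apply (X j) ?f x)"
    by (intro vanishes_sum[OF open_U smooth_X a] smooth_on_mult open_U smooth_coord_comp Xf)
  then have "vanishes w X a L (?M - int (w i)) (vf_apply (coord_field a i) ?f)"
  proof (rule vanishes_cong[OF open_U smooth_X a, rotated 2])
    show "smooth_on U (\<lambda>x. \<Sum>j\<in>UNIV. coord_comp a i j x * vf_apply (X j) ?f x)"
      by (intro smooth_on_sum smooth_on_mult open_U smooth_coord_comp Xf)
    show "(\<Sum>j\<in>UNIV. coord_comp a i j x * vf_apply (X j) ?f x) = vf_apply (coord_field a i) ?f x"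
      if "x \<in> U" for x
      by (rule vf_apply_linear_combination[OF f' that, symmetric]) (rule coord_field_eq_frame[OF that])
  qed
  then show ?case by (simp add: vf_word_Cons algebra_simps)
qed

text \<open>In other words, Taylor coefficients of the frame components in privileged coordinates
  vanish below weight \<open>w k - w j\<close>, which is what makes the dilated components
  converge.\<close>

lemma vf_word_coord_field_frame_comp:
  assumes "word_weight w I + w j < w k"
  shows "vf_word (coord_field a) I (frame_comp a j k) a = 0"
  using vanishes_vf_word_coord_field[OF smooth_frame_comp vanishes_frame_comp, where I = I and L = 0] assms
  by (simp add: vanishes_0)

text \<open>Carried to the coordinates \<open>z\<close>, the coordinate fields become partial
  derivatives, so words in them form a family closed under differentiation, as the Taylor expansion
  requires.\<close>

lemma vf_word_coord_field_has_derivative: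
  assumes f: "smooth_on U f" and "psi_inv a z \<in> U"
  shows "((\<lambda>z. vf_word (coord_field a) I f (psi_inv a z)) has_derivative
    (\<lambda>v. \<Sum>i\<in>UNIV. v $ i * vf_word (coord_field a) (i # I) f (psi_inv a z))) (at z)"
proof -
  let ?g = "vf_word (coord_field a) I f" and ?x = "psi_inv a z"
  let ?D = "frechet_derivative ?g (at ?x)"
  have g: "smooth_on U ?g" by (intro smooth_on_vf_word open_U smooth_coord_field f)
  have lin: "linear ?D" by (rule smooth_on_imp_linear[OF g assms(2)])
  have "(psi_inv a has_derivative frechet_derivative (psi_inv a) (at z)) (at z)"
    by (rule smooth_on_imp_has_derivative[OF smooth_psi_inv UNIV_I])
  moreover have "frechet_derivative (psi_inv a) (at z) = (\<lambda>v. \<Sum>i\<in>UNIV. v $ i *\<^sub>R coord_field a i ?x)"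
    using derivative_psi_inv_eq[of ?x] by (simp add: psi_inv_facts(3)[OF a] fun_eq_iff)
  ultimately have "(psi_inv a has_derivative (\<lambda>v. \<Sum>i\<in>UNIV. v $ i *\<^sub>R coord_field a i ?x)) (at z)"
    by simp
  then have "((\<lambda>z. ?g (psi_inv a z)) has_derivative (\<lambda>v. ?D (\<Sum>i\<in>UNIV. v $ i *\<^sub>R coord_field a i ?x))) (at z)"
    by (rule has_derivative_compose) (rule smooth_on_imp_has_derivative[OF g assms(2)])
  then show ?thesis
    by (simp add: linear_sum[OF lin] linear_scale[OF lin] vf_word_Cons vf_apply_def)
qed

end

end

section \<open>Weighted Taylor expansion\<close>

text \<open>Words replace multi-indices: iterated derivatives are already indexed by words, and
  summing over all words of length \<open>k\<close> absorbs the multinomial coefficients into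
  \<open>1 / fact k\<close>.\<close>

definition word_monomial :: "real^'n \<Rightarrow> 'n::finite list \<Rightarrow> real" where
  "word_monomial y I = prod_list (map (\<lambda>i. y $ i) I)"

lemma word_monomial_simps [simp]:
  "word_monomial y [] = 1" "word_monomial y (i # I) = y $ i * word_monomial y I"
  by (simp_all add: word_monomial_def)

lemma word_monomial_dilation: "word_monomial (dilation w t y) I = t ^ word_weight w I * word_monomial y I"
  by (induction I) (simp_all add: dilation_def power_add)

lemma finite_words_length [simp]: "finite {I :: 'n::finite list. length I = k}"
  using finite_lists_length_eq[of "UNIV :: 'n set" k] by simp

lemma sum_words_Suc:
  fixes h :: "'n::finite list \<Rightarrow> 'b::comm_monoid_add"
  shows "(\<Sum>I | length I = Suc k. h I) = (\<Sum>I | length I = k. \<Sum>i\<in>UNIV. h (i # I))"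
proof -
  have "{I :: 'n list. length I = Suc k} = (\<lambda>(I, i). i # I) ` ({I. length I = k} \<times> UNIV)"
    by (auto simp: length_Suc_conv image_iff)
  then have "(\<Sum>I | length I = Suc k. h I) = (\<Sum>(I, i)\<in>{I. length I = k} \<times> UNIV. h (i # I))"
    by (simp add: sum.reindex inj_on_def case_prod_unfold)
  then show ?thesis by (simp add: sum.cartesian_product)
qed

text \<open>\<open>D I\<close> stands for the iterated partial derivative of \<open>D []\<close>
  along \<open>I\<close>; Maclaurin's formula is applied on the ray from 0 to
  \<open>z\<close>.\<close>

lemma taylor_words:
  fixes D :: "'n::finite list \<Rightarrow> real^'n \<Rightarrow> real"
  assumes D: "\<And>I z. z \<in> W \<Longrightarrow> (D I has_derivative (\<lambda>v. \<Sum>i\<in>UNIV. v $ i * D (i # I) z)) (at z)"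
    and z: "\<And>s. 0 \<le> s \<Longrightarrow> s \<le> 1 \<Longrightarrow> s *\<^sub>R z \<in> W" and "0 < m"
  shows "\<exists>\<xi>. 0 < \<xi> \<and> \<xi> < 1 \<and> D [] z =
    (\<Sum>k<m. (\<Sum>I | length I = k. word_monomial z I * D I 0) / fact k) +
    (\<Sum>I | length I = m. word_monomial z I * D I (\<xi> *\<^sub>R z)) / fact m"
proof -
  define diff where "diff k s = (\<Sum>I | length I = k. word_monomial z I * D I (s *\<^sub>R z))" for k s
  have "DERIV (diff k) s :> diff (Suc k) s" if "0 \<le> s" "s \<le> 1" for k s
  proof -
    have "((\<lambda>s. D I (0 + s *\<^sub>R z)) has_real_derivative (\<Sum>i\<in>UNIV. z $ i * D (i # I) (s *\<^sub>R z))) (at s)" for I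
      using line_has_derivative[of "D I" _ 0 s z] D[OF z[OF that], of I] by simp
    then have "DERIV (diff k) s :> (\<Sum>I | length I = k. word_monomial z I * (\<Sum>i\<in>UNIV. z $ i * D (i # I) (s *\<^sub>R z)))"
      unfolding diff_def by (intro DERIV_sum DERIV_cmult) simp
    also have "(\<Sum>I | length I = k. word_monomial z I * (\<Sum>i\<in>UNIV. z $ i * D (i # I) (s *\<^sub>R z))) = diff (Suc k) s"
      unfolding diff_def sum_words_Suc by (simp add: sum_distrib_left mult_ac)
    finally show ?thesis .
  qed
  then have "\<exists>\<xi>>0. \<xi> < 1 \<and> D [] z = (\<Sum>k<m. diff k 0 / fact k * 1 ^ k) + diff m \<xi> / fact m * 1 ^ m"
    using Maclaurin[of 1 m diff "\<lambda>s. D [] (s *\<^sub>R z)"] \<open>0 < m\<close> by (auto simp: diff_def fun_eq_iff)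
  then show ?thesis by (auto simp: diff_def)
qed

lemma tendsto_power_ratio:
  assumes "m \<le> n"
  shows "((\<lambda>t::real. t ^ n / t ^ m) \<longlongrightarrow> (if n = m then 1 else 0)) (at 0)"
proof -
  have "((\<lambda>t::real. t ^ (n - m)) \<longlongrightarrow> 0 ^ (n - m)) (at 0)" by (intro tendsto_intros)
  also have "(0::real) ^ (n - m) = (if n = m then 1 else 0)" using assms by (simp add: power_0_left)
  finally show ?thesis
  proof (rule Lim_transform_eventually)
    show "\<forall>\<^sub>F t::real in at 0. t ^ (n - m) = t ^ n / t ^ m"
      using eventually_neq_at_within[of "0::real" 0 UNIV] by eventually_elim (simp add: power_diff assms)
  qed
qed

lemma tendsto_dilation:
  assumes "\<And>j. 0 < w j"
  shows "((\<lambda>t. dilation w t y) \<longlongrightarrow> 0) (at 0)"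
proof (rule vec_tendstoI)
  fix j
  have "((\<lambda>t::real. t ^ w j * y $ j) \<longlongrightarrow> 0 ^ w j * y $ j) (at 0)" by (intro tendsto_intros)
  then show "((\<lambda>t. dilation w t y $ j) \<longlongrightarrow> 0 $ j) (at 0)"
    using assms[of j] by (simp add: dilation_def power_0_left)
qed

lemma length_le_word_weight:
  assumes "\<And>j. 0 < w j"
  shows "length I \<le> word_weight w I"
proof (induction I)
  case (Cons i I)
  then show ?case using assms[of i] by simp
qed simp

text \<open>After division by \<open>t ^ m\<close>, the term of a word carries \<open>t\<close> to
  the power of its weight minus \<open>m\<close>: lighter words vanish by \<open>zero\<close>,
  heavier ones tend to 0, those of weight \<open>m\<close> remain.\<close>

lemma weighted_taylor_limit:
  fixes D :: "'n::finite list \<Rightarrow> real^'n \<Rightarrow> real"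
  assumes w: "\<And>j. 0 < w j" and W: "open W" "0 \<in> W"
    and D: "\<And>I z. z \<in> W \<Longrightarrow> (D I has_derivative (\<lambda>v. \<Sum>i\<in>UNIV. v $ i * D (i # I) z)) (at z)"
    and zero: "\<And>I. word_weight w I < m \<Longrightarrow> D I 0 = 0"
  shows "((\<lambda>t. D [] (dilation w t y) / t ^ m) \<longlongrightarrow>
    (\<Sum>I | word_weight w I = m. D I 0 / fact (length I) * word_monomial y I)) (at 0)"
proof -
  define z where "z t = dilation w t y" for t
  \<comment> \<open>Since weights are positive, length is at most weight: \<open>S\<close> contains
    all words of weight \<open>m\<close>, and the words of length \<open>Suc m\<close> in the
    remainder are heavier than \<open>m\<close>.\<close>
  define S where "S = {I :: 'n list. length I \<le> m}"
  have finS: "finite S" unfolding S_def using finite_lists_length_le[of "UNIV :: 'n set" m] by simp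
  obtain e where e: "e > 0" "ball 0 e \<subseteq> W" using W open_contains_ball by blast
  have z0: "(z \<longlongrightarrow> 0) (at 0)" unfolding z_def by (rule tendsto_dilation[OF w])
  have near: "\<forall>\<^sub>F t in at 0. norm (z t) < e"
    using tendstoD[OF z0 e(1)] by simp
  define T where "T t \<xi> \<longleftrightarrow> 0 < \<xi> \<and> \<xi> < 1 \<and> D [] (z t) =
    (\<Sum>k<Suc m. (\<Sum>I | length I = k. word_monomial (z t) I * D I 0) / fact k) +
    (\<Sum>I | length I = Suc m. word_monomial (z t) I * D I (\<xi> *\<^sub>R z t)) / fact (Suc m)" for t and \<xi> :: real
  have "\<exists>\<xi>. T t \<xi>" if "norm (z t) < e" for t
    unfolding T_def
  proof (rule taylor_words[OF D])
    fix s :: real assume "0 \<le> s" "s \<le> 1"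
    then have "s * norm (z t) \<le> 1 * norm (z t)" by (intro mult_right_mono) auto
    then have "s *\<^sub>R z t \<in> ball 0 e" using that \<open>0 \<le> s\<close> by simp
    then show "s *\<^sub>R z t \<in> W" using e by blast
  qed simp_all
  \<comment> \<open>How the intermediate value depends on \<open>t\<close> is unknown, but being
    between 0 and 1 it keeps \<open>\<xi> t *\<^sub>R z t\<close> tending to 0.\<close>
  then obtain \<xi> where "\<And>t. norm (z t) < e \<Longrightarrow> T t (\<xi> t)"
    by metis
  note \<xi> = this[unfolded T_def]
  define G where "G t I = t ^ word_weight w I / t ^ m * (D I 0 / fact (length I) * word_monomial y I)" for t I
  define R where "R t I = t ^ word_weight w I / t ^ m * (D I (\<xi> t *\<^sub>R z t) * (word_monomial y I / fact (Suc m)))" for t I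
  have expansion: "(\<Sum>I\<in>S. G t I) + (\<Sum>I | length I = Suc m. R t I) = D [] (z t) / t ^ m"
    if "norm (z t) < e" for t
  proof -
    have "(\<Sum>I\<in>S. G t I) = (\<Sum>k<Suc m. \<Sum>I | I \<in> S \<and> length I = k. G t I)"
      by (rule sum.group[symmetric]) (auto simp: S_def finS[unfolded S_def])
    also have "\<dots> = (\<Sum>k<Suc m. (\<Sum>I | length I = k. word_monomial (z t) I * D I 0) / fact k / t ^ m)"
    proof (rule sum.cong[OF refl])
      fix k assume "k \<in> {..<Suc m}"
      then have *: "{I \<in> S. length I = k} = {I. length I = k}" by (auto simp: S_def)
      show "(\<Sum>I | I \<in> S \<and> length I = k. G t I) =
          (\<Sum>I | length I = k. word_monomial (z t) I * D I 0) / fact k / t ^ m"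
        unfolding * sum_divide_distrib
        by (intro sum.cong refl) (auto simp: G_def z_def word_monomial_dilation mult_ac)
    qed
    finally have 1: "(\<Sum>I\<in>S. G t I) = (\<Sum>k<Suc m. (\<Sum>I | length I = k. word_monomial (z t) I * D I 0) / fact k) / t ^ m"
      by (simp only: sum_divide_distrib)
    have 2: "(\<Sum>I | length I = Suc m. R t I) =
        (\<Sum>I | length I = Suc m. word_monomial (z t) I * D I (\<xi> t *\<^sub>R z t)) / fact (Suc m) / t ^ m"
      unfolding sum_divide_distrib
      by (intro sum.cong refl) (simp add: R_def z_def word_monomial_dilation mult_ac)
    show ?thesis unfolding 1 2 using \<xi>[OF that] by (simp only: add_divide_distrib)
  qed
  have "((\<lambda>t. G t I) \<longlongrightarrow> (if word_weight w I = m then D I 0 / fact (length I) * word_monomial y I else 0)) (at 0)" for I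
  proof (cases "word_weight w I < m")
    case True
    then show ?thesis using zero[OF True] by (simp add: G_def)
  next
    case False
    then have "((\<lambda>t. G t I) \<longlongrightarrow> (if word_weight w I = m then 1 else 0) * (D I 0 / fact (length I) * word_monomial y I)) (at 0)"
      unfolding G_def by (intro tendsto_mult_right tendsto_power_ratio) simp
    then show ?thesis by (simp split: if_splits)
  qed
  then have G: "((\<lambda>t. \<Sum>I\<in>S. G t I) \<longlongrightarrow>
      (\<Sum>I\<in>S. if word_weight w I = m then D I 0 / fact (length I) * word_monomial y I else 0)) (at 0)"
    by (intro tendsto_sum)
  have "((\<lambda>t. \<xi> t *\<^sub>R z t) \<longlongrightarrow> 0) (at 0)"
  proof (rule Lim_null_comparison)
    show "((\<lambda>t. norm (z t)) \<longlongrightarrow> 0) (at 0)" using tendsto_norm_zero[OF z0] .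
    show "\<forall>\<^sub>F t in at 0. norm (\<xi> t *\<^sub>R z t) \<le> norm (z t)"
      using near
    proof eventually_elim
      case (elim t)
      then have "\<bar>\<xi> t\<bar> * norm (z t) \<le> 1 * norm (z t)" using \<xi>[OF elim] by (intro mult_right_mono) auto
      then show ?case by simp
    qed
  qed
  then have "((\<lambda>t. D I (\<xi> t *\<^sub>R z t)) \<longlongrightarrow> D I 0) (at 0)" for I
    using D[OF W(2), of I] has_derivative_continuous isCont_tendsto_compose by blast
  then have "((\<lambda>t. R t I) \<longlongrightarrow> 0 * (D I 0 * (word_monomial y I / fact (Suc m)))) (at 0)" if "length I = Suc m" for I
    unfolding R_def
    using tendsto_power_ratio[of m "word_weight w I"] length_le_word_weight[of w I, OF w] that
    by (intro tendsto_mult tendsto_const) auto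
  then have R: "((\<lambda>t. \<Sum>I | length I = Suc m. R t I) \<longlongrightarrow> 0) (at 0)"
    using tendsto_sum[of "{I. length I = Suc m}" "\<lambda>I t. R t I" "\<lambda>_. 0" "at 0"] by simp
  have "(\<Sum>I\<in>S. if word_weight w I = m then D I 0 / fact (length I) * word_monomial y I else 0) =
      (\<Sum>I | I \<in> S \<and> word_weight w I = m. D I 0 / fact (length I) * word_monomial y I)"
    by (rule sum.inter_filter[OF finS, symmetric])
  also have "{I. I \<in> S \<and> word_weight w I = m} = {I. word_weight w I = m}"
    using length_le_word_weight[of w, OF w] by (auto simp: S_def)
  finally have "((\<lambda>t. (\<Sum>I\<in>S. G t I) + (\<Sum>I | length I = Suc m. R t I)) \<longlongrightarrow>
      (\<Sum>I | word_weight w I = m. D I 0 / fact (length I) * word_monomial y I)) (at 0)"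
    using tendsto_add[OF G R] by simp
  then have "((\<lambda>t. D [] (z t) / t ^ m) \<longlongrightarrow>
      (\<Sum>I | word_weight w I = m. D I 0 / fact (length I) * word_monomial y I)) (at 0)"
    by (rule Lim_transform_eventually) (use near expansion in \<open>auto elim: eventually_mono\<close>)
  then show ?thesis by (simp add: z_def)
qed

section \<open>Model vector fields and the exponential map\<close>

context weighted_frame
begin

definition model_coeff :: "(real, 'n) vec \<Rightarrow> 'n \<Rightarrow> 'n \<Rightarrow> 'n list \<Rightarrow> real" where
  "model_coeff a j k I = vf_word (coord_field a) I (frame_comp a j k) a / fact (length I)"

lemma smooth_on_model_coeff: "smooth_on U (\<lambda>a. model_coeff a j k I)"
proof -
  have UU: "open (U \<times> U)" using open_U by (simp add: open_Times)
  have "smooth_on (U \<times> U) (\<lambda>p. vf_word (coord_field (fst p)) I (frame_comp (fst p) j k) (snd p))"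
    by (intro smooth_on_vf_word_param smooth_on_frame_comp UU smooth_on_subset[OF smooth_on_coord_field]) auto
  from smooth_on_compose[OF open_U this, of "\<lambda>a. (a, a)"]
  have "smooth_on U (\<lambda>a. vf_word (coord_field a) I (frame_comp a j k) a)"
    by (simp add: image_subset_iff smooth_on_Pair smooth_on_id open_U)
  then show ?thesis
    unfolding model_coeff_def by (intro smooth_on_divide smooth_on_const open_U) simp_all
qed

text \<open>The part of weighted degree \<open>w k - w j\<close> of component \<open>k\<close> of
  \<open>X j\<close> in privileged coordinates. As subtraction is truncated, this reading is
  confined to \<open>w j \<le> w k\<close>, the case in which \<open>model_vf_nth\<close> refers to
  it.\<close>

definition model_poly :: "(real, 'n) vec \<Rightarrow> 'n \<Rightarrow> 'n \<Rightarrow> (real, 'n) vec \<Rightarrow> real" where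
  "model_poly a j k y = (\<Sum>I | word_weight w I = w k - w j. model_coeff a j k I * word_monomial y I)"

lemma model_poly_same_weight:
  assumes "a \<in> U" "w j = w k"
  shows "model_poly a j k y = axis j 1 $ k"
proof -
  have "I = []" if "word_weight w I = 0" for I
    using length_le_word_weight[of w I, OF weight_pos] that by simp
  then have "{I. word_weight w I = 0} = {[]}" by auto
  then show ?thesis
    using assms by (simp add: model_poly_def model_coeff_def frame_comp_self)
qed

text \<open>Component \<open>k\<close> is scaled by \<open>t ^ w j / t ^ w k\<close>. For
  \<open>w j \<le> w k\<close> this is a division compensated by the order of vanishing; for
  \<open>w k < w j\<close> it tends to 0 against a factor continuous at 0.\<close>

lemma model_vf_nth:
  assumes a: "a \<in> U"
  shows "model_vf U w X a j y $ k = (if w j \<le> w k then model_poly a j k y else 0)"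
proof -
  define W where "W = psi_inv a -` U"
  define D where "D k I z = vf_word (coord_field a) I (frame_comp a j k) (psi_inv a z)" for k I z
  have psi_map: "psi_map U w X a = psi a" using psi_map_eq[OF a] by (auto simp: psi_def)
  have inj: "inj_on (psi a) U" by (metis inj_onI psi_inv_facts(2)[OF a])
  have inv0: "psi_inv a 0 = a" using psi_inv_facts(2)[OF a, of a] psi_self[OF a] by simp
  have W: "open W" "0 \<in> W"
    unfolding W_def using smooth_on_imp_continuous_on[OF smooth_psi_inv[OF a]] open_U a
    by (auto simp: open_vimage inv0)
  have in_coords: "in_coords U (psi a) (X j) z $ k = D k [] z" if "z \<in> W" for z k
    using in_coords_apply[OF inj, of "psi_inv a z" "X j"] that
    by (simp add: W_def psi_inv_facts(3)[OF a] D_def frame_comp_eq[OF a])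
  have D: "(D k I has_derivative (\<lambda>v. \<Sum>i\<in>UNIV. v $ i * D k (i # I) z)) (at z)" if "z \<in> W" for k I z
    unfolding D_def
    using vf_word_coord_field_has_derivative[OF a smooth_frame_comp[OF a]] that by (simp add: W_def)
  have W': "\<forall>\<^sub>F t in at 0. dilation w t y \<in> W"
    using topological_tendstoD[OF tendsto_dilation[of w y, OF weight_pos] W] .
  have nz: "\<forall>\<^sub>F t::real in at 0. t \<noteq> 0" by (rule eventually_neq_at_within)
  have "((\<lambda>t. t ^ w j * (inverse (t ^ w k) * in_coords U (psi a) (X j) (dilation w t y) $ k)) \<longlongrightarrow>
      (if w j \<le> w k then model_poly a j k y else 0)) (at 0)" for k
  proof (cases "w j \<le> w k")
    case True
    have "((\<lambda>t. D k [] (dilation w t y) / t ^ (w k - w j)) \<longlongrightarrow>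
        (\<Sum>I | word_weight w I = w k - w j. D k I 0 / fact (length I) * word_monomial y I)) (at 0)"
      using vf_word_coord_field_frame_comp[OF a, of _ j k]
      by (intro weighted_taylor_limit[OF weight_pos W D]) (auto simp: D_def inv0)
    also have "(\<Sum>I | word_weight w I = w k - w j. D k I 0 / fact (length I) * word_monomial y I) = model_poly a j k y"
      by (simp add: model_poly_def model_coeff_def D_def inv0)
    finally have "((\<lambda>t. D k [] (dilation w t y) / t ^ (w k - w j)) \<longlongrightarrow> (if w j \<le> w k then model_poly a j k y else 0)) (at 0)"
      using True by simp
    then show ?thesis
    proof (rule Lim_transform_eventually)
      show "\<forall>\<^sub>F t in at 0. D k [] (dilation w t y) / t ^ (w k - w j) =
          t ^ w j * (inverse (t ^ w k) * in_coords U (psi a) (X j) (dilation w t y) $ k)"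
        using W' nz by eventually_elim (simp add: in_coords True power_diff field_simps)
    qed
  next
    case False
    have "isCont (D k []) 0" using D[OF W(2)] has_derivative_continuous by blast
    then have "((\<lambda>t. D k [] (dilation w t y)) \<longlongrightarrow> D k [] 0) (at 0)"
      by (rule isCont_tendsto_compose) (rule tendsto_dilation[OF weight_pos])
    then have "((\<lambda>t. t ^ w j / t ^ w k * D k [] (dilation w t y)) \<longlongrightarrow> 0 * D k [] 0) (at 0)"
      using tendsto_power_ratio[of "w k" "w j"] False by (intro tendsto_mult) (auto simp: nat_neq_iff)
    then have "((\<lambda>t. t ^ w j / t ^ w k * D k [] (dilation w t y)) \<longlongrightarrow> (if w j \<le> w k then model_poly a j k y else 0)) (at 0)"
      using False by simp
    then show ?thesis
    proof (rule Lim_transform_eventually)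
      show "\<forall>\<^sub>F t in at 0. t ^ w j / t ^ w k * D k [] (dilation w t y) =
          t ^ w j * (inverse (t ^ w k) * in_coords U (psi a) (X j) (dilation w t y) $ k)"
        using W' by eventually_elim (simp add: in_coords divide_inverse)
    qed
  qed
  then have "((\<lambda>t. t ^ w j *\<^sub>R dilation_pullback w t (in_coords U (psi a) (X j)) y) \<longlongrightarrow>
      (\<chi> k. if w j \<le> w k then model_poly a j k y else 0)) (at 0)"
    by (intro vec_tendstoI) (simp add: dilation_pullback_def)
  then have "model_vf U w X a j y = (\<chi> k. if w j \<le> w k then model_poly a j k y else 0)"
    unfolding model_vf_def psi_map by (rule tendsto_Lim[OF at_neq_bot])
  then show ?thesis by simp
qed

text \<open>The field generating the exponential without its constant part \<open>x\<close>: in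
  component \<open>k\<close>, model fields of weight \<open>w k\<close> contribute just
  \<open>x $ k\<close> by \<open>model_poly_same_weight\<close>, and heavier ones contribute
  nothing.\<close>

definition exp_tail :: "(real, 'n) vec \<Rightarrow> (real, 'n) vec \<Rightarrow> (real, 'n) vec \<Rightarrow> (real, 'n) vec" where
  "exp_tail a x y = (\<chi> k. \<Sum>j | w j < w k. x $ j * model_poly a j k y)"

lemma sum_model_vf:
  assumes a: "a \<in> U"
  shows "(\<Sum>j\<in>UNIV. x $ j *\<^sub>R model_vf U w X a j y) = x + exp_tail a x y"
  unfolding vec_eq_iff
proof
  fix k
  have "(\<Sum>j\<in>UNIV. x $ j *\<^sub>R model_vf U w X a j y) $ k =
      (\<Sum>j\<in>UNIV. (if j = k then x $ j else 0) + (if w j < w k then x $ j * model_poly a j k y else 0))"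
    unfolding sum_component vector_scaleR_component model_vf_nth[OF a]
  proof (rule sum.cong[OF refl])
    fix j
    consider "w j < w k" | "w j = w k" | "w k < w j" by linarith
    then show "x $ j *\<^sub>R (if w j \<le> w k then model_poly a j k y else 0) =
        (if j = k then x $ j else 0) + (if w j < w k then x $ j * model_poly a j k y else 0)"
      by cases (auto simp: model_poly_same_weight[OF a] axis_def)
  qed
  also have "\<dots> = (x + exp_tail a x y) $ k"
    by (simp add: sum.distrib exp_tail_def sum.If_cases Int_def)
  finally show "(\<Sum>j\<in>UNIV. x $ j *\<^sub>R model_vf U w X a j y) $ k = (x + exp_tail a x y) $ k" .
qed

lemma word_monomial_agree:
  assumes "agree_below w m y y'" "word_weight w I < m"
  shows "word_monomial y I = word_monomial y' I"
  using assms(2)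
proof (induction I)
  case (Cons i I)
  then show ?case using assms(1) by (simp add: agree_below_def)
qed simp

text \<open>As \<open>w j\<close> is positive, words of weight \<open>w k - w j\<close> contain only
  letters of weight below \<open>w k\<close>; the range of summation restricts \<open>x\<close> in
  the same way.\<close>

lemma exp_tail_agree:
  assumes "agree_below w (w k) x x'" "agree_below w (w k) y y'"
  shows "exp_tail a x y $ k = exp_tail a x' y' $ k"
proof -
  have "model_poly a j k y = model_poly a j k y'" if "w j < w k" for j
    unfolding model_poly_def
    using weight_pos[of j] that by (intro sum.cong refl arg_cong2[where f = "(*)"] word_monomial_agree[OF assms(2)]) simp
  then show ?thesis
    using assms(1) by (simp add: exp_tail_def agree_below_def)
qed

lemma tpoly_exp_tail:
  assumes "\<And>i. tpoly (U \<times> UNIV) (\<lambda>p t. \<gamma> p t $ i)"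
  shows "tpoly (U \<times> UNIV) (\<lambda>p t. exp_tail (fst p) (snd p) (\<gamma> p t) $ k)"
proof -
  have mon: "tpoly (U \<times> UNIV) (\<lambda>p t. word_monomial (\<gamma> p t) I)" for I
  proof (induction I)
    case Nil
    show ?case using tpoly.coeff[OF smooth_on_const[OF open_U_UNIV], of 1] by simp
  next
    case (Cons i I)
    then show ?case using tpoly_mult[OF open_U_UNIV assms Cons] by simp
  qed
  have "smooth_on (U \<times> UNIV) (\<lambda>p. model_coeff (fst p) j k I)" for j I
    by (rule smooth_on_compose[OF open_U_UNIV smooth_on_model_coeff]) (auto intro: smooth_on_fst_snd open_U_UNIV)
  then have "tpoly (U \<times> UNIV) (\<lambda>p t. model_poly (fst p) j k (\<gamma> p t))" for j
    unfolding model_poly_def by (intro tpoly_sum tpoly_mult tpoly.coeff mon open_U_UNIV)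
  moreover have "tpoly (U \<times> UNIV) (\<lambda>p t. snd p $ j)" for j
    by (intro tpoly.coeff smooth_on_vec_nth smooth_on_fst_snd open_U_UNIV)
  ultimately show ?thesis
    by (simp add: exp_tail_def) (intro tpoly_sum tpoly_mult open_U_UNIV)
qed

theorem smooth_on_eps_carnot:
  "smooth_on (U \<times> UNIV) (\<lambda>(x, y). eps_carnot U w X x y)"
  "smooth_on (U \<times> UNIV) (\<lambda>(x, y). inv (eps_carnot U w X x) y)"
proof -
  obtain E E' where E: "smooth_on (U \<times> UNIV) (\<lambda>p. E (fst p) (snd p))"
    "smooth_on (U \<times> UNIV) (\<lambda>p. E' (fst p) (snd p))"
    "\<And>a x. a \<in> U \<Longrightarrow> time_one_flow (\<lambda>y. x + exp_tail a x y) 0 = E a x"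
    "\<And>a x. a \<in> U \<Longrightarrow> E' a (E a x) = x" "\<And>a x. a \<in> U \<Longrightarrow> E a (E' a x) = x"
    using triangular_exponential[OF open_U, of w exp_tail] exp_tail_agree tpoly_exp_tail by blast
  have eps: "eps_carnot U w X a = E' a \<circ> psi a" if a: "a \<in> U" for a
  proof -
    have "exp_map (model_vf U w X a) = E a"
      unfolding exp_map_def sum_model_vf[OF a] using E(3)[OF a] by auto
    moreover have "inv (E a) = E' a"
      using E(4,5)[OF a] by (intro inv_unique_comp) auto
    moreover have "psi_map U w X a = psi a" using psi_map_eq[OF a] by (auto simp: psi_def)
    ultimately show ?thesis by (simp add: eps_carnot_def)
  qed
  have inv_eps: "inv (eps_carnot U w X a) = psi_inv a \<circ> E a" if a: "a \<in> U" for a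
    unfolding eps[OF a] using E(4,5)[OF a] psi_inv_facts(2,3)[OF a] by (intro inv_unique_comp) auto
  have fst: "smooth_on (U \<times> UNIV) (fst :: (real, 'n) vec \<times> (real, 'n) vec \<Rightarrow> _)"
    by (rule smooth_on_fst_snd[OF open_U_UNIV])
  have "smooth_on (U \<times> UNIV) (\<lambda>p. E' (fst p) (psi (fst p) (snd p)))"
    by (rule smooth_on_compose2[OF open_U_UNIV E(2) fst smooth_on_psi]) auto
  then show "smooth_on (U \<times> UNIV) (\<lambda>(x, y). eps_carnot U w X x y)"
    by (rule smooth_on_cong[OF open_U_UNIV]) (auto simp: eps)
  have "smooth_on (U \<times> UNIV) (\<lambda>p. psi_inv (fst p) (E (fst p) (snd p)))"
    by (rule smooth_on_compose2[OF open_U_UNIV psi_inv_facts(1) fst E(1)]) auto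
  then show "smooth_on (U \<times> UNIV) (\<lambda>(x, y). inv (eps_carnot U w X x) y)"
    by (rule smooth_on_cong[OF open_U_UNIV]) (auto simp: inv_eps)
qed

end

section \<open>Frames of a Carnot manifold\<close>

text \<open>The position of \<open>l\<close> is strictly increasing in \<open>l\<close>, hence a
  bijection onto \<open>{1..CARD('n)}\<close>.\<close>

lemma card_initial_segments:
  assumes "d \<le> CARD('n::{finite,linorder})"
  shows "card {l :: 'n. card {i. i \<le> l} \<le> d} = d"
proof -
  let ?f = "\<lambda>l :: 'n. card {i. i \<le> l}"
  have "?f l < ?f l'" if "l < l'" for l l'
  proof (rule psubset_card_mono)
    have "l' \<in> {i. i \<le> l'}" "l' \<notin> {i. i \<le> l}" using that by auto
    moreover have "{i. i \<le> l} \<subseteq> {i. i \<le> l'}" using that by auto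
    ultimately show "{i. i \<le> l} \<subset> {i. i \<le> l'}" by blast
  qed simp
  then have inj: "inj ?f" by (intro linorder_injI less_imp_neq)
  have "?f l \<in> {1..CARD('n)}" for l
    using card_mono[of UNIV "{i. i \<le> l}"] card_gt_0_iff[of "{i. i \<le> l}"] by (auto simp: Suc_le_eq)
  then have range: "range ?f = {1..CARD('n)}"
    using card_image[OF inj] by (intro card_subset_eq) auto
  have "?f ` {l. ?f l \<le> d} = {1..d}"
  proof
    show "?f ` {l. ?f l \<le> d} \<subseteq> {1..d}" using range by auto
    show "{1..d} \<subseteq> ?f ` {l. ?f l \<le> d}"
    proof
      fix m assume "m \<in> {1..d}"
      then have "m \<in> range ?f" using range assms by auto
      then show "m \<in> ?f ` {l. ?f l \<le> d}" using \<open>m \<in> {1..d}\<close> by auto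
    qed
  qed
  then show ?thesis using card_image[OF inj_on_subset[OF inj subset_UNIV], of "{l. ?f l \<le> d}"] by simp
qed

lemma det_nonzero_if_basis:
  fixes f :: "'n::finite \<Rightarrow> real^'n"
  assumes "inj f" "independent (range f)"
  shows "det (\<chi> i j. f j $ i) \<noteq> 0"
proof -
  let ?A = "(\<chi> i j. f j $ i) :: real^'n^'n"
  have col: "column j ?A = f j" for j by (simp add: column_def vec_eq_iff)
  have "c i = 0" if "(\<Sum>j\<in>UNIV. c j *s column j ?A) = 0" for c i
  proof -
    have "(\<Sum>v\<in>range f. c (inv f v) *\<^sub>R v) = (\<Sum>j\<in>UNIV. c j *\<^sub>R f j)"
      using assms(1) by (simp add: sum.reindex)
    then have "(\<Sum>v\<in>range f. c (inv f v) *\<^sub>R v) = 0" using that by (simp add: col scalar_mult_eq_scaleR)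
    then have "c (inv f (f i)) = 0"
      using independentD[OF assms(2), of "range f" "\<lambda>v. c (inv f v)" "f i"] by simp
    then show ?thesis using assms(1) by simp
  qed
  then have "\<exists>B. B ** ?A = mat 1" unfolding matrix_left_invertible_independent_columns by blast
  then show ?thesis using invertible_det_nz invertible_left_inverse by blast
qed

context carnot_manifold
begin

section \<open>Ranks of the fibres and bounds on the weights\<close>

lemma fibre_basis:
  assumes "(D, \<phi>) \<in> A" "x \<in> \<phi> ` D" "1 \<le> m" "m \<le> r"
  obtains B where "independent B" "card B = rk m" "finite B" "span B = H (D, \<phi>) m x"
proof -
  obtain V b where V: "x \<in> V" "\<forall>y\<in>V. inj_on (\<lambda>i::nat. b i y) {..<rk m} \<and>
      independent ((\<lambda>i. b i y) ` {..<rk m}) \<and> span ((\<lambda>i. b i y) ` {..<rk m}) = H (D, \<phi>) m y"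
    using subbundle[OF assms(1,3,4)] assms(2) unfolding subbundle_on_def by metis
  show thesis
    by (rule that[of "(\<lambda>i. b i x) ` {..<rk m}"]) (simp_all add: bspec[OF V(2,1)] card_image)
qed

lemma dim_fibre:
  assumes "(D, \<phi>) \<in> A" "x \<in> \<phi> ` D" "1 \<le> m" "m \<le> r"
  shows "dim (H (D, \<phi>) m x) = rk m"
proof -
  obtain B where "independent B" "card B = rk m" "span B = H (D, \<phi>) m x"
    using fibre_basis[OF assms] by metis
  then show ?thesis using dim_span_eq_card_independent[of B] by simp
qed

lemma rank_le: "(D, \<phi>) \<in> A \<Longrightarrow> x \<in> \<phi> ` D \<Longrightarrow> 1 \<le> m \<Longrightarrow> m \<le> r \<Longrightarrow> rk m \<le> CARD('n)"
  using dim_fibre[of D \<phi> x m] dim_subset_UNIV[of "H (D, \<phi>) m x"] by simp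

lemma rank_top:
  assumes "(D, \<phi>) \<in> A" "x \<in> \<phi> ` D"
  shows "rk r = CARD('n)"
  using dim_fibre[OF assms step] top[OF assms] by simp

lemma fibre_mono:
  assumes "(D, \<phi>) \<in> A" "x \<in> \<phi> ` D" "1 \<le> m" "m \<le> m'" "m' \<le> r"
  shows "H (D, \<phi>) m x \<subseteq> H (D, \<phi>) m' x"
  using assms(4,5)
proof (induction m' rule: dec_induct)
  case (step k)
  have "H (D, \<phi>) k x \<subseteq> H (D, \<phi>) (Suc k) x"
    using step.hyps step.prems assms(3) by (intro filtration assms(1,2)) auto
  then show ?case using step by auto
qed simp

lemma weight_bounds:
  fixes j :: 'n
  assumes "(D, \<phi>) \<in> A" "x \<in> \<phi> ` D"
  shows "1 \<le> weight rk j" "weight rk j \<le> r"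
proof -
  have "card {i. i \<le> j} \<le> rk r"
    using rank_top[OF assms] card_mono[of UNIV "{i. i \<le> j}"] by simp
  with step have *: "1 \<le> r \<and> card {i. i \<le> j} \<le> rk r" by simp
  then show "1 \<le> weight rk j" unfolding weight_def by (rule LeastI2) simp
  show "weight rk j \<le> r" unfolding weight_def by (rule Least_le) (rule *)
qed

text \<open>A dimension count: the frame vectors of weight at most \<open>m\<close> are independent
  elements of the fibre, and there are at least \<open>rk m\<close> of them, since every position up
  to \<open>rk m\<close> has weight at most \<open>m\<close>.\<close>

lemma fibre_eq_span_frame:
  assumes "(D, \<phi>) \<in> A" and frame: "H_frame_on (\<phi> ` D) (weight rk) (H (D, \<phi>)) X"
    and x: "x \<in> \<phi> ` D" and m: "1 \<le> m" "m \<le> r"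
  shows "H (D, \<phi>) m x \<subseteq> span ((\<lambda>j. X j x) ` {j. weight rk j \<le> m})"
proof -
  let ?J = "{j :: 'n. weight rk j \<le> m}" and ?f = "\<lambda>j. X j x"
  have inj: "inj ?f" and ind: "independent (range ?f)" and sec: "\<And>j. ?f j \<in> H (D, \<phi>) (weight rk j) x"
    using frame x unfolding H_frame_on_def smooth_section_on_def by blast+
  show ?thesis
  proof (rule card_ge_dim_independent)
    show "?f ` ?J \<subseteq> H (D, \<phi>) m x"
    proof
      fix v assume "v \<in> ?f ` ?J"
      then obtain j where j: "v = X j x" "weight rk j \<le> m" by blast
      have "X j x \<in> H (D, \<phi>) (weight rk j) x" by (rule sec)
      also have "\<dots> \<subseteq> H (D, \<phi>) m x"
        by (rule fibre_mono[OF assms(1) x weight_bounds(1)[OF assms(1) x] j(2) m(2)])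
      finally show "v \<in> H (D, \<phi>) m x" unfolding j(1) .
    qed
    show "independent (?f ` ?J)" using ind by (rule independent_mono) auto
    have "{l :: 'n. card {i. i \<le> l} \<le> rk m} \<subseteq> ?J"
      using m(1) by (auto simp: weight_def intro: Least_le)
    from card_mono[OF _ this] have "rk m \<le> card ?J"
      using card_initial_segments[OF rank_le[OF assms(1) x m]] by simp
    also have "\<dots> = card (?f ` ?J)"
      by (rule card_image[symmetric, OF inj_on_subset[OF inj subset_UNIV]])
    finally show "dim (H (D, \<phi>) m x) \<le> card (?f ` ?J)" unfolding dim_fibre[OF assms(1) x m] .
  qed
qed

text \<open>The bracket lies in the subbundle whose index is the sum of the two weights, hence in
  the span of frame fields of at most that weight. Nonemptiness supplies a point at which the ranks,
  and thereby the weights, are controlled.\<close>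

lemma weighted_frame_if_H_frame:
  assumes "(D, \<phi>) \<in> A" and frame: "H_frame_on (\<phi> ` D) (weight rk) (H (D, \<phi>)) X" and "\<phi> ` D \<noteq> {}"
  shows "weighted_frame (\<phi> ` D) X (weight rk)"
proof -
  let ?U = "\<phi> ` D" and ?w = "weight rk"
  have op: "open ?U" by (rule chart_image[OF assms(1)])
  have sec: "smooth_section_on ?U (H (D, \<phi>) (?w j)) (X j)" for j
    using frame by (simp add: H_frame_on_def)
  interpret frame ?U X
  proof
    show "smooth_on ?U (X j)" for j using sec by (simp add: smooth_section_on_def)
    show "det (\<chi> i j. X j x $ i) \<noteq> 0" if "x \<in> ?U" for x
      using frame that by (intro det_nonzero_if_basis) (auto simp: H_frame_on_def)
  qed (rule op)
  show ?thesis
  proof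
    obtain x where "x \<in> ?U" using assms(3) by blast
    then show "0 < ?w j" for j :: 'n using weight_bounds(1)[OF assms(1), of x j] by linarith
  next
    fix x and i j k :: 'n assume x: "x \<in> ?U" and less: "?w i + ?w j < ?w k"
    note wb = weight_bounds[OF assms(1) x]
    let ?m = "?w i + ?w j"
    \<comment> \<open>The index stays within the filtration because it is below \<open>?w k\<close>,
      which is at most \<open>r\<close>.\<close>
    have m: "1 \<le> ?m" "?m \<le> r" using wb(1)[of i] wb(2)[of k] less by linarith+
    have "smooth_section_on ?U (H (D, \<phi>) ?m) (lie_bracket (X i) (X j))"
      by (rule bracket[OF assms(1) op subset_refl wb(1) wb(1) m(2) sec sec])
    then have "lie_bracket (X i) (X j) x \<in> span ((\<lambda>j. X j x) ` {j. ?w j \<le> ?m})"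
      using fibre_eq_span_frame[OF assms(1) frame x m] x unfolding smooth_section_on_def by blast
    also have "\<dots> \<subseteq> {v. frame_coords X x v $ k = 0}"
    proof (rule span_minimal)
      show "(\<lambda>j. X j x) ` {j. ?w j \<le> ?m} \<subseteq> {v. frame_coords X x v $ k = 0}"
        using less by (auto simp: frame_coords_frame[OF x] axis_def)
      show "subspace {v. frame_coords X x v $ k = 0}"
        using linear_0[OF linear_frame_coords[OF x]] linear_add[OF linear_frame_coords[OF x]]
          linear_scale[OF linear_frame_coords[OF x]]
        by (simp add: subspace_def)
    qed
    finally show "frame_coords X x (lie_bracket (X i) (X j) x) $ k = 0" by simp
  qed
qed

end

lemma smooth_on_empty: "smooth_on {} f"
proof -
  have "C_diff_on k {} f" for k by (induction k arbitrary: f) auto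
  then show ?thesis by (simp add: smooth_on_def)
qed

theorem corollary8p3:
  fixes M :: "'m topology" and A :: "('m, 'n::{finite,linorder}) chart set"
    and r :: nat and rk :: "nat \<Rightarrow> nat"
    and H :: "('m, 'n) chart \<Rightarrow> nat \<Rightarrow> (real, 'n) vec \<Rightarrow> (real, 'n) vec set"
    and D :: "'m set" and \<kappa> :: "'m \<Rightarrow> (real, 'n) vec" and U :: "(real, 'n) vec set"
    and X :: "'n \<Rightarrow> (real, 'n) vec \<Rightarrow> (real, 'n) vec"
  assumes "carnot_manifold M A r rk H"
    and "(D, \<kappa>) \<in> A"
    and "U = \<kappa> ` D"
    and "H_frame_on U (weight rk) (H (D, \<kappa>)) X"
  shows "smooth_on (U \<times> UNIV) (\<lambda>(x, y). eps_carnot U (weight rk) X x y) \<and>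
         smooth_on (U \<times> UNIV) (\<lambda>(x, y). inv (eps_carnot U (weight rk) X x) y)"
proof (cases "U = {}")
  \<comment> \<open>An empty chart domain gives no information on \<open>rk\<close>, so positivity
    of the weights cannot be drawn from this chart; smoothness on the empty set is vacuous.\<close>
  case True
  then show ?thesis by (simp add: smooth_on_empty)
next
  case False
  then interpret weighted_frame U X "weight rk"
    using carnot_manifold.weighted_frame_if_H_frame[OF assms(1,2)] assms(3,4) by simp
  show ?thesis using smooth_on_eps_carnot by blast
qed

end
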